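(* Let $\mathbf z_1,\dots,\mathbf z_n$ be a random sample from the distribution of a random vector $\mathbf z\in\mathbb R^p$ with mutually independent components having mean $0$ and variance $1$. Notation is as in the context. (i) Suppose $\mathbf z$ has finite sixth moments and at most one of $\gamma_1,\dots,\gamma_p$ is zero. Then there exists a sequence of all-cumulant-matrices solutions $\hat{\mathbf W}$ based on skewness (that is, $\alpha=1$) such that $\hat{\mathbf W}\to_P\mathbf I_p$ and $$\sqrt n(\hat w_{kk}-1)=-\tfrac12\sqrt n(\hat s_{kk}-1)+o_P(1),\qquad \sqrt n\,\hat w_{kl}=\frac{\sqrt n\,\hat\psi_{1kl}}{\gamma_k^2+\gamma_l^2}+o_P(1),\quad l\ne k,$$ where $\hat\psi_{1kl}=\gamma_k\hat r_{kl}-\gamma_l\hat r_{lk}-\gamma_k^2\hat s_{kl}$. (ii) Suppose $\mathbf z$ has finite eighth moments and at most one of $\kappa_1,\dots,\kappa_p$ is zero. Then there exists a sequence of all-cumulant-matrices solutions $\hat{\mathbf W}$ based on kurtosis (that is, $\alpha=0$) such that $\hat{\mathbf W}\to_P\mathbf I_p$ and $$\sqrt n(\hat w_{kk}-1)=-\tfrac12\sqrt n(\hat s_{kk}-1)+o_P(1),\qquad \sqrt n\,\hat w_{kl}=\frac{\sqrt n\,\hat\psi_{2kl}}{\kappa_k^2+\kappa_l^2}+o_P(1),\quad l\ne k,$$ where $\hat\psi_{2kl}=\kappa_k\hat q_{kl}-\kappa_l\hat q_{lk}-(\kappa_k\beta_k-3\kappa_l)\hat s_{kl}$. (iii) Suppose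 $\mathbf z$ has finite eighth moments and $\gamma_k=\kappa_k=0$ for at most one $k$. Then there exists a sequence of all-cumulant-matrices solutions $\hat{\mathbf W}$ based on both skewness and kurtosis such that $\hat{\mathbf W}\to_P\mathbf I_p$ and $$\sqrt n(\hat w_{kk}-1)=-\tfrac12\sqrt n(\hat s_{kk}-1)+o_P(1),$$ $$\sqrt n\,\hat w_{kl}=\frac{\alpha\sqrt n\,\hat\psi_{1kl}+(1-\alpha)\sqrt n\,\hat\psi_{2kl}}{\alpha(\gamma_k^2+\gamma_l^2)+(1-\alpha)(\kappa_k^2+\kappa_l^2)}+o_P(1),\quad l\neq k,$$ where $\alpha\in[0,1]$ is the proportion of weight given to skewness, and $\hat\psi_{1kl}$ and $\hat\psi_{2kl}$ are as in (i) and (ii).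
   Context: Moments: $\gamma_k=E(z_k^3)$, $\beta_k=E(z_k^4)$, $\kappa_k=\beta_k-3$, where $z_k$ is the $k$th component of $\mathbf z$. Write $\mathbf z_i=(z_{i1},\dots,z_{ip})^T$ and $$\hat s_{kl}=\frac1n\sum_{i=1}^n z_{ik}z_{il},\quad \hat r_{kl}=\frac1n\sum_{i=1}^n(z_{ik}^2-1)z_{il},\quad \hat q_{kl}=\frac1n\sum_{i=1}^n(z_{ik}^3-\gamma_k)z_{il}.$$ Cumulant matrices: for a random $p$-vector $\mathbf x$ with mean zero, $\mathbf C^{3i}(\mathbf x)=E[x_i\mathbf x\mathbf x^T]$ and $\mathbf C^{4ij}(\mathbf x)=E[x_ix_j\mathbf x\mathbf x^T]-E(x_ix_j)E(\mathbf x\mathbf x^T)-E(x_i\mathbf x)E(x_j\mathbf x^T)-E(x_j\mathbf x)E(x_i\mathbf x^T)$, $i,j=1,\dots,p$. Estimate based on all cumulant matrices (weight $\alpha\in[0,1]$): let $\bar{\mathbf z}=\frac1n\sum_i\mathbf z_i$, $\hat{\boldsymbol\Sigma}=\frac1n\sum_i(\mathbf z_i-\bar{\mathbf z})(\mathbf z_i-\bar{\mathbf z})^T$ (nonsingular with probability tending to one), and let $\hat{\mathbf C}^{3i},\hat{\mathbf C}^{4ij}$ be the cumulant matrices $\mathbf C^{3i}(\mathbf x),\mathbf C^{4ij}(\mathbf x)$ with $\mathbf x$ distributed according to the empirical distribution of $\hat{\boldsymbol\Sigma}^{-1/2}(\mathbf z_i-\bar{\mathbf z})$, $i=1,\dots,n$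 (symmetric positive definite root). An all-cumulant-matrices solution is $\hat{\mathbf W}=(\hat w_{kl})=\hat{\mathbf U}\hat{\boldsymbol\Sigma}^{-1/2}$, where $\hat{\mathbf U}$ maximizes $$\alpha\sum_{i=1}^p\|\mathrm{diag}(\mathbf U\hat{\mathbf C}^{3i}\mathbf U^T)\|^2+(1-\alpha)\sum_{i=1}^p\sum_{j=1}^p\|\mathrm{diag}(\mathbf U\hat{\mathbf C}^{4ij}\mathbf U^T)\|^2$$ over orthogonal $\mathbf U$; $\mathrm{diag}(\mathbf A)$ is the diagonal matrix with the diagonal of $\mathbf A$ and $\|\cdot\|$ is the Frobenius norm. Limits are as $n\to\infty$.
   Formalization: In (iii), at the endpoint α=1 it is additionally assumed that at most one γ_k is zero, and at α=0 that at most one κ_k is zero; otherwise a displayed denominator vanishes and the formula is undefined. *)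

theory Defs
  imports "HOL-Probability.Probability"
begin

(* Measurability is part of the definition because measure assigns 0 to
   non-measurable sets; without it, convergence could hold for no good reason. *)
definition conv_in_prob ::
    "'a measure \<Rightarrow> (nat \<Rightarrow> 'a \<Rightarrow> 'b::metric_space) \<Rightarrow> 'b \<Rightarrow> bool" where
  "conv_in_prob M X c \<longleftrightarrow>
     (\<forall>n. X n \<in> borel_measurable M) \<and>
     (\<forall>\<epsilon>>0. (\<lambda>n. measure M {\<omega> \<in> space M. dist (X n \<omega>) c > \<epsilon>}) \<longlonglongrightarrow> 0)"

(* X n = Y n + o_P(1) *)
definition eq_up_to_oP ::
    "'a measure \<Rightarrow> (nat \<Rightarrow> 'a \<Rightarrow> real) \<Rightarrow> (nat \<Rightarrow> 'a \<Rightarrow> real) \<Rightarrow> bool" where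
  "eq_up_to_oP M X Y \<longleftrightarrow> conv_in_prob M (\<lambda>n \<omega>. X n \<omega> - Y n \<omega>) 0"

definition has_moments :: "'a measure \<Rightarrow> ('a \<Rightarrow> real ^ 'p) \<Rightarrow> nat \<Rightarrow> bool" where
  "has_moments N z m \<longleftrightarrow> (\<forall>k. integrable N (\<lambda>\<omega>. \<bar>z \<omega> $ k\<bar> ^ m))"

definition third_moment :: "'a measure \<Rightarrow> ('a \<Rightarrow> real ^ 'p) \<Rightarrow> 'p \<Rightarrow> real" where
  "third_moment N z k = (LINT \<omega>|N. (z \<omega> $ k) ^ 3)"

definition fourth_moment :: "'a measure \<Rightarrow> ('a \<Rightarrow> real ^ 'p) \<Rightarrow> 'p \<Rightarrow> real" where
  "fourth_moment N z k = (LINT \<omega>|N. (z \<omega> $ k) ^ 4)"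

definition excess_kurtosis :: "'a measure \<Rightarrow> ('a \<Rightarrow> real ^ 'p) \<Rightarrow> 'p \<Rightarrow> real" where
  "excess_kurtosis N z k = fourth_moment N z k - 3"

(* Entrywise versions of E[x_i x x^T] and of
   E[x_i x_j x x^T] - E(x_i x_j) E(x x^T) - E(x_i x) E(x_j x^T) - E(x_j x) E(x_i x^T),
   for a centred random vector x on M. *)
definition cumulant3 ::
    "'a measure \<Rightarrow> ('a \<Rightarrow> real ^ 'p) \<Rightarrow> 'p \<Rightarrow> real ^ 'p ^ 'p" where
  "cumulant3 M x i = (\<chi> k l. LINT \<omega>|M. x \<omega> $ i * x \<omega> $ k * x \<omega> $ l)"

definition cumulant4 ::
    "'a measure \<Rightarrow> ('a \<Rightarrow> real ^ 'p) \<Rightarrow> 'p \<Rightarrow> 'p \<Rightarrow> real ^ 'p ^ 'p" where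
  "cumulant4 M x i j = (\<chi> k l.
       (LINT \<omega>|M. x \<omega> $ i * x \<omega> $ j * x \<omega> $ k * x \<omega> $ l)
     - (LINT \<omega>|M. x \<omega> $ i * x \<omega> $ j) * (LINT \<omega>|M. x \<omega> $ k * x \<omega> $ l)
     - (LINT \<omega>|M. x \<omega> $ i * x \<omega> $ k) * (LINT \<omega>|M. x \<omega> $ j * x \<omega> $ l)
     - (LINT \<omega>|M. x \<omega> $ j * x \<omega> $ k) * (LINT \<omega>|M. x \<omega> $ i * x \<omega> $ l))"

(* In all sample quantities the observations are x 0, ..., x (n - 1). *)
definition sample_mean :: "nat \<Rightarrow> (nat \<Rightarrow> real ^ 'p) \<Rightarrow> real ^ 'p" where
  "sample_mean n x = (1 / real n) *\<^sub>R (\<Sum>i<n. x i)"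

definition sample_cov :: "nat \<Rightarrow> (nat \<Rightarrow> real ^ 'p) \<Rightarrow> real ^ 'p ^ 'p" where
  "sample_cov n x = (\<chi> k l. (1 / real n) *
     (\<Sum>i<n. (x i - sample_mean n x) $ k * (x i - sample_mean n x) $ l))"

(* A^(-1/2), the symmetric positive definite root of the inverse; the description
   is meaningful only for symmetric positive definite A, such as an invertible
   sample covariance matrix. *)
definition inv_sqrt :: "real ^ 'p ^ 'p \<Rightarrow> real ^ 'p ^ 'p" where
  "inv_sqrt A = (THE B. transpose B = B \<and> (\<forall>v. v \<noteq> 0 \<longrightarrow> 0 < v \<bullet> (B *v v)) \<and>
                        B ** B = matrix_inv A)"

definition standardized :: "nat \<Rightarrow> (nat \<Rightarrow> real ^ 'p) \<Rightarrow> nat \<Rightarrow> real ^ 'p" where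
  "standardized n x i = inv_sqrt (sample_cov n x) *v (x i - sample_mean n x)"

(* A vector drawn from the empirical distribution of the standardized observations
   is realized as standardized n x evaluated at a uniform index in {..<n}. *)
definition sample_cumulant3 ::
    "nat \<Rightarrow> (nat \<Rightarrow> real ^ 'p) \<Rightarrow> 'p \<Rightarrow> real ^ 'p ^ 'p" where
  "sample_cumulant3 n x i =
     cumulant3 (uniform_count_measure {..<n}) (standardized n x) i"

definition sample_cumulant4 ::
    "nat \<Rightarrow> (nat \<Rightarrow> real ^ 'p) \<Rightarrow> 'p \<Rightarrow> 'p \<Rightarrow> real ^ 'p ^ 'p" where
  "sample_cumulant4 n x i j =
     cumulant4 (uniform_count_measure {..<n}) (standardized n x) i j"

definition diag_part :: "real ^ 'p ^ 'p \<Rightarrow> real ^ 'p ^ 'p" where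
  "diag_part A = (\<chi> k l. if k = l then A $ k $ l else 0)"

(* The norm of type real ^ 'p ^ 'p is the Frobenius norm. *)
definition acm_objective ::
    "real \<Rightarrow> nat \<Rightarrow> (nat \<Rightarrow> real ^ 'p) \<Rightarrow> real ^ 'p ^ 'p \<Rightarrow> real" where
  "acm_objective \<alpha> n x U =
     \<alpha> * (\<Sum>i\<in>UNIV. (norm (diag_part (U ** sample_cumulant3 n x i ** transpose U)))\<^sup>2)
     + (1 - \<alpha>) * (\<Sum>i\<in>UNIV. \<Sum>j\<in>UNIV.
         (norm (diag_part (U ** sample_cumulant4 n x i j ** transpose U)))\<^sup>2)"

definition acm_solution ::
    "real \<Rightarrow> nat \<Rightarrow> (nat \<Rightarrow> real ^ 'p) \<Rightarrow> real ^ 'p ^ 'p \<Rightarrow> bool" where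
  "acm_solution \<alpha> n x W \<longleftrightarrow>
     (\<exists>U. is_arg_max (acm_objective \<alpha> n x) orthogonal_matrix U \<and>
          W = U ** inv_sqrt (sample_cov n x))"

(* A solution is defined only for an invertible sample covariance matrix; W n is an
   arbitrary measurable function on the complementary event. *)
definition acm_solution_sequence ::
    "'a measure \<Rightarrow> (nat \<Rightarrow> 'a \<Rightarrow> real ^ 'p) \<Rightarrow> real \<Rightarrow> (nat \<Rightarrow> 'a \<Rightarrow> real ^ 'p ^ 'p) \<Rightarrow> bool" where
  "acm_solution_sequence M Z \<alpha> W \<longleftrightarrow>
     (\<forall>n. W n \<in> borel_measurable M \<and>
        (\<forall>\<omega>\<in>space M. invertible (sample_cov n (\<lambda>i. Z i \<omega>)) \<longrightarrow>
           acm_solution \<alpha> n (\<lambda>i. Z i \<omega>) (W n \<omega>)))"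

definition s_hat :: "nat \<Rightarrow> (nat \<Rightarrow> real ^ 'p) \<Rightarrow> 'p \<Rightarrow> 'p \<Rightarrow> real" where
  "s_hat n x k l = (1 / real n) * (\<Sum>i<n. x i $ k * x i $ l)"

definition r_hat :: "nat \<Rightarrow> (nat \<Rightarrow> real ^ 'p) \<Rightarrow> 'p \<Rightarrow> 'p \<Rightarrow> real" where
  "r_hat n x k l = (1 / real n) * (\<Sum>i<n. ((x i $ k)\<^sup>2 - 1) * x i $ l)"

definition q_hat :: "('p \<Rightarrow> real) \<Rightarrow> nat \<Rightarrow> (nat \<Rightarrow> real ^ 'p) \<Rightarrow> 'p \<Rightarrow> 'p \<Rightarrow> real" where
  "q_hat \<gamma> n x k l = (1 / real n) * (\<Sum>i<n. ((x i $ k) ^ 3 - \<gamma> k) * x i $ l)"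

definition psi1_hat ::
    "('p \<Rightarrow> real) \<Rightarrow> nat \<Rightarrow> (nat \<Rightarrow> real ^ 'p) \<Rightarrow> 'p \<Rightarrow> 'p \<Rightarrow> real" where
  "psi1_hat \<gamma> n x k l =
     \<gamma> k * r_hat n x k l - \<gamma> l * r_hat n x l k - (\<gamma> k)\<^sup>2 * s_hat n x k l"

definition psi2_hat ::
    "('p \<Rightarrow> real) \<Rightarrow> ('p \<Rightarrow> real) \<Rightarrow> ('p \<Rightarrow> real) \<Rightarrow>
     nat \<Rightarrow> (nat \<Rightarrow> real ^ 'p) \<Rightarrow> 'p \<Rightarrow> 'p \<Rightarrow> real" where
  "psi2_hat \<gamma> \<beta> \<kappa> n x k l =
     \<kappa> k * q_hat \<gamma> n x k l - \<kappa> l * q_hat \<gamma> n x l k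
     - (\<kappa> k * \<beta> k - 3 * \<kappa> l) * s_hat n x k l"

end

theory Submission
  imports Defs "HOL-Library.Landau_Symbols"
begin

text \<open>
  All \<open>o\<^sub>P\<close> statements are reduced to deterministic expansions: outside an event of probability
  \<open>O(K\<^sup>-\<^sup>2)\<close> (Chebyshev) all empirical moments of order at most 3 or 4 are within \<open>K / \<surd>n\<close> of their
  expectations, and on the complement everything is expanded uniformly up to \<open>o(1 / \<surd>n)\<close>.

  There the sample covariance matrix is \<open>1 + R\<close> with \<open>R = O(1 / \<surd>n)\<close>, so its inverse root is
  \<open>1 - R / 2\<close> to first order, which gives the expansion of the cumulant matrices of the
  whitened sample. They converge to the population matrices, which vanish except for a
  single diagonal entry \<open>\<gamma>\<^sub>i\<close> or \<open>\<kappa>\<^sub>i\<close>. Hence the limiting objective is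
  \<open>\<Sum>\<^sub>i (\<alpha> \<gamma>\<^sub>i\<^sup>2 + (1 - \<alpha>) \<kappa>\<^sub>i\<^sup>2) \<Sum>\<^sub>k u\<^sub>k\<^sub>i\<^sup>4\<close>, whose maximizers over the orthogonal matrices are the signed
  permutation matrices as soon as at most one weight vanishes. The objective is invariant under signed
  permutations, so the maximizer nearest to the identity converges to the identity; it can be chosen
  measurably. Its first-order condition, obtained by rotating two rows, linearizes to the stated formula.
\<close>

section \<open>Square roots of positive definite matrices\<close>

text \<open>No limit law is used: the only probabilistic estimate is Chebyshev's inequality for the
  sample mean of a monomial of degree at most \<open>r\<close>. It costs the second moment of the
  monomial, which is why \<open>r = 3\<close> asks for sixth and \<open>r = 4\<close> for eighth
  moments. The obstacle is the choice of the maximizer. The objective does not see the order and the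
  signs of the rows of \<open>U\<close>, so consistency depends on which maximizer is taken; the
  choice must moreover be measurable, since convergence in probability is only defined for
  measurable maps. Consistency alone gives no rate, so the rate has to be extracted from the
  stationarity equation itself. To first order \<open>U - 1\<close> is skew because \<open>U\<close>
  is orthogonal, while the inverse root contributes a symmetric matrix. On the diagonal only the
  root survives, which explains the common term \<open>- (1 / 2) * (s_hat - 1)\<close>; off the
  diagonal the two effects add, which makes the numerators asymmetric in \<open>k\<close> and
  \<open>l\<close>.\<close>

lemma self_adjoint_eigenvector_exists:
  fixes f :: "'a::euclidean_space \<Rightarrow> 'a"
  assumes f: "linear f" and sa: "\<And>x y. f x \<bullet> y = x \<bullet> f y"
    and S: "subspace S" "f ` S \<subseteq> S" "S \<noteq> {0}"
  shows "\<exists>v\<in>S. norm v = 1 \<and> (\<exists>e. f v = e *\<^sub>R v)"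
proof -
  have cont: "continuous_on T (\<lambda>x. x \<bullet> f x)" for T
    by (intro continuous_intros linear_continuous_on linear_conv_bounded_linear[THEN iffD1] f)
  have "compact (S \<inter> sphere 0 1)"
    by (intro closed_Int_compact closed_subspace S(1) compact_sphere)
  moreover have "S \<inter> sphere 0 1 \<noteq> {}"
  proof -
    obtain x where "x \<in> S" "x \<noteq> 0" using S(1,3) subspace_0 by blast
    then have "(1 / norm x) *\<^sub>R x \<in> S \<inter> sphere 0 1"
      using S(1) by (simp add: subspace_scale)
    then show ?thesis by blast
  qed
  ultimately obtain v where v: "v \<in> S" "norm v = 1"
    and vmax: "\<And>y. y \<in> S \<Longrightarrow> norm y = 1 \<Longrightarrow> y \<bullet> f y \<le> v \<bullet> f v"
    using continuous_attains_sup[OF _ _ cont, of "S \<inter> sphere 0 1"] by fastforce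
  define e where "e = v \<bullet> f v"
  define w where "w = e *\<^sub>R v - f v"
  have wS: "w \<in> S"
    unfolding w_def using S v by (intro subspace_diff subspace_scale) auto
  have form: "x \<bullet> f x \<le> e * (x \<bullet> x)" if "x \<in> S" for x
  proof (cases "x = 0")
    case False
    let ?y = "(1 / norm x) *\<^sub>R x"
    have "?y \<bullet> f ?y \<le> e"
      unfolding e_def by (rule vmax) (use that S False in \<open>auto simp: subspace_scale\<close>)
    then have "(x \<bullet> f x) / (norm x)\<^sup>2 \<le> e"
      by (simp add: linear_scale[OF f] power2_eq_square)
    with False show ?thesis
      by (simp add: divide_le_eq power2_norm_eq_inner)
  qed (simp add: linear_0[OF f])
  \<comment> \<open>First variation: on \<open>S\<close> the form is at most \<open>e\<close> times
    the squared norm, with equality at \<open>v\<close>. Along \<open>v + t w\<close> the gap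
    between the two has the linear term \<open>2 * t * (w \<bullet> w)\<close>, so a small negative
    \<open>t\<close> would make it negative.\<close>
  have "w = 0"
  proof (rule ccontr)
    assume "w \<noteq> 0"
    define c where "c = e * (w \<bullet> w) - w \<bullet> f w"
    have quad: "0 \<le> 2 * t * (w \<bullet> w) + t\<^sup>2 * c" for t
    proof -
      have fw: "v \<bullet> f w = w \<bullet> f v" using sa[of v w] by (simp add: inner_commute)
      have ww: "w \<bullet> w = e * (w \<bullet> v) - w \<bullet> f v"
        by (subst (2) w_def) (simp add: inner_diff_right)
      have vv: "v \<bullet> v = 1" using v by (simp add: norm_eq_1)
      have "(v + t *\<^sub>R w) \<bullet> f (v + t *\<^sub>R w) \<le> e * ((v + t *\<^sub>R w) \<bullet> (v + t *\<^sub>R w))"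
        by (rule form) (use v wS S in \<open>auto intro: subspace_add subspace_scale\<close>)
      then have "e + 2 * t * (w \<bullet> f v) + t\<^sup>2 * (w \<bullet> f w)
          \<le> e * (1 + 2 * t * (w \<bullet> v) + t\<^sup>2 * (w \<bullet> w))"
        by (simp add: linear_add[OF f] linear_scale[OF f] inner_add_left inner_add_right
            fw inner_commute[of v w] vv e_def power2_eq_square algebra_simps)
      then show ?thesis unfolding c_def ww by (simp add: algebra_simps)
    qed
    have pos: "w \<bullet> w > 0" using \<open>w \<noteq> 0\<close> by simp
    \<comment> \<open>The denominator exceeds \<open>c\<close> in absolute value, so the quadratic
      term of \<open>quad\<close> is at most half the size of the linear one, whatever the sign of
      \<open>c\<close>.\<close>
    define t where "t = - (w \<bullet> w) / (\<bar>c\<bar> + 1)"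
    have "t\<^sup>2 * c \<le> t\<^sup>2 * (\<bar>c\<bar> + 1)" by (intro mult_left_mono) auto
    also have "\<dots> = (w \<bullet> w)\<^sup>2 / (\<bar>c\<bar> + 1)"
      by (simp add: t_def power2_eq_square add_nonneg_eq_0_iff)
    also have "\<dots> < 2 * ((w \<bullet> w)\<^sup>2 / (\<bar>c\<bar> + 1))"
    proof -
      have "0 < (w \<bullet> w)\<^sup>2 / (\<bar>c\<bar> + 1)" using pos by (intro divide_pos_pos) auto
      then show ?thesis by linarith
    qed
    also have "\<dots> = - (2 * t * (w \<bullet> w))"
      by (simp add: t_def power2_eq_square)
    finally show False using quad[of t] by simp
  qed
  then have "f v = e *\<^sub>R v" by (simp add: w_def)
  then show ?thesis using v by blast
qed

text \<open>Deflation: self-adjointness makes the orthogonal complement of an eigenvector within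
  \<open>S\<close> invariant again. The claim is therefore made for all invariant subspaces and
  proved by induction on the dimension.\<close>

lemma self_adjoint_eigenbasis:
  fixes f :: "'a::euclidean_space \<Rightarrow> 'a"
  assumes f: "linear f" and sa: "\<And>x y. f x \<bullet> y = x \<bullet> f y"
    and "subspace S" "f ` S \<subseteq> S"
  shows "\<exists>B. finite B \<and> pairwise orthogonal B \<and>
    (\<forall>b\<in>B. norm b = 1 \<and> (\<exists>e. f b = e *\<^sub>R b)) \<and> span B = S"
  using assms(3,4)
proof (induction "dim S" arbitrary: S rule: less_induct)
  case less
  show ?case
  proof (cases "S = {0}")
    case True
    then show ?thesis by (intro exI[of _ "{}"]) auto
  next
    case False
    then obtain v e where v: "v \<in> S" "norm v = 1" "f v = e *\<^sub>R v"
      using self_adjoint_eigenvector_exists[OF f sa less.prems] by blast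
    define T where "T = {x \<in> S. v \<bullet> x = 0}"
    have T: "subspace T"
      unfolding T_def using less.prems(1)
      by (auto simp: subspace_def inner_add_right)
    have "v \<notin> T" using v by (auto simp: T_def)
    then have "T \<subset> S" using v(1) unfolding T_def by blast
    then have "dim T < dim S"
      using T less.prems(1) by (intro dim_psubset) (simp add: span_eq_iff[THEN iffD2])
    moreover have "f ` T \<subseteq> T"
    proof safe
      fix x assume "x \<in> T"
      then show "f x \<in> T"
        using less.prems(2) sa[of v x] v(3) by (auto simp: T_def)
    qed
    ultimately obtain B where B: "finite B" "pairwise orthogonal B"
      "\<forall>b\<in>B. norm b = 1 \<and> (\<exists>e. f b = e *\<^sub>R b)" "span B = T"
      using less.hyps T by blast
    have BT: "B \<subseteq> T" using B(4) span_superset by blast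
    have "span (insert v B) = S"
    proof
      show "span (insert v B) \<subseteq> S"
        using BT v \<open>T \<subset> S\<close> less.prems(1) by (intro span_minimal) auto
      show "S \<subseteq> span (insert v B)"
      proof
        fix x assume "x \<in> S"
        then have "x - (v \<bullet> x) *\<^sub>R v \<in> T"
          unfolding T_def using less.prems(1) v
          by (auto simp: inner_diff_right norm_eq_1 intro!: subspace_diff subspace_scale)
        then show "x \<in> span (insert v B)"
          using B(4) span_breakdown_eq by blast
      qed
    qed
    moreover have "pairwise orthogonal (insert v B)"
      using B(2) BT by (auto simp: pairwise_insert T_def orthogonal_def inner_commute)
    ultimately show ?thesis
      using B v by (intro exI[of _ "insert v B"]) auto
  qed
qed

text \<open>Symmetry is part of the notion, so that this is exactly the condition that
  \<open>inv_sqrt\<close> puts on the root.\<close>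

definition pos_def :: "real ^ 'n ^ 'n \<Rightarrow> bool" where
  "pos_def A \<longleftrightarrow> transpose A = A \<and> (\<forall>v. v \<noteq> 0 \<longrightarrow> 0 < v \<bullet> (A *v v))"

lemma pos_def_mat_1: "pos_def (mat 1)"
  by (simp add: pos_def_def)

lemma pos_def_invertible: "pos_def A \<Longrightarrow> invertible A"
  by (metis inner_zero_right less_irrefl matrix_left_invertible_ker pos_def_def invertible_left_inverse)

lemma matrix_inv_inverse:
  fixes A :: "real ^ 'n ^ 'n"
  assumes "invertible A"
  shows "A ** matrix_inv A = mat 1" "matrix_inv A ** A = mat 1"
  using someI_ex[OF assms[unfolded invertible_def]] unfolding matrix_inv_def by auto

lemma matrix_inv_unique:
  fixes A :: "real ^ 'n ^ 'n"
  assumes "A ** B = mat 1"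
  shows "matrix_inv A = B"
proof -
  have "invertible A" using assms invertible_right_inverse by blast
  then show ?thesis
    by (metis assms matrix_inv_inverse(2) matrix_mul_assoc matrix_mul_lid matrix_mul_rid)
qed

lemma pos_def_matrix_inv:
  assumes "pos_def A"
  shows "pos_def (matrix_inv A)"
proof -
  let ?B = "matrix_inv A"
  have inv: "A ** ?B = mat 1" "?B ** A = mat 1"
    using assms pos_def_invertible matrix_inv_inverse by blast+
  have sym: "transpose A = A" using assms by (simp add: pos_def_def)
  have "A ** transpose ?B = mat 1"
    by (metis inv(2) sym matrix_transpose_mul transpose_mat)
  then have "transpose ?B = ?B" using matrix_inv_unique by metis
  moreover have "0 < v \<bullet> (?B *v v)" if "v \<noteq> 0" for v
  proof -
    let ?w = "?B *v v"
    have v: "v = A *v ?w" by (simp add: matrix_vector_mul_assoc inv)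
    then have "?w \<noteq> 0" using that by auto
    then have "0 < ?w \<bullet> (A *v ?w)" using assms by (simp add: pos_def_def)
    then show ?thesis using v by (simp add: inner_commute)
  qed
  ultimately show ?thesis by (simp add: pos_def_def)
qed

lemma pos_def_sqrt_exists:
  fixes A :: "real ^ 'n ^ 'n"
  assumes "pos_def A"
  shows "\<exists>R. pos_def R \<and> R ** R = A"
proof -
  have sym: "(A *v x) \<bullet> y = x \<bullet> (A *v y)" for x y
    using assms by (simp add: dot_lmul_matrix pos_def_def flip: vector_transpose_matrix)
  have lin: "linear (\<lambda>x. A *v x)" by simp
  obtain B where B: "finite B" "pairwise orthogonal B" "\<And>b. b \<in> B \<Longrightarrow> norm b = 1"
    "\<And>b. b \<in> B \<Longrightarrow> \<exists>e. A *v b = e *\<^sub>R b" "span B = UNIV"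
    using self_adjoint_eigenbasis[OF lin sym subspace_UNIV] by auto
  define e where "e b = b \<bullet> (A *v b)" for b
  have e: "A *v b = e b *\<^sub>R b" "e b > 0" if "b \<in> B" for b
  proof -
    from B(4)[OF that] obtain d where d: "A *v b = d *\<^sub>R b" by blast
    then have "d = e b" using B(3)[OF that] by (simp add: e_def norm_eq_1)
    then show "A *v b = e b *\<^sub>R b" using d by simp
    have "b \<noteq> 0" using B(3)[OF that] by auto
    then show "e b > 0" using assms by (simp add: e_def pos_def_def)
  qed
  have expand: "(\<Sum>b\<in>B. (x \<bullet> b) *\<^sub>R b) = x" for x
    using orthonormal_basis_expand[OF B(2,3) _ B(1), of x] B(5) by simp
  \<comment> \<open>The spectral square root: every eigenvector \<open>b\<close> is multiplied by
    the root of its eigenvalue.\<close>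
  define r where "r x = (\<Sum>b\<in>B. (sqrt (e b) * (x \<bullet> b)) *\<^sub>R b)" for x
  have r: "linear r"
    by (rule linearI) (simp_all add: r_def inner_add_left distrib_left scaleR_add_left
        sum.distrib scaleR_sum_right mult.left_commute)
  have rb: "r b = sqrt (e b) *\<^sub>R b" if "b \<in> B" for b
  proof -
    have "r b = (\<Sum>c\<in>B. if c = b then sqrt (e b) *\<^sub>R b else 0)"
      unfolding r_def
    proof (intro sum.cong refl)
      fix c assume c: "c \<in> B"
      show "(sqrt (e c) * (b \<bullet> c)) *\<^sub>R c = (if c = b then sqrt (e b) *\<^sub>R b else 0)"
        using B(3)[OF c] pairwiseD[OF B(2) c that]
        by (cases "c = b") (simp_all add: orthogonal_def norm_eq_1 inner_commute)
    qed
    then show ?thesis using that B(1) by simp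
  qed
  have rr: "r (r x) = A *v x" for x
  proof -
    have "r (r x) = (\<Sum>b\<in>B. (sqrt (e b) * (x \<bullet> b)) *\<^sub>R r b)"
      by (subst (2) r_def) (simp add: linear_sum[OF r] linear_scale[OF r])
    also have "\<dots> = (\<Sum>b\<in>B. (x \<bullet> b) *\<^sub>R (A *v b))"
    proof (intro sum.cong refl)
      fix b assume b: "b \<in> B"
      have "sqrt (e b) * sqrt (e b) = e b" using e(2)[OF b] by simp
      then show "(sqrt (e b) * (x \<bullet> b)) *\<^sub>R r b = (x \<bullet> b) *\<^sub>R (A *v b)"
        by (simp add: rb[OF b] e(1)[OF b] mult_ac)
    qed
    also have "\<dots> = A *v (\<Sum>b\<in>B. (x \<bullet> b) *\<^sub>R b)"
      by (simp add: linear_sum[OF lin] linear_scale[OF lin])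
    finally show ?thesis by (simp add: expand)
  qed
  have rsym: "r x \<bullet> y = x \<bullet> r y" for x y
  proof -
    have "r x \<bullet> y = (\<Sum>b\<in>B. sqrt (e b) * (x \<bullet> b) * (b \<bullet> y))"
      by (simp add: r_def inner_sum_left)
    also have "\<dots> = (\<Sum>b\<in>B. sqrt (e b) * (y \<bullet> b) * (x \<bullet> b))"
      by (intro sum.cong refl) (simp add: inner_commute[of y])
    also have "\<dots> = x \<bullet> r y"
      by (simp add: r_def inner_sum_right)
    finally show ?thesis .
  qed
  have rpos: "0 < x \<bullet> r x" if "x \<noteq> 0" for x
  proof -
    have eq: "x \<bullet> r x = (\<Sum>b\<in>B. sqrt (e b) * (x \<bullet> b)\<^sup>2)"
      by (simp add: r_def inner_sum_right power2_eq_square mult_ac)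
    obtain b where b: "b \<in> B" "x \<bullet> b \<noteq> 0"
    proof (rule ccontr)
      assume "\<not> thesis"
      then have "(\<Sum>b\<in>B. (x \<bullet> b) *\<^sub>R b) = 0" using that by (intro sum.neutral) auto
      then show False using expand[of x] \<open>x \<noteq> 0\<close> by simp
    qed
    show ?thesis unfolding eq
      by (rule sum_pos2[OF B(1) b(1)]) (use b e(2) in \<open>auto simp: less_imp_le\<close>)
  qed
  define R where "R = matrix r"
  have Rv: "R *v x = r x" for x unfolding R_def by (simp add: r)
  have "transpose R = R"
  proof -
    have "adjoint r = r" by (rule adjoint_unique) (simp add: rsym)
    then show ?thesis unfolding R_def using matrix_adjoint[OF r] by simp
  qed
  then have "pos_def R" by (simp add: pos_def_def Rv rpos)
  moreover have "R ** R = A"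
    by (simp add: matrix_eq Rv rr flip: matrix_vector_mul_assoc)
  ultimately show ?thesis by blast
qed

text \<open>With \<open>D = B - C\<close> one has \<open>B\<^sup>2 - C\<^sup>2 = B D + D C\<close>, and the inner
  product of the second summand with \<open>D\<close> is nonnegative.\<close>
lemma pos_def_sqrt_lipschitz:
  fixes B C :: "real ^ 'n ^ 'n"
  assumes B: "\<And>v. c * (v \<bullet> v) \<le> v \<bullet> (B *v v)" and C: "pos_def C"
  shows "c * norm (B - C) \<le> norm (B ** B - C ** C)"
proof -
  define D where "D = B - C"
  have eq: "B ** B - C ** C = B ** D + D ** C"
    unfolding D_def
    by (simp add: vec_eq_iff matrix_matrix_mult_def algebra_simps sum_subtractf)
  have "D \<bullet> (B ** D) = (\<Sum>j\<in>UNIV. column j D \<bullet> (B *v column j D))"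
    unfolding inner_vec_def column_def matrix_matrix_mult_def matrix_vector_mult_def
    by (simp, subst sum.swap) simp
  also have "\<dots> \<ge> (\<Sum>j\<in>UNIV. c * (column j D \<bullet> column j D))"
    by (intro sum_mono B)
  also have "(\<Sum>j\<in>UNIV. c * (column j D \<bullet> column j D)) = c * (D \<bullet> D)"
    unfolding inner_vec_def column_def
    by (simp add: sum_distrib_left, subst sum.swap) simp
  finally have 1: "c * (D \<bullet> D) \<le> D \<bullet> (B ** D)" .
  have "D \<bullet> (D ** C) = (\<Sum>i\<in>UNIV. D $ i \<bullet> (transpose C *v D $ i))"
    unfolding inner_vec_def matrix_matrix_mult_def matrix_vector_mult_def transpose_def
    by (simp add: mult_ac)
  also have "\<dots> \<ge> 0"
    using C by (intro sum_nonneg)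
      (metis inner_zero_left less_eq_real_def pos_def_def)
  finally have 2: "0 \<le> D \<bullet> (D ** C)" .
  have "c * (norm D)\<^sup>2 \<le> D \<bullet> (B ** B - C ** C)"
    using 1 2 unfolding eq by (simp add: inner_add_right power2_norm_eq_inner)
  also have "\<dots> \<le> norm D * norm (B ** B - C ** C)"
    by (rule norm_cauchy_schwarz)
  finally have "norm D * (c * norm D) \<le> norm D * norm (B ** B - C ** C)"
    by (simp add: power2_eq_square mult_ac)
  then show ?thesis
    unfolding D_def[symmetric] by (cases "D = 0") (simp_all add: mult_le_cancel_left)
qed

text \<open>Compactness of the unit sphere makes positivity uniform; the constant is the one that
  \<open>pos_def_sqrt_lipschitz\<close> asks for.\<close>

lemma pos_def_lower_bound:
  fixes A :: "real ^ 'n ^ 'n"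
  assumes "pos_def A"
  shows "\<exists>c>0. \<forall>v. c * (v \<bullet> v) \<le> v \<bullet> (A *v v)"
proof -
  have "continuous_on (sphere 0 1) (\<lambda>v. v \<bullet> (A *v v))"
    by (intro continuous_intros)
  moreover obtain x :: "real ^ 'n" where "x \<in> sphere 0 1"
    using vector_choose_size[of 1] by (auto simp: dist_norm)
  ultimately obtain u where u: "norm u = 1" "\<And>v. norm v = 1 \<Longrightarrow> u \<bullet> (A *v u) \<le> v \<bullet> (A *v v)"
    using continuous_attains_inf[of "sphere 0 1" "\<lambda>v. v \<bullet> (A *v v)"] by fastforce
  define c where "c = u \<bullet> (A *v u)"
  have "c * (v \<bullet> v) \<le> v \<bullet> (A *v v)" for v
  proof (cases "v = 0")
    case False
    have "c \<le> (1 / norm v) *\<^sub>R v \<bullet> (A *v ((1 / norm v) *\<^sub>R v))"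
      unfolding c_def by (rule u) (use False in auto)
    then have "c \<le> (v \<bullet> (A *v v)) / (norm v)\<^sup>2"
      by (simp add: matrix_vector_mult_scaleR power2_eq_square)
    then show ?thesis using False by (simp add: pos_le_divide_eq power2_norm_eq_inner)
  qed simp
  moreover have "c > 0"
  proof -
    have "u \<noteq> 0" using u(1) by auto
    then show ?thesis using assms by (simp add: c_def pos_def_def)
  qed
  ultimately show ?thesis by blast
qed

lemma pos_def_sqrt_unique:
  fixes B C :: "real ^ 'n ^ 'n"
  assumes "pos_def B" "pos_def C" "B ** B = C ** C"
  shows "B = C"
proof -
  obtain c where "c > 0" "\<And>v. c * (v \<bullet> v) \<le> v \<bullet> (B *v v)"
    using pos_def_lower_bound[OF assms(1)] by blast
  then have "c * norm (B - C) \<le> 0"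
    using pos_def_sqrt_lipschitz[of c B C] assms by simp
  with \<open>c > 0\<close> show ?thesis by (simp add: mult_le_0_iff)
qed

lemma inv_sqrt:
  assumes "pos_def A"
  shows "pos_def (inv_sqrt A)" "inv_sqrt A ** inv_sqrt A = matrix_inv A"
proof -
  obtain R where R: "pos_def R" "R ** R = matrix_inv A"
    using pos_def_sqrt_exists[OF pos_def_matrix_inv[OF assms]] by blast
  have "\<exists>!B. pos_def B \<and> B ** B = matrix_inv A"
    using R by (intro ex1I[of _ R] conjI pos_def_sqrt_unique[of _ R]) (simp_all only:)
  then have "\<exists>!B. transpose B = B \<and> (\<forall>v. v \<noteq> 0 \<longrightarrow> 0 < v \<bullet> (B *v v)) \<and> B ** B = matrix_inv A"
    by (simp only: pos_def_def conj_assoc)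
  from theI'[OF this]
  show "pos_def (inv_sqrt A)" "inv_sqrt A ** inv_sqrt A = matrix_inv A"
    unfolding inv_sqrt_def pos_def_def by blast+
qed

text \<open>With \<open>B\<close> the root, \<open>B ** (B ** A) = mat 1\<close>; a one-sided
  inverse of a square matrix is two-sided, so the factors may be exchanged.\<close>

lemma inv_sqrt_whitens:
  assumes "pos_def A"
  shows "inv_sqrt A ** A ** inv_sqrt A = mat 1"
proof -
  have "inv_sqrt A ** (inv_sqrt A ** A) = mat 1"
    using inv_sqrt(2)[OF assms] matrix_inv_inverse(2)[OF pos_def_invertible[OF assms]]
    by (simp add: matrix_mul_assoc)
  then show ?thesis using matrix_left_right_inverse by blast
qed

text \<open>Cramer's rule writes every entry of the inverse as a quotient of determinants, hence of
  polynomials in the entries.\<close>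

lemma continuous_on_matrix_inv:
  "continuous_on {A :: real ^ 'n ^ 'n. invertible A} matrix_inv"
proof -
  have eq: "matrix_inv A =
      (\<chi> k j. det (\<chi> i l. if l = k then (axis j 1 :: real ^ 'n) $ i else A $ i $ l) / det A)"
    if "invertible A" for A :: "real ^ 'n ^ 'n"
  proof -
    have "A *v column j (matrix_inv A) = axis j 1" for j
      by (simp add: matrix_inv_inverse(1)[OF that] matrix_vector_mul_assoc
          flip: matrix_vector_mult_basis)
    then have "column j (matrix_inv A) =
      (\<chi> k. det (\<chi> i l. if l = k then (axis j 1 :: real ^ 'n) $ i else A $ i $ l) / det A)" for j
      using cramer[of A "column j (matrix_inv A)" "axis j 1"] that by (simp add: invertible_det_nz)
    then show ?thesis by (auto simp: vec_eq_iff column_def)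
  qed
  have "continuous_on {A. invertible A} (\<lambda>A :: real ^ 'n ^ 'n. det (\<chi> i l. if l = k then
      (axis j 1 :: real ^ 'n) $ i else A $ i $ l) / det A)" for k j
  proof (intro continuous_intros)
    show "continuous_on {A. invertible A} (\<lambda>A :: real ^ 'n ^ 'n. det A)"
      unfolding det_def by (intro continuous_intros)
    have "continuous_on {A. invertible A} (\<lambda>A :: real ^ 'n ^ 'n.
      if l = k then (axis j 1 :: real ^ 'n) $ i else A $ i $ l)" for i l
      by (cases "l = k") (auto intro!: continuous_intros)
    then show "continuous_on {A. invertible A} (\<lambda>A :: real ^ 'n ^ 'n. det (\<chi> i l. if l = k then
      (axis j 1 :: real ^ 'n) $ i else A $ i $ l))"
      unfolding det_def vec_lambda_beta by (intro continuous_intros)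
  qed (simp add: invertible_det_nz)
  then show ?thesis
    by (subst continuous_on_cong[OF refl eq]) (auto intro!: continuous_on_vec_lambda)
qed

text \<open>The Lipschitz estimate takes its constant from the root at the base point alone, so one
  constant serves all neighbours \<open>X\<close>, and continuity passes from the inverse to its
  root.\<close>

lemma continuous_on_inv_sqrt:
  "continuous_on {A :: real ^ 'n ^ 'n. pos_def A} inv_sqrt"
  unfolding continuous_on_def
proof
  fix A :: "real ^ 'n ^ 'n" assume "A \<in> {A. pos_def A}"
  then have A: "pos_def A" by simp
  let ?F = "at A within {A. pos_def A}"
  obtain c where c: "c > 0" "\<And>v. c * (v \<bullet> v) \<le> v \<bullet> (inv_sqrt A *v v)"
    using pos_def_lower_bound[OF inv_sqrt(1)[OF A]] by blast
  have "continuous_on {A :: real ^ 'n ^ 'n. pos_def A} matrix_inv"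
    by (rule continuous_on_subset[OF continuous_on_matrix_inv]) (auto intro: pos_def_invertible)
  then have "(matrix_inv \<longlongrightarrow> matrix_inv A) ?F"
    using A by (simp add: continuous_on_def)
  then have "((\<lambda>X. norm (matrix_inv A - matrix_inv X) / c) \<longlongrightarrow>
      norm (matrix_inv A - matrix_inv A) / c) ?F"
    using c by (intro tendsto_intros) auto
  then have lim: "((\<lambda>X. norm (matrix_inv A - matrix_inv X) / c) \<longlongrightarrow> 0) ?F" by simp
  have "\<forall>\<^sub>F X in ?F. norm (inv_sqrt X - inv_sqrt A) \<le> norm (matrix_inv A - matrix_inv X) / c"
  proof (subst eventually_at_filter, intro always_eventually allI impI)
    fix X :: "real ^ 'n ^ 'n" assume "X \<in> {A. pos_def A}"
    then have X: "pos_def X" by simp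
    have "c * norm (inv_sqrt A - inv_sqrt X) \<le> norm (matrix_inv A - matrix_inv X)"
      using pos_def_sqrt_lipschitz[OF c(2) inv_sqrt(1)[OF X]] inv_sqrt(2)[OF A] inv_sqrt(2)[OF X]
      by simp
    then show "norm (inv_sqrt X - inv_sqrt A) \<le> norm (matrix_inv A - matrix_inv X) / c"
      using c(1) by (simp add: field_simps norm_minus_commute)
  qed
  then have "((\<lambda>X. inv_sqrt X - inv_sqrt A) \<longlongrightarrow> 0) ?F"
    by (rule Lim_null_comparison[OF _ lim])
  then show "(inv_sqrt \<longlongrightarrow> inv_sqrt A) ?F"
    by (simp add: LIM_zero_iff)
qed

text \<open>The quadratic form of the identity has lower bound 1, so near the identity the root
  inherits the rate of the inverse with constant 1.\<close>

lemma norm_inv_sqrt_minus_mat_1: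
  assumes "pos_def A"
  shows "norm (inv_sqrt A - mat 1) \<le> norm (matrix_inv A - mat 1)"
  using pos_def_sqrt_lipschitz[of 1 "mat 1" "inv_sqrt A"] inv_sqrt[OF assms]
  by (simp add: norm_minus_commute)

section \<open>Measurable selection of maximizers\<close>

text \<open>The compact-valued maps below are measurable in the sense that the set of points whose
  value meets a closed set is measurable; this is stable under minimizing a continuous function,
  so a singleton-valued map is reached by minimizing the coordinates one after another.\<close>

definition measurable_compact_map ::
    "'a measure \<Rightarrow> ('a \<Rightarrow> 'b::topological_space set) \<Rightarrow> bool" where
  "measurable_compact_map M A \<longleftrightarrow>
     (\<forall>\<omega>\<in>space M. compact (A \<omega>) \<and> A \<omega> \<noteq> {}) \<and>
     (\<forall>C. closed C \<longrightarrow> {\<omega> \<in> space M. A \<omega> \<inter> C \<noteq> {}} \<in> sets M)"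

text \<open>By compactness a maximizer lies in \<open>C\<close> iff the supremum over
  \<open>K \<inter> C\<close> reaches the supremum over \<open>K\<close>. Continuity allows both
  suprema to be taken over countable dense sets \<open>D\<close> and \<open>E\<close>, with slack
  \<open>1 / real (Suc k)\<close>, so the event is a countable combination of comparisons at fixed
  points.\<close>

lemma measurable_argmax_map:
  fixes f :: "'a \<Rightarrow> 'b::euclidean_space \<Rightarrow> real"
  assumes K: "compact K" "K \<noteq> {}"
    and meas: "\<And>u. u \<in> K \<Longrightarrow> (\<lambda>\<omega>. f \<omega> u) \<in> borel_measurable M"
    and cont: "\<And>\<omega>. \<omega> \<in> space M \<Longrightarrow> continuous_on K (f \<omega>)"
  shows "measurable_compact_map M (\<lambda>\<omega>. {u \<in> K. \<forall>v\<in>K. f \<omega> v \<le> f \<omega> u})"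
  unfolding measurable_compact_map_def
proof (intro conjI ballI allI impI)
  fix \<omega> assume \<omega>: "\<omega> \<in> space M"
  have "{u \<in> K. \<forall>v\<in>K. f \<omega> v \<le> f \<omega> u} = K \<inter> (\<Inter>v\<in>K. {u \<in> K. f \<omega> v \<le> f \<omega> u})"
    by auto
  moreover have "closed (K \<inter> (\<Inter>v\<in>K. {u \<in> K. f \<omega> v \<le> f \<omega> u}))"
    using K(1) cont[OF \<omega>]
    by (intro closed_Int closed_INT ballI continuous_closed_preimage_constant compact_imp_closed
        continuous_on_closed_Collect_le continuous_on_const) auto
  ultimately show "compact {u \<in> K. \<forall>v\<in>K. f \<omega> v \<le> f \<omega> u}"
    using K(1) by (metis (no_types, lifting) closed_Int_compact inf_commute inf_left_idem)
  show "{u \<in> K. \<forall>v\<in>K. f \<omega> v \<le> f \<omega> u} \<noteq> {}"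
    using continuous_attains_sup[OF K cont[OF \<omega>]] by auto
next
  fix C :: "'b set" assume C: "closed C"
  obtain D where D: "countable D" "D \<subseteq> K" "K \<subseteq> closure D" using separable by blast
  obtain E where E: "countable E" "E \<subseteq> K \<inter> C" "K \<inter> C \<subseteq> closure E" using separable by blast
  have KC: "compact (K \<inter> C)" using K C by (simp add: compact_Int_closed)
  have eq: "{u \<in> K. \<forall>v\<in>K. f \<omega> v \<le> f \<omega> u} \<inter> C \<noteq> {} \<longleftrightarrow>
      (\<forall>v\<in>D. \<forall>k::nat. \<exists>u\<in>E. f \<omega> v - 1 / real (Suc k) < f \<omega> u)"
    (is "?L \<longleftrightarrow> ?R") if \<omega>: "\<omega> \<in> space M" for \<omega>
  proof
    assume ?L
    then obtain u where u: "u \<in> K \<inter> C" "\<And>v. v \<in> K \<Longrightarrow> f \<omega> v \<le> f \<omega> u" by auto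
    show ?R
    proof (intro ballI allI)
      fix v k assume "v \<in> D"
      have "\<exists>w\<in>E. f \<omega> u - 1 / real (Suc k) < f \<omega> w"
      proof (rule ccontr)
        assume "\<not> ?thesis"
        then have le: "\<And>w. w \<in> E \<Longrightarrow> f \<omega> w \<le> f \<omega> u - 1 / real (Suc k)" by (auto simp: not_less)
        have "closure E \<subseteq> K" using E(2) compact_imp_closed[OF K(1)] by (simp add: closure_minimal)
        then have "continuous_on (closure E) (f \<omega>)"
          using cont[OF \<omega>] continuous_on_subset by blast
        then have "f \<omega> u \<le> f \<omega> u - 1 / real (Suc k)"
          using continuous_le_on_closure[of E "f \<omega>" u] le u(1) E(3) by blast
        then show False by simp
      qed
      then obtain w where w: "w \<in> E" "f \<omega> u - 1 / real (Suc k) < f \<omega> w" by blast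
      have "f \<omega> v \<le> f \<omega> u" using u(2) \<open>v \<in> D\<close> D(2) by blast
      then show "\<exists>u\<in>E. f \<omega> v - 1 / real (Suc k) < f \<omega> u"
        using w by (intro bexI[of _ w]) auto
    qed
  next
    assume R: ?R
    have "D \<noteq> {}" using D(3) K(2) by auto
    then have ne: "K \<inter> C \<noteq> {}" using R E(2) by blast
    obtain u where u: "u \<in> K \<inter> C" "\<And>w. w \<in> K \<inter> C \<Longrightarrow> f \<omega> w \<le> f \<omega> u"
      using continuous_attains_sup[OF KC ne continuous_on_subset[OF cont[OF \<omega>]]] by auto
    have *: "f \<omega> v \<le> f \<omega> u" if "v \<in> D" for v
    proof (rule field_le_epsilon)
      fix e :: real assume "e > 0"
      then obtain k where k: "1 / real (Suc k) < e" using nat_approx_posE by blast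
      obtain w where "w \<in> E" "f \<omega> v - 1 / real (Suc k) < f \<omega> w" using R \<open>v \<in> D\<close> by blast
      with u(2)[of w] E(2) k show "f \<omega> v \<le> f \<omega> u + e" by force
    qed
    have "closure D \<subseteq> K" using D(2) compact_imp_closed[OF K(1)] by (simp add: closure_minimal)
    then have "continuous_on (closure D) (f \<omega>)"
      using cont[OF \<omega>] continuous_on_subset by blast
    then have "f \<omega> v \<le> f \<omega> u" if "v \<in> K" for v
      using continuous_le_on_closure[of D "f \<omega>" v] * that D(3) by blast
    then show ?L using u(1) by auto
  qed
  have "{\<omega> \<in> space M. \<forall>v\<in>D. \<forall>k::nat. \<exists>u\<in>E. f \<omega> v - 1 / real (Suc k) < f \<omega> u} \<in> sets M"
  proof -
    have "{\<omega> \<in> space M. f \<omega> v - 1 / real (Suc k) < f \<omega> u} \<in> sets M" if "u \<in> E" "v \<in> D" for u v k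
      using meas that D(2) E(2) by (intro borel_measurable_less) auto
    then have "{\<omega> \<in> space M. \<exists>u\<in>E. f \<omega> v - 1 / real (Suc k) < f \<omega> u} \<in> sets M" if "v \<in> D" for v k
      using that E(1) by (intro sets.sets_Collect_countable_Ex') auto
    then show ?thesis
      using D(1) by (intro sets.sets_Collect_countable_All' sets.sets_Collect_countable_All) auto
  qed
  then show "{\<omega> \<in> space M. {u \<in> K. \<forall>v\<in>K. f \<omega> v \<le> f \<omega> u} \<inter> C \<noteq> {}} \<in> sets M"
    using eq by (simp cong: conj_cong)
qed

text \<open>A minimizer of \<open>g\<close> lies in \<open>C\<close> iff \<open>A\<close> meets
  \<open>C\<close> and, for every rational level \<open>q\<close>, whenever \<open>A\<close> meets
  the sublevel set of \<open>q\<close> it does so inside \<open>C\<close>. These are countably many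
  hitting events of closed sets.\<close>

lemma measurable_argmin_map:
  fixes g :: "'b::{t2_space} \<Rightarrow> real"
  assumes A: "measurable_compact_map M A" and g: "continuous_on UNIV g"
  shows "measurable_compact_map M (\<lambda>\<omega>. {u \<in> A \<omega>. \<forall>v\<in>A \<omega>. g u \<le> g v})"
  unfolding measurable_compact_map_def
proof (intro conjI ballI allI impI)
  note Ac = A[unfolded measurable_compact_map_def]
  have attain: "\<exists>u\<in>A \<omega> \<inter> C. \<forall>v\<in>A \<omega> \<inter> C. g u \<le> g v"
    if "\<omega> \<in> space M" "closed C" "A \<omega> \<inter> C \<noteq> {}" for \<omega> C
    using that Ac by (intro continuous_attains_inf continuous_on_subset[OF g])
      (auto simp: compact_Int_closed)
  {
    fix \<omega> assume \<omega>: "\<omega> \<in> space M"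
    obtain u where u: "u \<in> A \<omega>" "\<forall>v\<in>A \<omega>. g u \<le> g v" using attain[OF \<omega>, of UNIV] Ac \<omega> by auto
    then have "{u \<in> A \<omega>. \<forall>v\<in>A \<omega>. g u \<le> g v} = A \<omega> \<inter> {w. g w \<le> g u}"
      by (auto intro: order_trans)
    moreover have "closed {w. g w \<le> g u}"
      by (intro closed_Collect_le g continuous_on_const)
    ultimately show "compact {u \<in> A \<omega>. \<forall>v\<in>A \<omega>. g u \<le> g v}"
      using Ac \<omega> by (simp add: compact_Int_closed)
    show "{u \<in> A \<omega>. \<forall>v\<in>A \<omega>. g u \<le> g v} \<noteq> {}" using u by auto
  next
    fix C :: "'b set" assume C: "closed C"
    let ?hit = "\<lambda>D. {\<omega> \<in> space M. A \<omega> \<inter> D \<noteq> {}}"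
    have hit: "?hit D \<in> sets M" if "closed D" for D using Ac that by blast
    have cl: "closed {w. g w \<le> r}" for r by (intro closed_Collect_le g continuous_on_const)
    have "{\<omega> \<in> space M. {u \<in> A \<omega>. \<forall>v\<in>A \<omega>. g u \<le> g v} \<inter> C \<noteq> {}} =
      ?hit C \<inter> (\<Inter>q\<in>\<rat>. (space M - ?hit {w. g w \<le> q}) \<union> ?hit (C \<inter> {w. g w \<le> q}))" (is "?L = ?R")
    proof
      show "?L \<subseteq> ?R" by (auto intro: order_trans)
      show "?R \<subseteq> ?L"
      proof
        fix \<omega> assume R: "\<omega> \<in> ?R"
        then have \<omega>: "\<omega> \<in> space M" and hitC: "A \<omega> \<inter> C \<noteq> {}" by simp_all
        have R: "A \<omega> \<inter> (C \<inter> {w. g w \<le> q}) \<noteq> {}" if "q \<in> \<rat>" "A \<omega> \<inter> {w. g w \<le> q} \<noteq> {}" for q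
        proof -
          have "\<omega> \<in> (space M - ?hit {w. g w \<le> q}) \<union> ?hit (C \<inter> {w. g w \<le> q})"
            using R that(1) by (rule_tac INT_D[OF IntD2])
          then show ?thesis using that(2) by simp
        qed
        obtain u where u: "u \<in> A \<omega> \<inter> C" "\<forall>v\<in>A \<omega> \<inter> C. g u \<le> g v"
          using attain[OF \<omega> C hitC] by (rule bexE)
        have "g u \<le> g v" if "v \<in> A \<omega>" for v
        proof (rule ccontr)
          assume "\<not> g u \<le> g v"
          then have "g v < g u" by simp
          from Rats_dense_in_real[OF this] obtain q where q: "q \<in> \<rat>" "g v < q" "q < g u" by blast
          from q(2) that have "v \<in> A \<omega> \<inter> {w. g w \<le> q}" by simp
          then have "A \<omega> \<inter> {w. g w \<le> q} \<noteq> {}" by blast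
          then have "A \<omega> \<inter> (C \<inter> {w. g w \<le> q}) \<noteq> {}" using R[OF q(1)] by simp
          then obtain w where "w \<in> A \<omega> \<inter> C" "g w \<le> q" by blast
          with u(2) q(3) show False by (metis leD order_trans)
        qed
        then have "u \<in> {u \<in> A \<omega>. \<forall>v\<in>A \<omega>. g u \<le> g v} \<inter> C" using u(1) by blast
        then show "\<omega> \<in> ?L" using \<omega> by blast
      qed
    qed
    also have "\<dots> \<in> sets M"
    proof (intro sets.Int sets.countable_INT' sets.Un sets.Diff sets.top hit closed_Int C cl)
      show "countable (\<rat> :: real set)" by (rule countable_rat)
      show "(\<rat> :: real set) \<noteq> {}" by (auto intro: exI[of _ 0])
      show "(\<lambda>q. (space M - ?hit {w. g w \<le> q}) \<union> ?hit (C \<inter> {w. g w \<le> q})) ` \<rat> \<subseteq> sets M"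
        by (auto intro!: sets.Un sets.Diff hit closed_Int C cl)
    qed
    finally show "{\<omega> \<in> space M. {u \<in> A \<omega>. \<forall>v\<in>A \<omega>. g u \<le> g v} \<inter> C \<noteq> {}} \<in> sets M" .
  }
qed

lemma measurable_compact_map_lexmin:
  fixes G :: "('b::t2_space \<Rightarrow> real) set"
  assumes "finite G" "measurable_compact_map M A" "\<And>g. g \<in> G \<Longrightarrow> continuous_on UNIV g"
  shows "\<exists>B. measurable_compact_map M B \<and>
    (\<forall>\<omega>\<in>space M. B \<omega> \<subseteq> A \<omega> \<and> (\<forall>u\<in>B \<omega>. \<forall>v\<in>B \<omega>. \<forall>g\<in>G. g u = g v))"
  using assms(1,3)
proof (induction rule: finite_induct)
  case empty
  then show ?case using assms(2) by auto
next
  case (insert g G)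
  then obtain B where B: "measurable_compact_map M B"
    "\<forall>\<omega>\<in>space M. B \<omega> \<subseteq> A \<omega> \<and> (\<forall>u\<in>B \<omega>. \<forall>v\<in>B \<omega>. \<forall>g\<in>G. g u = g v)" by auto
  then have "measurable_compact_map M (\<lambda>\<omega>. {u \<in> B \<omega>. \<forall>v\<in>B \<omega>. g u \<le> g v})"
    using insert.prems by (intro measurable_argmin_map) auto
  moreover have "g u = g v"
    if "u \<in> B \<omega>" "v \<in> B \<omega>" "\<forall>v\<in>B \<omega>. g u \<le> g v" "\<forall>u\<in>B \<omega>. g v \<le> g u" for \<omega> u v
    using that by (simp add: antisym)
  ultimately show ?case
    using B(2) by (intro exI[of _ "\<lambda>\<omega>. {u \<in> B \<omega>. \<forall>v\<in>B \<omega>. g u \<le> g v}"]) blast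
qed

lemma measurable_compact_map_selection:
  fixes A :: "'a \<Rightarrow> 'b::euclidean_space set"
  assumes "measurable_compact_map M A"
  shows "\<exists>s\<in>borel_measurable M. \<forall>\<omega>\<in>space M. s \<omega> \<in> A \<omega>"
proof -
  have "\<exists>B. measurable_compact_map M B \<and> (\<forall>\<omega>\<in>space M. B \<omega> \<subseteq> A \<omega> \<and>
    (\<forall>u\<in>B \<omega>. \<forall>v\<in>B \<omega>. \<forall>g\<in>(\<lambda>b x. x \<bullet> b) ` Basis. g u = g v))"
    by (rule measurable_compact_map_lexmin[OF _ assms]) (auto intro!: continuous_intros)
  then obtain B where B: "measurable_compact_map M B"
    and sel: "\<forall>\<omega>\<in>space M. B \<omega> \<subseteq> A \<omega> \<and>
      (\<forall>u\<in>B \<omega>. \<forall>v\<in>B \<omega>. \<forall>g\<in>(\<lambda>b x. x \<bullet> b) ` Basis. g u = g v)"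
    by (rule exE) (erule conjE)
  have coord: "u \<bullet> b = v \<bullet> b" if "\<omega> \<in> space M" "u \<in> B \<omega>" "v \<in> B \<omega>" "b \<in> Basis" for \<omega> u v b
  proof -
    note bspec[OF bspec[OF conjunct2[OF bspec[OF sel that(1)]] that(2)] that(3)]
    from bspec[OF this imageI[OF that(4)]] show ?thesis .
  qed
  have uniq: "u = v" if "\<omega> \<in> space M" "u \<in> B \<omega>" "v \<in> B \<omega>" for \<omega> u v
    using coord[OF that] by (rule euclidean_eqI)
  define s where "s \<omega> = (SOME u. u \<in> B \<omega>)" for \<omega>
  have s: "s \<omega> \<in> B \<omega>" if "\<omega> \<in> space M" for \<omega>
    using B that unfolding s_def measurable_compact_map_def by (simp add: some_in_eq)
  \<comment> \<open>Since \<open>B\<close> is single-valued, \<open>s\<close> lies in an open set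
    exactly when \<open>B\<close> misses its closed complement.\<close>
  have "s \<in> borel_measurable M"
  proof (rule borel_measurableI)
    fix S :: "'b set" assume "open S"
    have "s -` S \<inter> space M = space M - {\<omega> \<in> space M. B \<omega> \<inter> - S \<noteq> {}}"
      using s uniq by blast
    then show "s -` S \<inter> space M \<in> sets M"
      using B \<open>open S\<close> by (simp add: measurable_compact_map_def closed_Compl sets.Diff)
  qed
  then show ?thesis using s sel by blast
qed

text \<open>The distance to \<open>a\<close> is minimized first; the coordinates afterwards only
  break ties.\<close>

lemma measurable_nearest_argmax:
  fixes f :: "'a \<Rightarrow> 'b::euclidean_space \<Rightarrow> real"
  assumes "compact K" "K \<noteq> {}"
    and "\<And>u. u \<in> K \<Longrightarrow> (\<lambda>\<omega>. f \<omega> u) \<in> borel_measurable M"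
    and "\<And>\<omega>. \<omega> \<in> space M \<Longrightarrow> continuous_on K (f \<omega>)"
  obtains s where "s \<in> borel_measurable M"
    "\<And>\<omega>. \<omega> \<in> space M \<Longrightarrow> is_arg_max (f \<omega>) (\<lambda>u. u \<in> K) (s \<omega>)"
    "\<And>\<omega> u. \<omega> \<in> space M \<Longrightarrow> is_arg_max (f \<omega>) (\<lambda>u. u \<in> K) u \<Longrightarrow> dist (s \<omega>) a \<le> dist u a"
proof -
  let ?A = "\<lambda>\<omega>. {u \<in> K. \<forall>v\<in>K. f \<omega> v \<le> f \<omega> u}"
  have "measurable_compact_map M ?A"
    using assms by (rule measurable_argmax_map)
  then have "measurable_compact_map M (\<lambda>\<omega>. {u \<in> ?A \<omega>. \<forall>v\<in>?A \<omega>. dist u a \<le> dist v a})"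
    by (rule measurable_argmin_map) (intro continuous_intros)
  from measurable_compact_map_selection[OF this] obtain s where s: "s \<in> borel_measurable M"
    "\<And>\<omega>. \<omega> \<in> space M \<Longrightarrow> s \<omega> \<in> {u \<in> ?A \<omega>. \<forall>v\<in>?A \<omega>. dist u a \<le> dist v a}"
    by blast
  show ?thesis
    by (rule that[OF s(1)]) (use s(2) in \<open>auto simp: is_arg_max_linorder\<close>)
qed

section \<open>Joint diagonalization\<close>

lemma orthogonal_matrix_alt:
  fixes U :: "real ^ 'n ^ 'n"
  shows "orthogonal_matrix U \<longleftrightarrow> U ** transpose U = mat 1"
  unfolding orthogonal_matrix using matrix_left_right_inverse by blast

lemma orthogonal_matrix_rows:
  fixes U :: "real ^ 'n ^ 'n"
  shows "orthogonal_matrix U \<longleftrightarrow> (\<forall>k l. U $ k \<bullet> U $ l = (if k = l then 1 else 0))"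
  by (auto simp: orthogonal_matrix_alt vec_eq_iff matrix_matrix_mult_def transpose_def mat_def
      inner_vec_def)

lemma orthogonal_matrix_columns:
  fixes U :: "real ^ 'n ^ 'n"
  shows "orthogonal_matrix U \<longleftrightarrow>
    (\<forall>k l. (\<Sum>i\<in>UNIV. U $ i $ k * U $ i $ l) = (if k = l then 1 else 0))"
  by (auto simp: orthogonal_matrix vec_eq_iff matrix_matrix_mult_def transpose_def mat_def)

lemma compact_orthogonal_matrices: "compact {U :: real ^ 'n ^ 'n. orthogonal_matrix U}"
proof -
  have "{U :: real ^ 'n ^ 'n. orthogonal_matrix U} =
      (\<Inter>k. \<Inter>l. {U. U $ k \<bullet> U $ l = (if k = l then 1 else 0)})"
    by (auto simp: orthogonal_matrix_rows)
  also have "closed \<dots>"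
    by (intro closed_INT ballI closed_Collect_eq continuous_intros)
  finally have "closed {U :: real ^ 'n ^ 'n. orthogonal_matrix U}" .
  moreover have "bounded {U :: real ^ 'n ^ 'n. orthogonal_matrix U}"
  proof (rule boundedI)
    fix U :: "real ^ 'n ^ 'n" assume "U \<in> {U. orthogonal_matrix U}"
    then have "norm (U $ i) = 1" for i by (simp add: orthogonal_matrix_rows norm_eq_1)
    then show "norm U \<le> (\<Sum>i\<in>(UNIV :: 'n set). 1)"
      using norm_le_l1_cart[of "\<chi> i. norm (U $ i)"]
      by (metis (no_types, lifting) L2_set_le_sum norm_ge_zero norm_vec_def sum.cong)
  qed
  ultimately show ?thesis by (simp add: compact_eq_bounded_closed)
qed

lemma norm_matrix_vector_mult_le:
  fixes A :: "real ^ 'n ^ 'm"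
  shows "norm (A *v x) \<le> norm A * norm x"
proof -
  have "norm (A *v x) = L2_set (\<lambda>i. \<bar>A $ i \<bullet> x\<bar>) UNIV"
    by (simp add: norm_vec_def matrix_vector_mult_def inner_vec_def)
  also have "\<dots> \<le> L2_set (\<lambda>i. norm (A $ i) * norm x) UNIV"
    by (intro L2_set_mono Cauchy_Schwarz_ineq2) auto
  also have "\<dots> = norm A * norm x"
    by (simp add: norm_vec_def[of A] L2_set_left_distrib)
  finally show ?thesis .
qed

lemma norm_orthogonal_matrix_mult:
  fixes Q X :: "real ^ 'n ^ 'n"
  assumes "orthogonal_matrix Q"
  shows "norm (Q ** X) = norm X"
proof -
  have cols: "A \<bullet> A = (\<Sum>j\<in>UNIV. column j A \<bullet> column j A)" for A :: "real ^ 'n ^ 'n"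
    unfolding inner_vec_def column_def by (simp, subst sum.swap) simp
  have "column j (Q ** X) = Q *v column j X" for j
    by (simp add: vec_eq_iff column_def matrix_matrix_mult_def matrix_vector_mult_def)
  moreover have "orthogonal_transformation (\<lambda>v. Q *v v)"
    using assms orthogonal_transformation_matrix[of "\<lambda>v. Q *v v"] by simp
  ultimately have "(Q ** X) \<bullet> (Q ** X) = X \<bullet> X"
    unfolding cols by (simp add: orthogonal_transformation_def)
  then show ?thesis by (simp add: norm_eq)
qed

text \<open>\<open>U $ k \<bullet> (C m *v U $ k)\<close> is the \<open>k\<close>-th diagonal entry
  of \<open>U ** C m ** transpose U\<close>. With weights and matrices left free, the sample
  objective and its limit are both instances.\<close>

definition joint_diagonality ::
    "'m set \<Rightarrow> ('m \<Rightarrow> real) \<Rightarrow> ('m \<Rightarrow> real ^ 'n ^ 'n) \<Rightarrow> real ^ 'n ^ 'n \<Rightarrow> real" where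
  "joint_diagonality I w C U = (\<Sum>m\<in>I. w m * (\<Sum>k\<in>UNIV. (U $ k \<bullet> (C m *v U $ k))\<^sup>2))"

lemma symmetric_inner_matrix:
  fixes C :: "real ^ 'n ^ 'n"
  assumes "transpose C = C"
  shows "x \<bullet> (C *v y) = y \<bullet> (C *v x)"
  by (metis assms dot_lmul_matrix inner_commute vector_transpose_matrix)

text \<open>Given directly by its action on the rows of \<open>U\<close>, on which the quadratic
  forms of the objective are evaluated.\<close>

definition givens_rotation :: "'n \<Rightarrow> 'n \<Rightarrow> real \<Rightarrow> real ^ 'n ^ 'n \<Rightarrow> real ^ 'n ^ 'n" where
  "givens_rotation k l t U = (\<chi> i. if i = k then cos t *\<^sub>R U $ k + sin t *\<^sub>R U $ l
     else if i = l then cos t *\<^sub>R U $ l - sin t *\<^sub>R U $ k else U $ i)"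

lemma orthogonal_givens_rotation:
  assumes "orthogonal_matrix U" "k \<noteq> l"
  shows "orthogonal_matrix (givens_rotation k l t U)"
proof -
  have U: "U $ i \<bullet> U $ j = (if i = j then 1 else 0)" for i j
    using assms(1) by (simp add: orthogonal_matrix_rows)
  have "cos t * cos t + sin t * sin t = 1"
    using sin_cos_squared_add[of t] by (simp add: power2_eq_square)
  then show ?thesis
    unfolding orthogonal_matrix_rows givens_rotation_def
    using assms(2) by (auto simp: inner_add_left inner_add_right inner_diff_left inner_diff_right U add.commute)
qed

text \<open>The first-order condition: the derivative along the Givens rotations of the rows
  \<open>k\<close> and \<open>l\<close> vanishes.\<close>
lemma joint_diagonality_stationary:
  fixes U :: "real ^ 'n ^ 'n"
  assumes max: "is_arg_max (joint_diagonality I w C) orthogonal_matrix U"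
    and sym: "\<And>m. m \<in> I \<Longrightarrow> transpose (C m) = C m" and "k \<noteq> l"
  shows "(\<Sum>m\<in>I. w m * ((U $ k \<bullet> (C m *v U $ l)) *
      (U $ k \<bullet> (C m *v U $ k) - U $ l \<bullet> (C m *v U $ l)))) = 0"
proof -
  define a where "a m = U $ k \<bullet> (C m *v U $ k)" for m
  define b where "b m = U $ k \<bullet> (C m *v U $ l)" for m
  define d where "d m = U $ l \<bullet> (C m *v U $ l)" for m
  define p where "p m t = (cos t)\<^sup>2 * a m + 2 * cos t * sin t * b m + (sin t)\<^sup>2 * d m" for m t
  define q where "q m t = (sin t)\<^sup>2 * a m - 2 * cos t * sin t * b m + (cos t)\<^sup>2 * d m" for m t
  define G where "G t = (\<Sum>m\<in>I. w m * ((p m t)\<^sup>2 + (q m t)\<^sup>2))" for t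
  define R where "R = (\<Sum>m\<in>I. w m * (\<Sum>i\<in>UNIV - {k, l}. (U $ i \<bullet> (C m *v U $ i))\<^sup>2))"
  have split: "(\<Sum>i\<in>UNIV. h i) = h k + h l + (\<Sum>i\<in>UNIV - {k, l}. h i)" for h :: "'n \<Rightarrow> real"
    using \<open>k \<noteq> l\<close> sum.subset_diff[of "{k, l}" UNIV h] by simp
  have G: "joint_diagonality I w C (givens_rotation k l t U) = R + G t" for t
  proof -
    let ?V = "givens_rotation k l t U"
    have "(\<Sum>i\<in>UNIV. (?V $ i \<bullet> (C m *v ?V $ i))\<^sup>2) =
        (p m t)\<^sup>2 + (q m t)\<^sup>2 + (\<Sum>i\<in>UNIV - {k, l}. (U $ i \<bullet> (C m *v U $ i))\<^sup>2)" if "m \<in> I" for m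
    proof -
      have b': "U $ l \<bullet> (C m *v U $ k) = b m"
        unfolding b_def by (rule symmetric_inner_matrix[OF sym[OF that]])
      have "?V $ k \<bullet> (C m *v ?V $ k) = p m t"
        by (simp add: givens_rotation_def p_def matrix_vector_right_distrib
            matrix_vector_mult_scaleR inner_add_left inner_add_right b')
          (simp add: a_def b_def d_def power2_eq_square algebra_simps)
      moreover have "?V $ l \<bullet> (C m *v ?V $ l) = q m t"
        using \<open>k \<noteq> l\<close> by (simp add: givens_rotation_def q_def matrix_vector_mult_diff_distrib
            matrix_vector_mult_scaleR inner_diff_left inner_diff_right b')
          (simp add: a_def b_def d_def power2_eq_square algebra_simps)
      moreover have "(\<Sum>i\<in>UNIV - {k, l}. (?V $ i \<bullet> (C m *v ?V $ i))\<^sup>2) =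
          (\<Sum>i\<in>UNIV - {k, l}. (U $ i \<bullet> (C m *v U $ i))\<^sup>2)"
        by (intro sum.cong) (auto simp: givens_rotation_def)
      ultimately show ?thesis by (subst split) simp
    qed
    then show ?thesis
      unfolding joint_diagonality_def R_def G_def
      by (simp add: sum.distrib[symmetric] algebra_simps)
  qed
  have "givens_rotation k l 0 U = U"
    by (simp add: givens_rotation_def vec_eq_iff)
  then have Gmax: "G t \<le> G 0" for t
    using max G[of t] G[of 0] orthogonal_givens_rotation[of U k l t] \<open>k \<noteq> l\<close>
    by (fastforce simp: is_arg_max_linorder)
  \<comment> \<open>At 0 the functions \<open>p m\<close> and \<open>q m\<close> have the values
    \<open>a m\<close> and \<open>d m\<close> and the derivatives \<open>2 * b m\<close> and
    \<open>- 2 * b m\<close>.\<close>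
  have "((\<lambda>t. w m * ((p m t)\<^sup>2 + (q m t)\<^sup>2)) has_real_derivative
      4 * (w m * (b m * (a m - d m)))) (at 0)" for m
    unfolding p_def q_def
    by (rule derivative_eq_intros refl | simp add: algebra_simps)+
  then have "(G has_real_derivative (\<Sum>m\<in>I. 4 * (w m * (b m * (a m - d m))))) (at 0)"
    unfolding G_def by (intro DERIV_sum) 
  then have "(\<Sum>m\<in>I. 4 * (w m * (b m * (a m - d m)))) = 0"
    by (rule DERIV_local_max[where d = 1]) (use Gmax in auto)
  then show ?thesis
    unfolding a_def b_def d_def sum_distrib_left[symmetric] by simp
qed

text \<open>The rows of \<open>U\<close> are unit vectors, so every quadratic form is bounded by the
  norm of its matrix. A difference of squares is then bounded by \<open>B x\<close>, which does not
  involve \<open>U\<close>.\<close>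

lemma joint_diagonality_uniform_limit:
  fixes C0 :: "'m \<Rightarrow> real ^ 'n ^ 'n"
  assumes I: "finite I" and C: "\<And>m. m \<in> I \<Longrightarrow> ((\<lambda>x. C x m) \<longlongrightarrow> C0 m) F" and "e > 0"
  shows "\<forall>\<^sub>F x in F. \<forall>U. orthogonal_matrix U \<longrightarrow>
    \<bar>joint_diagonality I w (C x) U - joint_diagonality I w C0 U\<bar> < e"
proof -
  define B where "B x = (\<Sum>m\<in>I. \<bar>w m\<bar> * (\<Sum>k\<in>(UNIV :: 'n set).
      norm (C x m - C0 m) * (norm (C x m) + norm (C0 m))))" for x
  have "(B \<longlongrightarrow> (\<Sum>m\<in>I. \<bar>w m\<bar> * (\<Sum>k\<in>(UNIV :: 'n set).
      norm (C0 m - C0 m) * (norm (C0 m) + norm (C0 m))))) F"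
    unfolding B_def by (intro tendsto_intros C)
  then have "(B \<longlongrightarrow> 0) F" by simp
  then have "\<forall>\<^sub>F x in F. B x < e" using \<open>e > 0\<close> by (rule order_tendstoD)
  then show ?thesis
  proof (rule eventually_mono, intro allI impI)
    fix x and U :: "real ^ 'n ^ 'n" assume Bx: "B x < e" and U: "orthogonal_matrix U"
    have 1: "norm (U $ k) = 1" for k using U by (simp add: orthogonal_matrix_rows norm_eq_1)
    have q: "\<bar>U $ k \<bullet> (A *v U $ k)\<bar> \<le> norm A" for k and A :: "real ^ 'n ^ 'n"
      using Cauchy_Schwarz_ineq2[of "U $ k" "A *v U $ k"] norm_matrix_vector_mult_le[of A "U $ k"] 1
      by simp
    have "\<bar>joint_diagonality I w (C x) U - joint_diagonality I w C0 U\<bar> \<le> B x"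
      unfolding joint_diagonality_def B_def sum_subtractf[symmetric] right_diff_distrib[symmetric]
    proof (intro order_trans[OF sum_abs] sum_mono, unfold abs_mult, intro mult_left_mono
        order_trans[OF sum_abs] sum_mono)
      fix m k
      let ?a = "U $ k \<bullet> (C x m *v U $ k)" and ?b = "U $ k \<bullet> (C0 m *v U $ k)"
      have "\<bar>?a\<^sup>2 - ?b\<^sup>2\<bar> = \<bar>?a - ?b\<bar> * \<bar>?a + ?b\<bar>"
        by (simp add: power2_eq_square square_diff_square_factored abs_mult mult.commute)
      also have "?a - ?b = U $ k \<bullet> ((C x m - C0 m) *v U $ k)"
        by (simp add: matrix_vector_mult_diff_rdistrib inner_diff_right)
      also have "\<bar>U $ k \<bullet> ((C x m - C0 m) *v U $ k)\<bar> * \<bar>?a + ?b\<bar> \<le>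
          norm (C x m - C0 m) * (norm (C x m) + norm (C0 m))"
        using q[of k "C x m"] q[of k "C0 m"] by (intro mult_mono q) auto
      finally show "\<bar>?a\<^sup>2 - ?b\<^sup>2\<bar> \<le> norm (C x m - C0 m) * (norm (C x m) + norm (C0 m))" .
    qed auto
    with Bx show "\<bar>joint_diagonality I w (C x) U - joint_diagonality I w C0 U\<bar> < e" by simp
  qed
qed

lemma continuous_on_joint_diagonality: "continuous_on S (joint_diagonality I w C)"
  unfolding joint_diagonality_def
  by (intro continuous_intros bounded_linear.continuous_on[OF matrix_vector_mul_bounded_linear])

text \<open>By uniform convergence a maximizer is close to some maximizer \<open>P\<close> of the limit, and
  then multiplying it by the transpose of \<open>P\<close> yields a maximizer close to the identity.\<close>
lemma nearest_maximizer_tendsto_mat_1: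
  fixes C0 :: "'m \<Rightarrow> real ^ 'n ^ 'n"
  assumes I: "finite I" and C: "\<And>m. m \<in> I \<Longrightarrow> ((\<lambda>x. C x m) \<longlongrightarrow> C0 m) F"
    and symmetry: "\<And>P D U. is_arg_max (joint_diagonality I w C0) orthogonal_matrix P \<Longrightarrow>
      joint_diagonality I w D (transpose P ** U) = joint_diagonality I w D U"
    and max: "\<forall>\<^sub>F x in F. is_arg_max (joint_diagonality I w (C x)) orthogonal_matrix (U x) \<and>
      (\<forall>V. is_arg_max (joint_diagonality I w (C x)) orthogonal_matrix V \<longrightarrow>
        dist (U x) (mat 1) \<le> dist V (mat 1))"
  shows "(U \<longlongrightarrow> mat 1) F"
proof (rule tendstoI)
  fix e :: real assume "e > 0"
  let ?f = "joint_diagonality I w C0" and ?O = "orthogonal_matrix :: real ^ 'n ^ 'n \<Rightarrow> bool"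
  \<comment> \<open>The orthogonal matrices that stay away from all maximizers of the limit at
    once.\<close>
  define T where "T = {V. ?O V} \<inter> (\<Inter>P\<in>{P. is_arg_max ?f ?O P}. {V. e \<le> dist V P})"
  have "closed (\<Inter>P\<in>{P. is_arg_max ?f ?O P}. {V. e \<le> dist V P})"
    by (intro closed_INT ballI closed_Collect_le continuous_intros)
  then have T: "compact T"
    unfolding T_def by (intro compact_Int_closed compact_orthogonal_matrices)
  obtain P0 where P0: "is_arg_max ?f ?O P0"
    using continuous_attains_sup[OF compact_orthogonal_matrices _
        continuous_on_joint_diagonality[of _ I w C0]] orthogonal_matrix_id
    by (fastforce simp: is_arg_max_linorder)
  \<comment> \<open>On the compact set \<open>T\<close> the limit objective misses its maximum by a
    fixed gap. The gap is written as \<open>2 * d\<close> because the approximation error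
    \<open>d\<close> enters twice, at \<open>U x\<close> and at \<open>P0\<close>.\<close>
  obtain d where d: "d > 0" "\<And>V. V \<in> T \<Longrightarrow> ?f V \<le> ?f P0 - 2 * d"
  proof (cases "T = {}")
    case False
    obtain V where V: "V \<in> T" "\<And>V'. V' \<in> T \<Longrightarrow> ?f V' \<le> ?f V"
      using continuous_attains_sup[OF T False continuous_on_joint_diagonality[of _ I w C0]] by blast
    have "\<not> is_arg_max ?f ?O V"
      using V(1) \<open>e > 0\<close> unfolding T_def by force
    moreover have "?O V" using V(1) by (simp add: T_def)
    ultimately obtain V' where "?O V'" "?f V < ?f V'"
      by (auto simp: is_arg_max_linorder not_le)
    then have "?f V < ?f P0" using P0 by (fastforce simp: is_arg_max_linorder)
    then show ?thesis using V(2) by (intro that[of "(?f P0 - ?f V) / 2"]) (auto simp: field_simps)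
  qed (auto intro: that[of 1])
  have "\<forall>\<^sub>F x in F. \<forall>U. ?O U \<longrightarrow> \<bar>joint_diagonality I w (C x) U - ?f U\<bar> < d"
    by (rule joint_diagonality_uniform_limit[OF I C d(1)])
  then show "\<forall>\<^sub>F x in F. dist (U x) (mat 1) < e"
    using max
  proof eventually_elim
    case (elim x)
    let ?g = "joint_diagonality I w (C x)"
    have U: "?O (U x)" "\<And>V. ?O V \<Longrightarrow> ?g V \<le> ?g (U x)"
      using elim(2) by (auto simp: is_arg_max_linorder)
    have P0': "?O P0" using P0 by (simp add: is_arg_max_linorder)
    have "?f P0 - 2 * d < ?f (U x)"
      using U(2)[OF P0'] elim(1)[rule_format, OF U(1)] elim(1)[rule_format, OF P0'] by linarith
    then have "U x \<notin> T" using d(2) by fastforce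
    then obtain P where P: "is_arg_max ?f ?O P" "dist (U x) P < e"
      using U(1) unfolding T_def by (auto simp: not_le)
    have oP: "?O P" using P(1) by (simp add: is_arg_max_linorder)
    have "is_arg_max ?g ?O (transpose P ** U x)"
      using U oP symmetry[OF P(1)] by (auto simp: is_arg_max_linorder orthogonal_matrix_mul)
    then have "dist (U x) (mat 1) \<le> dist (transpose P ** U x) (mat 1)"
      using elim(2) by blast
    also have "transpose P ** U x - mat 1 = transpose P ** (U x - P)"
      using oP by (simp add: orthogonal_matrix vec_eq_iff matrix_matrix_mult_def
          algebra_simps sum_subtractf)
    then have "dist (transpose P ** U x) (mat 1) = dist (U x) P"
      unfolding dist_norm using oP by (simp add: norm_orthogonal_matrix_mult)
    finally show ?case using P(2) by simp
  qed
qed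

section \<open>Signed permutations and the maximizers of the limiting objective\<close>

text \<open>Unit column norms leave one nonzero entry per column, in row \<open>\<tau> i\<close>;
  unit row norms make \<tau> injective. Multiplication by \<open>transpose P\<close> then merely
  permutes rows and changes signs.\<close>

lemma orthogonal_matrix_01_signed_permutation:
  fixes P :: "real ^ 'n ^ 'n"
  assumes P: "orthogonal_matrix P" and 01: "\<And>k i. (P $ k $ i)\<^sup>2 = 0 \<or> (P $ k $ i)\<^sup>2 = 1"
  obtains \<tau> where "bij \<tau>" "\<And>i. (P $ \<tau> i $ i)\<^sup>2 = 1"
    "\<And>(U :: real ^ 'n ^ 'n) i. (transpose P ** U) $ i = P $ \<tau> i $ i *\<^sub>R U $ \<tau> i"
proof -
  have rows: "(\<Sum>i\<in>UNIV. (P $ k $ i)\<^sup>2) = 1" for k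
    using P orthogonal_matrix_rows[of P] by (simp add: inner_vec_def power2_eq_square)
  have cols: "(\<Sum>k\<in>UNIV. (P $ k $ i)\<^sup>2) = 1" for i
    using P orthogonal_matrix_columns[of P] by (simp add: power2_eq_square)
  have "\<exists>k. (P $ k $ i)\<^sup>2 = 1" for i
  proof (rule ccontr)
    assume "\<nexists>k. (P $ k $ i)\<^sup>2 = 1"
    then have "(P $ k $ i)\<^sup>2 = 0" for k using 01 by blast
    then have "(\<Sum>k\<in>UNIV. (P $ k $ i)\<^sup>2) = 0" by (intro sum.neutral) auto
    then show False using cols[of i] by linarith
  qed
  then obtain \<tau> where \<tau>: "\<And>i. (P $ \<tau> i $ i)\<^sup>2 = 1" by metis
  have other: "P $ k $ i = 0" if "k \<noteq> \<tau> i" for k i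
  proof -
    have "(P $ k $ i)\<^sup>2 + (P $ \<tau> i $ i)\<^sup>2 \<le> (\<Sum>k\<in>UNIV. (P $ k $ i)\<^sup>2)"
      using sum_mono2[of UNIV "{k, \<tau> i}" "\<lambda>k. (P $ k $ i)\<^sup>2"] that by simp
    then show ?thesis using \<tau>[of i] cols[of i] by simp
  qed
  have "inj \<tau>"
  proof (rule injI, rule ccontr)
    fix i j assume ij: "\<tau> i = \<tau> j" "i \<noteq> j"
    have "(P $ \<tau> i $ i)\<^sup>2 + (P $ \<tau> i $ j)\<^sup>2 \<le> (\<Sum>i'\<in>UNIV. (P $ \<tau> i $ i')\<^sup>2)"
      using sum_mono2[of UNIV "{i, j}" "\<lambda>i'. (P $ \<tau> i $ i')\<^sup>2"] ij(2) by simp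
    then show False using \<tau>[of i] \<tau>[of j] rows[of "\<tau> i"] ij(1) by simp
  qed
  then have "bij \<tau>" by (simp add: bij_def finite_UNIV_inj_surj)
  moreover have "(transpose P ** U) $ i = P $ \<tau> i $ i *\<^sub>R U $ \<tau> i" for U :: "real ^ 'n ^ 'n" and i
  proof -
    have "(transpose P ** U) $ i $ j = P $ \<tau> i $ i * U $ \<tau> i $ j" for j
    proof -
      have "(transpose P ** U) $ i $ j = (\<Sum>k\<in>UNIV. P $ k $ i * U $ k $ j)"
        by (simp add: matrix_matrix_mult_def transpose_def)
      also have "\<dots> = (\<Sum>k\<in>{\<tau> i}. P $ k $ i * U $ k $ j)"
        by (rule sum.mono_neutral_right) (auto simp: other)
      finally show ?thesis by simp
    qed
    then show ?thesis by (simp add: vec_eq_iff)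
  qed
  ultimately show ?thesis using that \<tau> by blast
qed

text \<open>The signs disappear in the quadratic forms and the permutation in the sum over the
  rows.\<close>

lemma joint_diagonality_signed_permutation:
  fixes P :: "real ^ 'n ^ 'n"
  assumes P: "orthogonal_matrix P" and 01: "\<And>k i. (P $ k $ i)\<^sup>2 = 0 \<or> (P $ k $ i)\<^sup>2 = 1"
  shows "joint_diagonality I w C (transpose P ** U) = joint_diagonality I w C U"
proof -
  obtain \<tau> where \<tau>: "bij \<tau>" "\<And>i. (P $ \<tau> i $ i)\<^sup>2 = 1"
    "\<And>(U :: real ^ 'n ^ 'n) i. (transpose P ** U) $ i = P $ \<tau> i $ i *\<^sub>R U $ \<tau> i"
    using orthogonal_matrix_01_signed_permutation[OF P 01] by metis
  have "(transpose P ** U) $ i \<bullet> (C m *v (transpose P ** U) $ i) =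
      (P $ \<tau> i $ i)\<^sup>2 * (U $ \<tau> i \<bullet> (C m *v U $ \<tau> i))" for m i
    unfolding \<tau>(3) by (simp add: matrix_vector_mult_scaleR power2_eq_square)
  then have "(\<Sum>i\<in>UNIV. ((transpose P ** U) $ i \<bullet> (C m *v (transpose P ** U) $ i))\<^sup>2) =
      (\<Sum>i\<in>UNIV. (U $ \<tau> i \<bullet> (C m *v U $ \<tau> i))\<^sup>2)" for m
    by (simp add: \<tau>(2))
  also have "(\<Sum>i\<in>UNIV. (U $ \<tau> i \<bullet> (C m *v U $ \<tau> i))\<^sup>2) = (\<Sum>k\<in>UNIV. (U $ k \<bullet> (C m *v U $ k))\<^sup>2)" for m
    by (rule sum.reindex_bij_betw[OF \<tau>(1)])
  finally show ?thesis by (simp add: joint_diagonality_def)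
qed

text \<open>Equality in \<open>\<Sum>\<^sub>k u\<^sub>k\<^sub>i\<^sup>4 \<le> (\<Sum>\<^sub>k u\<^sub>k\<^sub>i\<^sup>2)\<^sup>2 = 1\<close> forces the entries of every column with
  positive weight into \<open>{-1, 0, 1}\<close>; a single remaining column is then determined by the
  row norms.\<close>
lemma fourth_power_maximizer_01:
  fixes P :: "real ^ 'n ^ 'n"
  assumes P: "orthogonal_matrix P" and c: "\<And>i. 0 \<le> c i" "\<And>i j. c i = 0 \<Longrightarrow> c j = 0 \<Longrightarrow> i = j"
    and max: "(\<Sum>i\<in>UNIV. c i) \<le> (\<Sum>i\<in>UNIV. c i * (\<Sum>k\<in>UNIV. (P $ k $ i) ^ 4))"
  shows "(P $ k $ i)\<^sup>2 = 0 \<or> (P $ k $ i)\<^sup>2 = 1"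
proof -
  have rows: "(\<Sum>i\<in>UNIV. (P $ k $ i)\<^sup>2) = 1" for k
    using P orthogonal_matrix_rows[of P] by (simp add: inner_vec_def power2_eq_square)
  have cols: "(\<Sum>k\<in>UNIV. (P $ k $ i)\<^sup>2) = 1" for i
    using P orthogonal_matrix_columns[of P] by (simp add: power2_eq_square)
  have le1: "(P $ k $ i)\<^sup>2 \<le> 1" for k i
  proof -
    have "(P $ k $ i)\<^sup>2 \<le> (\<Sum>k\<in>UNIV. (P $ k $ i)\<^sup>2)" by (rule member_le_sum[of k UNIV "\<lambda>k. (P $ k $ i)\<^sup>2"]) auto
    then show ?thesis using cols[of i] by linarith
  qed
  \<comment> \<open>The defect of the fourth-power inequality, split into nonnegative terms that
    vanish only at squared entries 0 and 1.\<close>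
  define g where "g k i = (P $ k $ i)\<^sup>2 * (1 - (P $ k $ i)\<^sup>2)" for k i
  have g0: "g k i \<ge> 0" for k i using le1[of k i] by (simp add: g_def)
  have g: "(\<Sum>k\<in>UNIV. g k i) = 1 - (\<Sum>k\<in>UNIV. (P $ k $ i) ^ 4)" for i
  proof -
    have "g k i = (P $ k $ i)\<^sup>2 - (P $ k $ i) ^ 4" for k
      by (simp add: g_def right_diff_distrib flip: power_add)
    then show ?thesis by (simp add: sum_subtractf cols)
  qed
  have "(\<Sum>i\<in>UNIV. c i * (\<Sum>k\<in>UNIV. g k i)) \<le> 0"
    using max by (simp add: g algebra_simps sum_subtractf)
  then have sum0: "(\<Sum>i\<in>UNIV. c i * (\<Sum>k\<in>UNIV. g k i)) = 0"
    using c(1) g0 by (intro antisym sum_nonneg mult_nonneg_nonneg) auto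
  have "\<forall>i\<in>UNIV. c i * (\<Sum>k\<in>UNIV. g k i) = 0"
    using sum_nonneg_eq_0_iff[THEN iffD1, OF _ _ sum0] c(1) g0
    by (auto intro!: mult_nonneg_nonneg sum_nonneg)
  then have "(\<Sum>k\<in>UNIV. g k i) = 0" if "c i \<noteq> 0" for i using that by auto
  then have "\<forall>k\<in>UNIV. g k i = 0" if "c i \<noteq> 0" for i
    using sum_nonneg_eq_0_iff[of UNIV "\<lambda>k. g k i"] that g0 by simp
  then have pos: "(P $ k $ i)\<^sup>2 = 0 \<or> (P $ k $ i)\<^sup>2 = 1" if "c i \<noteq> 0" for k i
    using that by (auto simp: g_def)
  show ?thesis
  proof (cases "c i = 0")
    case True
    then have others: "(P $ k $ j)\<^sup>2 = 0 \<or> (P $ k $ j)\<^sup>2 = 1" if "j \<noteq> i" for j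
      using pos c(2)[OF True, of j] that by metis
    have split: "(\<Sum>j\<in>UNIV. (P $ k $ j)\<^sup>2) = (P $ k $ i)\<^sup>2 + (\<Sum>j\<in>UNIV - {i}. (P $ k $ j)\<^sup>2)"
      by (rule sum.remove) auto
    show ?thesis
    proof (cases "\<exists>j. j \<noteq> i \<and> (P $ k $ j)\<^sup>2 = 1")
      case True
      then obtain j where j: "j \<noteq> i" "(P $ k $ j)\<^sup>2 = 1" by blast
      then have "(\<Sum>j\<in>UNIV - {i}. (P $ k $ j)\<^sup>2) \<ge> 1"
        using member_le_sum[of j "UNIV - {i}" "\<lambda>j. (P $ k $ j)\<^sup>2"] by auto
      then have "(P $ k $ i)\<^sup>2 \<le> 0" using split rows[of k] by linarith
      then show ?thesis by simp
    next
      case False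
      then have "(\<Sum>j\<in>UNIV - {i}. (P $ k $ j)\<^sup>2) = 0"
        using others by (intro sum.neutral) blast
      then show ?thesis using split rows[of k] by linarith
    qed
  qed (use pos in blast)
qed

section \<open>First-order perturbation of the joint diagonalizer\<close>

lemma smallo_1_mult_bigo:
  "f \<in> o[F](\<lambda>_. 1) \<Longrightarrow> g \<in> O[F](h) \<Longrightarrow> (\<lambda>x. f x * g x) \<in> o[F](h)" for f :: "'a \<Rightarrow> real"
  using landau_o.small_big_mult[of f F "\<lambda>_. 1" g h] by simp

lemma bigo_mult_smallo_1:
  "f \<in> O[F](h) \<Longrightarrow> g \<in> o[F](\<lambda>_. 1) \<Longrightarrow> (\<lambda>x. f x * g x) \<in> o[F](h)" for f :: "'a \<Rightarrow> real"
  using landau_o.big_small_mult[of f F h g "\<lambda>_. 1"] by simp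

lemma tendsto_imp_smallo_1: "(f \<longlongrightarrow> 0) F \<Longrightarrow> f \<in> o[F](\<lambda>_. 1 :: real)" for f :: "'a \<Rightarrow> real"
  by (rule smalloI_tendsto) auto

lemma smallo_cmult: "f \<in> o[F](g) \<Longrightarrow> (\<lambda>x. c * f x) \<in> o[F](g)" for f :: "'a \<Rightarrow> real"
  by (cases "c = 0") auto

lemma bigo_cmult: "f \<in> O[F](g) \<Longrightarrow> (\<lambda>x. c * f x) \<in> O[F](g)" for f :: "'a \<Rightarrow> real"
  by (cases "c = 0") auto

text \<open>Perturbation of the joint diagonalizer of diagonal matrices. With \<open>E = U - 1\<close> the first-order
  condition reads \<open>V k l * E k l = T k l + o(\<Sum>\<bar>E\<bar> + \<epsilon>)\<close>, from which first \<open>E = O(\<epsilon>)\<close> and then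
  the expansion follow.\<close>
locale joint_diagonality_perturbation =
  fixes F :: "'c filter" and \<epsilon> :: "'c \<Rightarrow> real" and I :: "'m set" and w :: "'m \<Rightarrow> real"
    and d :: "'m \<Rightarrow> 'n::finite \<Rightarrow> real"
    and C :: "'c \<Rightarrow> 'm \<Rightarrow> real ^ 'n ^ 'n" and U :: "'c \<Rightarrow> real ^ 'n ^ 'n"
  assumes eps: "(\<epsilon> \<longlongrightarrow> 0) F" "\<And>x. \<epsilon> x \<ge> 0"
    and finite_I: "finite I"
    and C_sym: "\<And>x m. m \<in> I \<Longrightarrow> transpose (C x m) = C x m"
    and C_rate: "\<And>m k l. m \<in> I \<Longrightarrow>
      (\<lambda>x. C x m $ k $ l - (if k = l then d m k else 0)) \<in> O[F](\<epsilon>)"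
    and U_max: "\<forall>\<^sub>F x in F. is_arg_max (joint_diagonality I w (C x)) orthogonal_matrix (U x)"
    and U_lim: "(U \<longlongrightarrow> mat 1) F"
    and separated: "\<And>k l. k \<noteq> l \<Longrightarrow> (\<Sum>m\<in>I. w m * (d m k - d m l)\<^sup>2) \<noteq> 0"
begin

definition E where "E k l x = U x $ k $ l - (if k = l then 1 else 0)"
definition \<Delta> where "\<Delta> m k l x = C x m $ k $ l - (if k = l then d m k else 0)"
definition T where "T k l x = (\<Sum>m\<in>I. w m * (d m k - d m l) * C x m $ k $ l)"
definition V where "V k l = (\<Sum>m\<in>I. w m * (d m k - d m l)\<^sup>2)"
text \<open>A provisional gauge: it dominates both \<epsilon> and all entries of \<open>E\<close>,
  so remainders can be measured before any rate for \<open>E\<close> is known.\<close>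

definition g where "g x = (\<Sum>k\<in>UNIV. \<Sum>l\<in>UNIV. \<bar>E k l x\<bar>) + \<epsilon> x"
definition D where "D m k l x = U x $ k \<bullet> (C x m *v U x $ l)"

lemma eps_o1: "\<epsilon> \<in> o[F](\<lambda>_. 1)"
  by (rule tendsto_imp_smallo_1[OF eps(1)])

lemma E_lim: "(E k l \<longlongrightarrow> 0) F"
proof -
  have "((\<lambda>x. U x $ k $ l) \<longlongrightarrow> mat 1 $ k $ l) F"
    by (intro tendsto_vec_nth U_lim)
  then have "((\<lambda>x. U x $ k $ l - mat 1 $ k $ l) \<longlongrightarrow> 0) F" by (rule LIM_zero)
  then show ?thesis by (simp add: E_def[abs_def] mat_def)
qed

lemma E_o1: "E k l \<in> o[F](\<lambda>_. 1)"
  by (rule tendsto_imp_smallo_1[OF E_lim])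

lemma E_bigo: "E k l \<in> O[F](g)"
proof (rule bigoI[where c = 1], intro always_eventually allI)
  fix x
  have "\<bar>E k l x\<bar> \<le> (\<Sum>l\<in>UNIV. \<bar>E k l x\<bar>)" by (rule member_le_sum) auto
  also have "\<dots> \<le> (\<Sum>k\<in>UNIV. \<Sum>l\<in>UNIV. \<bar>E k l x\<bar>)"
    by (rule member_le_sum[of k UNIV "\<lambda>k. \<Sum>l\<in>UNIV. \<bar>E k l x\<bar>"]) (auto intro: sum_nonneg)
  finally show "norm (E k l x) \<le> 1 * norm (g x)" using eps(2)[of x] by (simp add: g_def)
qed

lemma eps_bigo: "\<epsilon> \<in> O[F](g)"
proof (rule bigoI[where c = 1], intro always_eventually allI)
  fix x
  have "0 \<le> (\<Sum>k\<in>UNIV. \<Sum>l\<in>UNIV. \<bar>E k l x\<bar>)" by (intro sum_nonneg) auto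
  then show "norm (\<epsilon> x) \<le> 1 * norm (g x)" using eps(2)[of x] by (simp add: g_def)
qed

lemma EE: "(\<lambda>x. E k l x * E i j x) \<in> o[F](g)"
  by (rule smallo_1_mult_bigo[OF E_o1 E_bigo])

lemma \<Delta>_bigo: "m \<in> I \<Longrightarrow> \<Delta> m k l \<in> O[F](\<epsilon>)"
  unfolding \<Delta>_def[abs_def] by (rule C_rate)

lemma U_eq: "U x $ k $ l = (if k = l then 1 else 0) + E k l x"
  by (simp add: E_def)

lemma C_eq: "C x m $ k $ l = (if k = l then d m k else 0) + \<Delta> m k l x"
  by (simp add: \<Delta>_def)

text \<open>Orthogonality of \<open>1 + E\<close> reads
  \<open>E + transpose E = - E ** transpose E\<close>, and the right-hand side is quadratic in a
  quantity tending to zero.\<close>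

lemma skew: "(\<lambda>x. E k l x + E l k x) \<in> o[F](g)"
proof -
  have "(\<lambda>x. - (\<Sum>j\<in>UNIV. E k j x * E l j x)) \<in> o[F](g)"
    by (intro landau_o.small.uminus_in_iff[THEN iffD2] big_sum_in_smallo EE)
  moreover have "\<forall>\<^sub>F x in F. - (\<Sum>j\<in>UNIV. E k j x * E l j x) = E k l x + E l k x"
    using U_max
  proof eventually_elim
    case (elim x)
    have "(if k = l then 1 else 0) = (\<Sum>j\<in>UNIV. U x $ k $ j * U x $ l $ j)"
      using elim by (simp add: is_arg_max_linorder orthogonal_matrix_rows inner_vec_def)
    also have "\<dots> = (if k = l then 1 else 0) + E k l x + E l k x + (\<Sum>j\<in>UNIV. E k j x * E l j x)"
      unfolding U_eq by (simp add: distrib_left distrib_right sum.distrib if_distrib[of "\<lambda>a. a * _"]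
          if_distrib[of "\<lambda>a. _ * a"] cong: if_cong)
    finally show ?case by simp
  qed
  ultimately show ?thesis by (rule landau_o.small.in_cong[THEN iffD1, rotated])
qed

lemma diag_small: "E k k \<in> o[F](g)"
  using skew[of k k] by (simp add: landau_o.small.cmult_in_iff flip: mult_2)

lemma D_eq: "D m k l x = (\<Sum>i\<in>UNIV. \<Sum>j\<in>UNIV. U x $ k $ i * C x m $ i $ j * U x $ l $ j)"
  by (simp add: D_def inner_vec_def matrix_vector_mult_def sum_distrib_left mult.assoc)

text \<open>In the product of \<open>1 + E\<close>, \<open>d + \<Delta>\<close> and the transpose of
  \<open>1 + E\<close> the first-order part at \<open>k\<close>, \<open>l\<close> is
  \<open>d m k * E l k + d m l * E k l + \<Delta> m k l\<close>. By \<open>skew\<close> the entry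
  \<open>E l k\<close> becomes \<open>- E k l\<close>, and all other terms contain two small
  factors.\<close>

lemma D_off_diag:
  assumes "m \<in> I" "k \<noteq> l"
  shows "(\<lambda>x. D m k l x - ((d m l - d m k) * E k l x + C x m $ k $ l)) \<in> o[F](g)"
proof -
  have E\<Delta>: "(\<lambda>x. E i j x * \<Delta> m a b x) \<in> o[F](g)" for i j a b
    by (rule smallo_1_mult_bigo[OF E_o1 landau_o.big_trans[OF \<Delta>_bigo[OF assms(1)] eps_bigo]])
  have "(\<lambda>x. (E k i x * \<Delta> m i j x) * E l j x) \<in> o[F](g)" for i j
    using landau_o.small_mult[OF E\<Delta>[of k i i j] E_o1[of l j]] by simp
  then have small: "(\<lambda>x. d m k * (E k l x + E l k x) + (\<Sum>i\<in>UNIV. d m i * (E k i x * E l i x))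
     + (\<Sum>j\<in>UNIV. E l j x * \<Delta> m k j x) + (\<Sum>i\<in>UNIV. E k i x * \<Delta> m i l x)
     + (\<Sum>i\<in>UNIV. \<Sum>j\<in>UNIV. (E k i x * \<Delta> m i j x) * E l j x)) \<in> o[F](g)" (is "?r \<in> _")
    by (intro sum_in_smallo(1) big_sum_in_smallo smallo_cmult E\<Delta> EE skew)
  have "D m k l x - ((d m l - d m k) * E k l x + C x m $ k $ l) = ?r x" for x
  proof -
    have if_sum: "(\<Sum>j\<in>UNIV. if P then f j else 0) = (if P then \<Sum>j\<in>UNIV. f j else 0)"
      for P and f :: "'n \<Rightarrow> real" by simp
    have "D m k l x = (\<Sum>i\<in>UNIV. \<Sum>j\<in>UNIV. ((if k = i then 1 else 0) + E k i x) *
        ((if i = j then d m i else 0) + \<Delta> m i j x) * ((if l = j then 1 else 0) + E l j x))"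
      unfolding D_eq U_eq C_eq ..
    also have "\<dots> = d m k * E l k x + \<Delta> m k l x + (\<Sum>j\<in>UNIV. E l j x * \<Delta> m k j x)
      + d m l * E k l x + (\<Sum>i\<in>UNIV. d m i * (E k i x * E l i x))
      + (\<Sum>i\<in>UNIV. E k i x * \<Delta> m i l x) + (\<Sum>i\<in>UNIV. \<Sum>j\<in>UNIV. (E k i x * \<Delta> m i j x) * E l j x)"
      using assms(2) by (simp add: distrib_left distrib_right sum.distrib if_distrib[of "\<lambda>a. a * _"]
          if_distrib[of "\<lambda>a. _ * a"] mult_ac if_sum cong: if_cong)
    finally show ?thesis
      using assms(2) by (simp add: C_eq algebra_simps)
  qed
  then show ?thesis using small by simp
qed

text \<open>A limit without rate suffices here, because in the stationarity equation the diagonal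
  differences multiply off-diagonal entries that are already \<open>O(g)\<close>.\<close>

lemma D_diag:
  assumes "m \<in> I"
  shows "(D m k k \<longlongrightarrow> d m k) F"
proof -
  have U: "((\<lambda>x. U x $ k $ i) \<longlongrightarrow> (if k = i then 1 else 0)) F" for i
    using tendsto_vec_nth[OF tendsto_vec_nth[OF U_lim], of k i] by (simp add: mat_def)
  have C: "((\<lambda>x. C x m $ i $ j) \<longlongrightarrow> (if i = j then d m i else 0)) F" for i j
  proof -
    have "\<Delta> m i j \<in> o[F](\<lambda>_. 1)"
      using \<Delta>_bigo[OF assms] eps_o1 by (rule landau_o.big_small_trans)
    then have "(\<Delta> m i j \<longlongrightarrow> 0) F" using smalloD_tendsto by fastforce
    then have "((\<lambda>x. (if i = j then d m i else 0) + \<Delta> m i j x) \<longlongrightarrow> (if i = j then d m i else 0) + 0) F"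
      by (intro tendsto_intros)
    then show ?thesis by (simp add: C_eq)
  qed
  have "(D m k k \<longlongrightarrow> (\<Sum>i\<in>UNIV. \<Sum>j\<in>UNIV. (if k = i then 1 else 0) *
      (if i = j then d m i else 0) * (if k = j then 1 else 0))) F"
    unfolding D_eq[abs_def] by (intro tendsto_intros U C)
  then show ?thesis
    by (simp add: if_distrib[of "\<lambda>a. a * _"] if_distrib[of "\<lambda>a. _ * a"] cong: if_cong)
qed

lemma T_bigo: "k \<noteq> l \<Longrightarrow> T k l \<in> O[F](\<epsilon>)"
proof -
  assume "k \<noteq> l"
  then have "(\<lambda>x. w m * (d m k - d m l) * C x m $ k $ l) \<in> O[F](\<epsilon>)" if "m \<in> I" for m
    using landau_o.big.mult[OF bigo_const[of "w m * (d m k - d m l)" F] C_rate[OF that, of k l]]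
    by simp
  then show ?thesis
    unfolding T_def[abs_def] by (intro big_sum_in_bigo)
qed

text \<open>In the stationarity equation \<open>D m k l\<close> is replaced by its linear part
  \<open>L m\<close> and the diagonal difference by its limit \<open>d m k - d m l\<close>. Summing
  the products of these two gives \<open>T - V * E\<close>, and the replacement errors are
  \<open>o(g)\<close>.\<close>

lemma linearized_g:
  assumes "k \<noteq> l"
  shows "(\<lambda>x. V k l * E k l x - T k l x) \<in> o[F](g)"
proof -
  define L where "L m x = (d m l - d m k) * E k l x + C x m $ k $ l" for m x
  define H where "H m x = D m k k x - D m l l x - (d m k - d m l)" for m x
  have H: "H m \<in> o[F](\<lambda>_. 1)" if "m \<in> I" for m
  proof (rule tendsto_imp_smallo_1)
    have "(H m \<longlongrightarrow> d m k - d m l - (d m k - d m l)) F"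
      unfolding H_def by (intro tendsto_intros D_diag that)
    then show "(H m \<longlongrightarrow> 0) F" by simp
  qed
  have L: "L m \<in> O[F](g)" if "m \<in> I" for m
  proof -
    have "(\<lambda>x. (d m l - d m k) * E k l x) \<in> O[F](g)"
      using landau_o.big.mult[OF bigo_const[of "d m l - d m k" F] E_bigo[of k l]] by simp
    moreover have "(\<lambda>x. C x m $ k $ l) \<in> O[F](g)"
      using landau_o.big_trans[OF C_rate[OF that, of k l] eps_bigo] assms by simp
    ultimately show ?thesis unfolding L_def by (rule sum_in_bigo)
  qed
  have "(\<lambda>x. w m * ((D m k l x - L m x) * (d m k - d m l + H m x) + L m x * H m x)) \<in> o[F](g)"
    if "m \<in> I" for m
  proof -
    have DL: "(\<lambda>x. D m k l x - L m x) \<in> o[F](g)"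
      unfolding L_def by (rule D_off_diag[OF that assms])
    have "(\<lambda>x. d m k - d m l + H m x) \<in> O[F](\<lambda>_. 1)"
      by (intro sum_in_bigo bigo_const landau_o.small_imp_big H that)
    then have "(\<lambda>x. (D m k l x - L m x) * (d m k - d m l + H m x)) \<in> o[F](g)"
      using landau_o.small_big_mult[OF DL] by fastforce
    moreover have "(\<lambda>x. L m x * H m x) \<in> o[F](g)"
      by (rule bigo_mult_smallo_1[OF L[OF that] H[OF that]])
    ultimately have "(\<lambda>x. (D m k l x - L m x) * (d m k - d m l + H m x) + L m x * H m x) \<in> o[F](g)"
      by (rule sum_in_smallo)
    then show ?thesis
      using landau_o.big_small_mult[OF bigo_const[of "w m" F]] by fastforce
  qed
  then have "(\<lambda>x. \<Sum>m\<in>I. w m * ((D m k l x - L m x) * (d m k - d m l + H m x) + L m x * H m x))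
      \<in> o[F](g)"
    by (intro big_sum_in_smallo)
  moreover have "\<forall>\<^sub>F x in F. (\<Sum>m\<in>I. w m * ((D m k l x - L m x) * (d m k - d m l + H m x) + L m x * H m x))
      = V k l * E k l x - T k l x"
    using U_max
  proof eventually_elim
    case (elim x)
    have "(\<Sum>m\<in>I. w m * (D m k l x * (D m k k x - D m l l x))) = 0"
      unfolding D_def by (rule joint_diagonality_stationary[OF elim C_sym assms])
    moreover have "w m * ((D m k l x - L m x) * (d m k - d m l + H m x) + L m x * H m x) =
        w m * (D m k l x * (D m k k x - D m l l x))
        + (w m * (d m k - d m l)\<^sup>2 * E k l x - w m * (d m k - d m l) * C x m $ k $ l)" for m
      unfolding H_def L_def by (simp add: power2_eq_square algebra_simps)
    ultimately show ?case
      by (simp add: sum.distrib sum_subtractf V_def T_def flip: sum_distrib_right)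
  qed
  ultimately show ?thesis by (rule landau_o.small.in_cong[THEN iffD1, rotated])
qed

lemma E_split: "\<exists>a b. a \<in> O[F](\<epsilon>) \<and> b \<in> o[F](g) \<and> (\<forall>x. E k l x = a x + b x)"
proof (cases "k = l")
  case True
  then show ?thesis
    using diag_small by (intro exI[of _ "\<lambda>_. 0"] exI[of _ "E k l"]) auto
next
  case False
  then have V: "V k l \<noteq> 0" using separated by (simp add: V_def)
  show ?thesis
  proof (intro exI conjI allI)
    show "(\<lambda>x. T k l x / V k l) \<in> O[F](\<epsilon>)"
      using T_bigo[OF False] V using bigo_cmult[of _ F \<epsilon> "1 / V k l"] by simp
    show "(\<lambda>x. (V k l * E k l x - T k l x) / V k l) \<in> o[F](g)"
      using linearized_g[OF False] V using smallo_cmult[of _ F g "1 / V k l"] by fastforce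
    show "E k l x = T k l x / V k l + (V k l * E k l x - T k l x) / V k l" for x
      using V by (simp add: field_simps)
  qed
qed

text \<open>Absorption: the sum of all \<open>E\<close> is bounded by an
  \<open>O(\<epsilon>)\<close> part and an \<open>o(g)\<close> part, and the latter is eventually at
  most \<open>g / 2\<close> and moves to the left. From
  \<open>g \<le> c * \<epsilon> + g / 2 + \<epsilon>\<close> comes the constant
  \<open>2 * c + 2\<close>.\<close>

lemma g_bigo: "g \<in> O[F](\<epsilon>)"
proof -
  obtain a b where a: "\<And>k l. a k l \<in> O[F](\<epsilon>)" and b: "\<And>k l. b k l \<in> o[F](g)"
    and E: "\<And>k l x. E k l x = a k l x + b k l x"
    using E_split by metis
  define A where "A x = (\<Sum>k\<in>UNIV. \<Sum>l\<in>UNIV. \<bar>a k l x\<bar>)" for x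
  define B where "B x = (\<Sum>k\<in>UNIV. \<Sum>l\<in>UNIV. \<bar>b k l x\<bar>)" for x
  have "A \<in> O[F](\<epsilon>)" unfolding A_def by (intro big_sum_in_bigo) (simp add: a)
  then obtain c where c: "\<forall>\<^sub>F x in F. norm (A x) \<le> c * norm (\<epsilon> x)" by (elim landau_o.bigE)
  have "B \<in> o[F](g)" unfolding B_def by (intro big_sum_in_smallo) (simp add: b)
  then have "\<forall>\<^sub>F x in F. norm (B x) \<le> 1 / 2 * norm (g x)" by (rule landau_o.smallD) simp
  then have "\<forall>\<^sub>F x in F. norm (g x) \<le> (2 * c + 2) * norm (\<epsilon> x)"
    using c
  proof eventually_elim
    case (elim x)
    have "(\<Sum>k\<in>UNIV. \<Sum>l\<in>UNIV. \<bar>E k l x\<bar>) \<le> A x + B x"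
      unfolding A_def B_def sum.distrib[symmetric] E by (intro sum_mono abs_triangle_ineq)
    moreover have "0 \<le> (\<Sum>k\<in>UNIV. \<Sum>l\<in>UNIV. \<bar>E k l x\<bar>)" by (intro sum_nonneg) auto
    ultimately show ?case
      using elim eps(2)[of x] unfolding g_def by (auto simp: algebra_simps abs_le_iff)
  qed
  then show ?thesis by (rule bigoI)
qed

lemma smallo_g_imp_eps: "f \<in> o[F](g) \<Longrightarrow> f \<in> o[F](\<epsilon>)"
  by (rule landau_o.small_big_trans[OF _ g_bigo])

lemma maximizer_rate: "(\<lambda>x. U x $ k $ l - (if k = l then 1 else 0)) \<in> O[F](\<epsilon>)"
  using landau_o.big_trans[OF E_bigo g_bigo] by (simp add: E_def[abs_def])

lemma maximizer_diag: "(\<lambda>x. U x $ k $ k - 1) \<in> o[F](\<epsilon>)"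
  using smallo_g_imp_eps[OF diag_small[of k]] by (simp add: E_def[abs_def])

lemma maximizer_expansion:
  assumes "k \<noteq> l"
  shows "(\<lambda>x. (\<Sum>m\<in>I. w m * (d m k - d m l)\<^sup>2) * U x $ k $ l
    - (\<Sum>m\<in>I. w m * (d m k - d m l) * C x m $ k $ l)) \<in> o[F](\<epsilon>)"
  using smallo_g_imp_eps[OF linearized_g[OF assms]] assms by (simp add: E_def T_def V_def)

end

section \<open>Moments of whitened samples\<close>

text \<open>Mixed moments are indexed by lists of components, repetitions giving powers. Lists of
  bounded length form a finite set, and whitening can be undone one list element at a time.\<close>

definition sample_moment :: "nat \<Rightarrow> (nat \<Rightarrow> real ^ 'p) \<Rightarrow> 'p list \<Rightarrow> real" where
  "sample_moment n x L = (1 / real n) * (\<Sum>t<n. prod_list (map (($) (x t)) L))"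

text \<open>The moment \<open>E (\<Prod>i\<in>L. z\<^sub>i)\<close> of a vector with independent components
  whose marginal moments are \<open>\<mu> i j = E (z\<^sub>i\<^sup>j)\<close>.\<close>
definition product_moment :: "('p::finite \<Rightarrow> nat \<Rightarrow> real) \<Rightarrow> 'p list \<Rightarrow> real" where
  "product_moment \<mu> L = (\<Prod>i\<in>UNIV. \<mu> i (count_list L i))"

text \<open>The quadratic form at \<open>v\<close> is a mean of the squares of
  \<open>y t \<bullet> v\<close>. If all of these vanished, \<open>v\<close> would lie in the
  kernel.\<close>

lemma invertible_sample_cov_pos_def:
  assumes "invertible (sample_cov n x)"
  shows "pos_def (sample_cov n x)"
proof -
  define y where "y t = x t - sample_mean n x" for t
  let ?S = "sample_cov n x"
  have S: "?S $ k $ l = (1 / real n) * (\<Sum>t<n. y t $ k * y t $ l)" for k l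
    by (simp add: sample_cov_def y_def)
  have mult: "?S *v v = (1 / real n) *\<^sub>R (\<Sum>t<n. (y t \<bullet> v) *\<^sub>R y t)" for v
    by (simp add: vec_eq_iff matrix_vector_mult_def S inner_vec_def sum_distrib_left
        sum_distrib_right sum_divide_distrib mult_ac, subst sum.swap) simp
  have form: "v \<bullet> (?S *v v) = (1 / real n) * (\<Sum>t<n. (y t \<bullet> v)\<^sup>2)" for v
    unfolding mult by (simp add: inner_sum_right power2_eq_square inner_commute)
  have "0 < v \<bullet> (?S *v v)" if "v \<noteq> 0" for v
  proof -
    have "?S *v v \<noteq> 0"
      using assms that by (metis invertible_left_inverse matrix_left_invertible_ker)
    then have n: "n > 0" and "\<exists>t<n. y t \<bullet> v \<noteq> 0"
      unfolding mult by (auto intro!: Nat.gr0I sum.neutral)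
    then have "(\<Sum>t<n. (y t \<bullet> v)\<^sup>2) > 0"
      by (metis finite_lessThan lessThan_iff sum_pos2 zero_le_power2 zero_less_power2)
    then show ?thesis unfolding form using n by simp
  qed
  moreover have "transpose ?S = ?S"
    by (simp add: vec_eq_iff transpose_def S mult.commute)
  ultimately show ?thesis by (simp add: pos_def_def)
qed

lemma product_moment_singleton_zero:
  assumes "count_list L i = Suc 0" "\<mu> i (Suc 0) = 0"
  shows "product_moment \<mu> L = 0"
proof -
  have "\<mu> i (count_list L i) = 0" by (simp only: assms)
  then have "\<exists>i\<in>UNIV. \<mu> i (count_list L i) = 0" by blast
  then show ?thesis unfolding product_moment_def by (intro prod_zero finite)
qed

lemma product_moment_cong:
  "(\<And>i. count_list L i = count_list L' i) \<Longrightarrow> product_moment \<mu> L = product_moment \<mu> L'"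
  by (simp add: product_moment_def)

lemma product_moment_replicate:
  assumes "\<And>i. \<mu> i 0 = 1"
  shows "product_moment \<mu> (replicate j k) = \<mu> k j"
proof -
  have cnt: "count_list (replicate j k) i = (if i = k then j else 0)" for i
    by (cases "i = k"; induction j) simp_all
  have "product_moment \<mu> (replicate j k) = (\<Prod>i\<in>UNIV. if i = k then \<mu> k j else 1)"
    unfolding product_moment_def cnt by (intro prod.cong) (auto simp: assms)
  then show ?thesis by simp
qed

lemma replicate_numeral:
  "replicate 2 a = [a, a]" "replicate 3 a = [a, a, a]" "replicate 4 a = [a, a, a, a]"
  by (simp_all add: eval_nat_numeral)

context
  fixes \<mu> :: "'p::finite \<Rightarrow> nat \<Rightarrow> real"
  assumes \<mu>: "\<And>i. \<mu> i 0 = 1" "\<And>i. \<mu> i (Suc 0) = 0" "\<And>i. \<mu> i 2 = 1"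
begin

lemma product_moment_0: "product_moment \<mu> [] = 1"
  by (simp add: product_moment_def \<mu>)

lemma product_moment_1: "product_moment \<mu> [i] = 0"
  by (rule product_moment_singleton_zero[of _ i]) (simp_all add: \<mu>)

lemma product_moment_2: "product_moment \<mu> [i, j] = (if i = j then 1 else 0)"
proof (cases "i = j")
  case True
  then show ?thesis using product_moment_replicate[of \<mu> 2 i] by (simp add: \<mu>(1,3) replicate_numeral)
next
  case False
  then show ?thesis by (simp add: \<mu> product_moment_singleton_zero[of _ i])
qed

lemma product_moment_3: "product_moment \<mu> [i, j, k] = (if i = j \<and> j = k then \<mu> i 3 else 0)"
proof (cases "i = j \<and> j = k")
  case True
  then show ?thesis using product_moment_replicate[of \<mu> 3 i] by (simp add: \<mu>(1) replicate_numeral)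
next
  case False
  then have "count_list [i, j, k] i = Suc 0 \<or> count_list [i, j, k] j = Suc 0 \<or> count_list [i, j, k] k = Suc 0"
    by (cases "i = j"; cases "j = k"; cases "i = k") simp_all
  then obtain a where "count_list [i, j, k] a = Suc 0" by blast
  from product_moment_singleton_zero[OF this, of \<mu>] show ?thesis using False by (auto simp: \<mu>)
qed

text \<open>An index that occurs exactly once contributes the mean zero as a factor. If there is
  none, four positions must pair up, and each pair contributes the variance 1 unless all four
  coincide.\<close>

lemma product_moment_4:
  "product_moment \<mu> [i, j, k, l] = (if i = j \<and> j = k \<and> k = l then \<mu> i 4
    else if i = j \<and> k = l \<or> i = k \<and> j = l \<or> i = l \<and> j = k then 1 else 0)"
proof (cases "\<exists>a. count_list [i, j, k, l] a = 1")
  case True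
  then obtain a where "count_list [i, j, k, l] a = 1" by blast
  moreover from this have "\<not> (i = j \<and> k = l \<or> i = k \<and> j = l \<or> i = l \<and> j = k)"
    by (auto split: if_splits)
  ultimately show ?thesis
    using product_moment_singleton_zero[of "[i, j, k, l]" a \<mu>] by (auto simp: \<mu>)
next
  case False
  then have pairs: "i = j \<and> k = l \<or> i = k \<and> j = l \<or> i = l \<and> j = k" 
    by (auto dest: spec[of _ i] spec[of _ j] spec[of _ k] spec[of _ l] split: if_splits)
  show ?thesis
  proof (cases "i = j \<and> j = k \<and> k = l")
    case True
    then show ?thesis using product_moment_replicate[of \<mu> 4 i] by (simp add: \<mu>(1) replicate_numeral)
  next
    case neq: False
    have "product_moment \<mu> [i, j, k, l] = 1"
      unfolding product_moment_def
    proof (rule prod.neutral, rule ballI)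
      fix a
      have "count_list [i, j, k, l] a = 0 \<or> count_list [i, j, k, l] a = 2"
        using pairs neq by (cases "i = a"; cases "j = a"; cases "k = a"; cases "l = a") simp_all
      then show "\<mu> a (count_list [i, j, k, l] a) = 1" by (elim disjE) (simp_all only: \<mu>)
    qed
    then show ?thesis by (simp only: if_not_P[OF neq] if_P[OF pairs])
  qed
qed

end

section \<open>Expansion of the inverse root of the sample covariance matrix\<close>

lemma matrix_add_rdistrib:
  fixes A B :: "real ^ 'm ^ 'n"
  shows "(A + B) ** C = A ** C + B ** C"
  by (simp add: vec_eq_iff matrix_matrix_mult_def distrib_right sum.distrib)

lemma tendsto_matrix_entries:
  fixes A :: "'c \<Rightarrow> real ^ 'n ^ 'm"
  assumes "\<And>i j. ((\<lambda>c. A c $ i $ j) \<longlongrightarrow> B $ i $ j) F"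
  shows "(A \<longlongrightarrow> B) F"
  using assms by (intro vec_tendstoI)

lemma norm_matrix_le_sum_entries:
  fixes A :: "real ^ 'n ^ 'm"
  shows "norm A \<le> (\<Sum>i\<in>UNIV. \<Sum>j\<in>UNIV. \<bar>A $ i $ j\<bar>)"
proof -
  have "norm A \<le> (\<Sum>i\<in>UNIV. norm (A $ i))"
    unfolding norm_vec_def[of A] by (rule L2_set_le_sum) simp
  also have "\<dots> \<le> (\<Sum>i\<in>UNIV. \<Sum>j\<in>UNIV. \<bar>A $ i $ j\<bar>)"
    by (intro sum_mono norm_le_l1_cart)
  finally show ?thesis .
qed

lemma abs_matrix_entry_le_norm:
  fixes A :: "real ^ 'n ^ 'm"
  shows "\<bar>A $ i $ j\<bar> \<le> norm A"
  using Finite_Cartesian_Product.norm_nth_le[of A i] component_le_norm_cart[of "A $ i" j] by linarith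

text \<open>The deterministic side: samples indexed by an arbitrary filter, of which only the rate
  of the moments up to order \<open>r\<close> is known. Later an index is a pair of a sample size
  and an outcome off the exceptional event.\<close>

locale sample_expansion =
  fixes F :: "'c filter" and n :: "'c \<Rightarrow> nat" and x :: "'c \<Rightarrow> nat \<Rightarrow> real ^ 'p"
    and \<mu> :: "'p \<Rightarrow> nat \<Rightarrow> real" and r :: nat
  assumes n_lim: "filterlim n at_top F"
    and moment_rate: "\<And>L. length L \<le> r \<Longrightarrow>
      (\<lambda>c. sample_moment (n c) (x c) L - product_moment \<mu> L) \<in> O[F](\<lambda>c. 1 / sqrt (real (n c)))"
    and r: "r \<ge> 3"
    and \<mu>: "\<And>i. \<mu> i 0 = 1" "\<And>i. \<mu> i (Suc 0) = 0" "\<And>i. \<mu> i 2 = 1"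
begin

definition \<epsilon> where "\<epsilon> c = 1 / sqrt (real (n c))"
definition S where "S c = sample_cov (n c) (x c)"
definition A where "A c = inv_sqrt (S c)"
definition xbar where "xbar c = sample_mean (n c) (x c)"
definition m where "m L c = sample_moment (n c) (x c) L"
definition y where "y c = standardized (n c) (x c)"
definition D where "D i j c = A c $ i $ j - mat 1 $ i $ j"
definition R where "R i j c = S c $ i $ j - mat 1 $ i $ j"
text \<open>Only the components in \<open>L1\<close> are whitened, so that they can be replaced by raw
  components one at a time.\<close>
definition mix where "mix L1 L2 c = (1 / real (n c)) *
  (\<Sum>t<n c. prod_list (map (($) (y c t)) L1) * prod_list (map (($) (x c t)) L2))"

lemma eps_lim: "(\<epsilon> \<longlongrightarrow> 0) F"
proof -
  have "filterlim (\<lambda>c. sqrt (real (n c))) at_top F"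
    by (rule filterlim_compose[OF sqrt_at_top
        filterlim_compose[OF filterlim_real_sequentially n_lim]])
  then have "((\<lambda>c. inverse (sqrt (real (n c)))) \<longlongrightarrow> 0) F" by (rule tendsto_inverse_0_at_top)
  then show ?thesis by (simp add: \<epsilon>_def[abs_def] inverse_eq_divide)
qed

lemma eps_o1: "\<epsilon> \<in> o[F](\<lambda>_. 1)"
  by (rule tendsto_imp_smallo_1[OF eps_lim])

lemma eps_mult: "f \<in> O[F](\<epsilon>) \<Longrightarrow> g \<in> O[F](\<epsilon>) \<Longrightarrow> (\<lambda>c. f c * g c) \<in> o[F](\<epsilon>)"
  by (rule bigo_mult_smallo_1) (auto intro: landau_o.big_small_trans eps_o1)

lemma eps_imp_bigo_1: "f \<in> O[F](\<epsilon>) \<Longrightarrow> (\<lambda>c. a + f c) \<in> O[F](\<lambda>_. 1)"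
  by (intro sum_in_bigo bigo_const landau_o.big_trans[OF _ landau_o.small_imp_big[OF eps_o1]])

lemma m_rate: "length L \<le> r \<Longrightarrow> (\<lambda>c. m L c - product_moment \<mu> L) \<in> O[F](\<epsilon>)"
  unfolding m_def \<epsilon>_def[abs_def] by (rule moment_rate)

lemma m2_rate: "(\<lambda>c. m [i, j] c - mat 1 $ i $ j) \<in> O[F](\<epsilon>)"
  using m_rate[of "[i, j]"] r by (simp add: product_moment_2[of \<mu>, OF \<mu>] mat_def)

lemma xbar_m: "xbar c $ i = m [i] c"
  by (simp add: xbar_def sample_mean_def m_def sample_moment_def)

lemma xbar_rate: "(\<lambda>c. xbar c $ i) \<in> O[F](\<epsilon>)"
  using m_rate[of "[i]"] r by (simp add: product_moment_1[of \<mu>, OF \<mu>] xbar_m)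

lemma S_eq: "S c $ i $ j = m [i, j] c - xbar c $ i * xbar c $ j"
proof (cases "n c = 0")
  case True
  then show ?thesis by (simp add: S_def sample_cov_def m_def sample_moment_def xbar_def sample_mean_def)
next
  case False
  have "S c $ i $ j = (1 / real (n c)) *
      (\<Sum>t<n c. (x c t $ i - xbar c $ i) * (x c t $ j - xbar c $ j))"
    by (simp add: S_def sample_cov_def xbar_def)
  also have "(\<Sum>t<n c. (x c t $ i - xbar c $ i) * (x c t $ j - xbar c $ j)) =
      (\<Sum>t<n c. x c t $ i * x c t $ j) - xbar c $ j * (\<Sum>t<n c. x c t $ i)
      - xbar c $ i * (\<Sum>t<n c. x c t $ j) + real (n c) * (xbar c $ i * xbar c $ j)"
    by (simp add: algebra_simps sum.distrib sum_subtractf sum_distrib_left)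
  also have "(\<Sum>t<n c. x c t $ i) = real (n c) * xbar c $ i"
    using False by (simp add: xbar_def sample_mean_def)
  also have "(\<Sum>t<n c. x c t $ j) = real (n c) * xbar c $ j"
    using False by (simp add: xbar_def sample_mean_def)
  also have "(1 / real (n c)) * ((\<Sum>t<n c. x c t $ i * x c t $ j)
      - xbar c $ j * (real (n c) * xbar c $ i) - xbar c $ i * (real (n c) * xbar c $ j)
      + real (n c) * (xbar c $ i * xbar c $ j)) = m [i, j] c - xbar c $ i * xbar c $ j"
    using False by (simp add: m_def sample_moment_def diff_divide_distrib add_divide_distrib)
  finally show ?thesis .
qed

lemma R_expansion: "(\<lambda>c. R i j c - (m [i, j] c - mat 1 $ i $ j)) \<in> o[F](\<epsilon>)"
proof -
  have "(\<lambda>c. - (xbar c $ i * xbar c $ j)) \<in> o[F](\<epsilon>)"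
    using eps_mult[OF xbar_rate xbar_rate] by simp
  then show ?thesis by (simp add: R_def S_eq)
qed

lemma R_rate: "R i j \<in> O[F](\<epsilon>)"
  using sum_in_bigo(1)[OF landau_o.small_imp_big[OF R_expansion[of i j]] m2_rate[of i j]] by simp

lemma S_lim: "(S \<longlongrightarrow> mat 1) F"
proof (rule tendsto_matrix_entries)
  fix i j
  have "(R i j \<longlongrightarrow> 0) F"
    using smalloD_tendsto[OF landau_o.big_small_trans[OF R_rate eps_o1]] by simp
  then show "((\<lambda>c. S c $ i $ j) \<longlongrightarrow> mat 1 $ i $ j) F"
    unfolding R_def by (rule LIM_zero_cancel)
qed

lemma S_pos_def: "\<forall>\<^sub>F c in F. pos_def (S c)"
proof -
  have "((\<lambda>c. det (S c)) \<longlongrightarrow> det (mat 1 :: real ^ 'p ^ 'p)) F"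
    unfolding det_def by (intro tendsto_intros S_lim)
  then have "\<forall>\<^sub>F c in F. det (S c) > 0" by (rule order_tendstoD) simp
  then show ?thesis
  proof eventually_elim
    case (elim c)
    then show ?case
      unfolding S_def by (intro invertible_sample_cov_pos_def) (simp add: invertible_det_nz)
  qed
qed

text \<open>The inverse minus 1 equals minus the inverse times \<open>S c - mat 1\<close>; the first
  factor converges by continuity and the second has the rate \<epsilon>.\<close>

lemma matrix_inv_S_rate: "(\<lambda>c. norm (matrix_inv (S c) - mat 1)) \<in> O[F](\<epsilon>)"
proof -
  let ?X = "\<lambda>c. matrix_inv (S c)"
  have inv: "\<forall>\<^sub>F c in F. invertible (S c)"
    using S_pos_def by eventually_elim (rule pos_def_invertible)
  have "(?X \<longlongrightarrow> matrix_inv (mat 1)) F"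
  proof (rule continuous_on_tendsto_compose[OF continuous_on_matrix_inv S_lim])
    show "(mat 1 :: real ^ 'p ^ 'p) \<in> {A. invertible A}"
      by (simp add: pos_def_invertible pos_def_mat_1)
  qed (use inv in simp)
  then have X: "((\<lambda>c. ?X c $ i $ j) \<longlongrightarrow> matrix_inv (mat 1) $ i $ j) F" for i j
    by (intro tendsto_vec_nth)
  have "(\<lambda>c. ?X c $ i $ k * R k j c) \<in> O[F](\<epsilon>)" for i j k
    using landau_o.big.mult[OF bigoI_tendsto[where g = "\<lambda>_. 1", simplified, OF X] R_rate] by simp
  then have "(\<lambda>c. \<Sum>i\<in>UNIV. \<Sum>j\<in>UNIV. \<bar>\<Sum>k\<in>UNIV. ?X c $ i $ k * R k j c\<bar>) \<in> O[F](\<epsilon>)"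
    by (intro big_sum_in_bigo landau_o.big.abs_in_iff[THEN iffD2])
  moreover have "\<forall>\<^sub>F c in F. norm (norm (?X c - mat 1)) \<le>
      norm (\<Sum>i\<in>UNIV. \<Sum>j\<in>UNIV. \<bar>\<Sum>k\<in>UNIV. ?X c $ i $ k * R k j c\<bar>)"
    using inv
  proof eventually_elim
    case (elim c)
    have "(?X c - mat 1) $ i $ j = - (\<Sum>k\<in>UNIV. ?X c $ i $ k * R k j c)" for i j
    proof -
      have "(\<Sum>k\<in>UNIV. ?X c $ i $ k * R k j c) = (?X c ** S c - ?X c ** mat 1) $ i $ j"
        unfolding matrix_matrix_mult_def R_def by (simp add: right_diff_distrib sum_subtractf)
      then show ?thesis by (simp add: matrix_inv_inverse(2)[OF elim])
    qed
    then show ?case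
      using norm_matrix_le_sum_entries[of "?X c - mat 1"] by simp
  qed
  ultimately show ?thesis by (rule landau_o.big_trans[OF landau_o.big_mono, rotated])
qed

lemma D_rate: "D i j \<in> O[F](\<epsilon>)"
proof (rule landau_o.big_trans[OF landau_o.big_mono matrix_inv_S_rate])
  show "\<forall>\<^sub>F c in F. norm (D i j c) \<le> norm (norm (matrix_inv (S c) - mat 1))"
    using S_pos_def
  proof eventually_elim
    case (elim c)
    show ?case
      using norm_inv_sqrt_minus_mat_1[OF elim] abs_matrix_entry_le_norm[of "A c - mat 1" i j]
      by (simp add: D_def A_def)
  qed
qed

text \<open>Instead of expanding the root, the whitening identity
  \<open>(1 + d) ** (1 + \<rho>) ** (1 + d) = 1\<close> is multiplied out:
  \<open>d + d + \<rho>\<close> equals terms with at least two factors of order \<epsilon>. This is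
  the origin of the factor 1/2.\<close>

lemma D_expansion: "(\<lambda>c. D i j c + 1 / 2 * (m [i, j] c - mat 1 $ i $ j)) \<in> o[F](\<epsilon>)"
proof -
  let ?Q = "\<lambda>c. (\<Sum>k\<in>UNIV. D i k c * R k j c) + (\<Sum>k\<in>UNIV. D i k c * D k j c)
    + (\<Sum>k\<in>UNIV. R i k c * D k j c) + (\<Sum>k\<in>UNIV. (\<Sum>l\<in>UNIV. D i l c * R l k c) * D k j c)"
  have "(\<lambda>c. \<Sum>l\<in>UNIV. D i l c * R l k c) \<in> O[F](\<epsilon>)" for k
    by (intro big_sum_in_bigo landau_o.small_imp_big eps_mult D_rate R_rate)
  then have Q: "?Q \<in> o[F](\<epsilon>)"
    by (intro sum_in_smallo(1) big_sum_in_smallo eps_mult D_rate R_rate)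
  have "\<forall>\<^sub>F c in F. - 1 / 2 * ?Q c - 1 / 2 * (R i j c - (m [i, j] c - mat 1 $ i $ j))
      = D i j c + 1 / 2 * (m [i, j] c - mat 1 $ i $ j)"
    using S_pos_def
  proof eventually_elim
    case (elim c)
    define d where "d = A c - mat 1"
    define \<rho> where "\<rho> = S c - mat 1"
    have "mat 1 = (mat 1 + d) ** (mat 1 + \<rho>) ** (mat 1 + d)"
      using inv_sqrt_whitens[OF elim] by (simp add: d_def \<rho>_def A_def)
    also have "\<dots> = mat 1 + d + d + \<rho> + (d ** \<rho> + d ** d + \<rho> ** d + d ** \<rho> ** d)"
      by (simp add: matrix_add_ldistrib matrix_add_rdistrib matrix_mul_assoc add_ac)
    finally have "(0 :: real ^ 'p ^ 'p) = d + d + \<rho> + (d ** \<rho> + d ** d + \<rho> ** d + d ** \<rho> ** d)"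
      by (simp add: add.assoc)
    then have "(0 :: real ^ 'p ^ 'p) $ i $ j =
        (d + d + \<rho> + (d ** \<rho> + d ** d + \<rho> ** d + d ** \<rho> ** d)) $ i $ j"
      by (rule arg_cong)
    then have "0 = D i j c + D i j c + R i j c + ?Q c"
      unfolding matrix_matrix_mult_def d_def \<rho>_def D_def R_def
      by (simp add: sum.distrib)
    then show ?case by (simp add: field_simps)
  qed
  moreover have "(\<lambda>c. - 1 / 2 * ?Q c - 1 / 2 * (R i j c - (m [i, j] c - mat 1 $ i $ j))) \<in> o[F](\<epsilon>)"
    by (intro sum_in_smallo(2) smallo_cmult Q R_expansion)
  ultimately show ?thesis by (rule landau_o.small.in_cong[THEN iffD1])
qed

end

section \<open>Moments and cumulants of the whitened sample\<close>

context sample_expansion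
begin

text \<open>Component \<open>a\<close> of \<open>A c *v xbar c\<close>, the whitened centring
  term.\<close>

definition b where "b a c = xbar c $ a + (\<Sum>j\<in>UNIV. D a j c * xbar c $ j)"

lemma b_expansion: "(\<lambda>c. b a c - xbar c $ a) \<in> o[F](\<epsilon>)"
  unfolding b_def by (simp add: big_sum_in_smallo eps_mult D_rate xbar_rate)

lemma b_rate: "b a \<in> O[F](\<epsilon>)"
  using sum_in_bigo(1)[OF landau_o.small_imp_big[OF b_expansion[of a]] xbar_rate[of a]] by simp

lemma y_eq: "y c t $ a = x c t $ a + (\<Sum>j\<in>UNIV. D a j c * x c t $ j) - b a c"
proof -
  have "y c t = A c *v (x c t - xbar c)"
    by (simp add: y_def standardized_def A_def S_def xbar_def)
  also have "\<dots> = (x c t - xbar c) + (A c - mat 1) *v (x c t - xbar c)"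
    by (simp add: matrix_vector_mult_diff_rdistrib)
  finally show ?thesis
    by (simp add: matrix_vector_mult_def b_def D_def right_diff_distrib sum_subtractf)
qed

lemma mix_Nil: "mix [] L c = m L c"
  by (simp add: mix_def m_def sample_moment_def)

lemma mix_Cons:
  "mix (a # L1) L2 c = mix L1 (a # L2) c + (\<Sum>j\<in>UNIV. D a j c * mix L1 (j # L2) c) - b a c * mix L1 L2 c"
proof -
  define p where "p t = prod_list (map (($) (y c t)) L1)" for t
  define q where "q t = prod_list (map (($) (x c t)) L2)" for t
  define X where "X j = (\<Sum>t<n c. p t * (x c t $ j * q t))" for j
  define Y where "Y = (\<Sum>t<n c. p t * q t)"
  have "(\<Sum>t<n c. (y c t $ a * p t) * q t) =
      (\<Sum>t<n c. p t * (x c t $ a * q t) + (\<Sum>j\<in>UNIV. D a j c * (p t * (x c t $ j * q t))) - b a c * (p t * q t))"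
    by (intro sum.cong refl) (simp add: y_eq algebra_simps sum_distrib_left sum_distrib_right)
  also have "\<dots> = X a + (\<Sum>j\<in>UNIV. D a j c * X j) - b a c * Y"
    unfolding X_def Y_def by (simp add: sum.distrib sum_subtractf sum_distrib_left) (rule sum.swap)
  finally have "mix (a # L1) L2 c = (1 / real (n c)) * (X a + (\<Sum>j\<in>UNIV. D a j c * X j) - b a c * Y)"
    by (simp add: mix_def p_def q_def)
  moreover have "mix L1 (j # L2) c = (1 / real (n c)) * X j" for j
    by (simp add: mix_def X_def p_def q_def)
  moreover have "mix L1 L2 c = (1 / real (n c)) * Y"
    by (simp add: mix_def Y_def p_def q_def)
  ultimately show ?thesis
    by (simp add: distrib_left right_diff_distrib sum_distrib_left mult.left_commute)
qed

lemma mix_rate: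
  "length L1 + length L2 \<le> r \<Longrightarrow> (\<lambda>c. mix L1 L2 c - product_moment \<mu> (L1 @ L2)) \<in> O[F](\<epsilon>)"
proof (induction L1 arbitrary: L2)
  case Nil
  then show ?case using m_rate[of L2] by (simp add: mix_Nil)
next
  case (Cons a L1)
  have bounded: "mix L1 L \<in> O[F](\<lambda>_. 1)" if "length L1 + length L \<le> r" for L
    using eps_imp_bigo_1[OF Cons.IH[OF that], of "product_moment \<mu> (L1 @ L)"] by simp
  have "product_moment \<mu> (L1 @ a # L2) = product_moment \<mu> (a # L1 @ L2)"
    by (rule product_moment_cong) simp
  then have 1: "(\<lambda>c. mix L1 (a # L2) c - product_moment \<mu> (a # L1 @ L2)) \<in> O[F](\<epsilon>)"
    using Cons.IH[of "a # L2"] Cons.prems by simp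
  have 2: "(\<lambda>c. \<Sum>j\<in>UNIV. D a j c * mix L1 (j # L2) c) \<in> O[F](\<epsilon>)"
  proof (rule big_sum_in_bigo)
    fix j
    show "(\<lambda>c. D a j c * mix L1 (j # L2) c) \<in> O[F](\<epsilon>)"
      using landau_o.big.mult[OF D_rate bounded[of "j # L2"]] Cons.prems by simp
  qed
  have 3: "(\<lambda>c. b a c * mix L1 L2 c) \<in> O[F](\<epsilon>)"
    using landau_o.big.mult[OF b_rate bounded[of L2]] Cons.prems by simp
  show ?case
    using sum_in_bigo(2)[OF sum_in_bigo(1)[OF 1 2] 3] by (simp add: mix_Cons algebra_simps)
qed

text \<open>The corrections in \<open>mix_Cons\<close> carry a factor \<open>D\<close> or
  \<open>b\<close> of order \<epsilon>. Up to \<open>o(\<epsilon>)\<close> the mixed moments next to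
  them may thus be replaced by population moments, and \<open>D\<close> and \<open>b\<close> by
  their leading terms. The strict bound on the lengths leaves room for the additional index
  \<open>j\<close>.\<close>

lemma mix_Cons_expansion:
  assumes "length L1 + length L2 < r"
  shows "(\<lambda>c. mix (a # L1) L2 c - (mix L1 (a # L2) c
      - 1 / 2 * (\<Sum>j\<in>UNIV. (m [a, j] c - mat 1 $ a $ j) * product_moment \<mu> (j # L1 @ L2))
      - xbar c $ a * product_moment \<mu> (L1 @ L2))) \<in> o[F](\<epsilon>)"
proof -
  have perm: "product_moment \<mu> (L1 @ j # L2) = product_moment \<mu> (j # L1 @ L2)" for j
    by (rule product_moment_cong) simp
  have 1: "(\<lambda>c. D a j c * (mix L1 (j # L2) c - product_moment \<mu> (j # L1 @ L2))) \<in> o[F](\<epsilon>)" for j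
    using mix_rate[of L1 "j # L2"] assms by (intro eps_mult D_rate) (simp add: perm)
  have 2: "(\<lambda>c. b a c * (mix L1 L2 c - product_moment \<mu> (L1 @ L2))) \<in> o[F](\<epsilon>)"
    using mix_rate[of L1 L2] assms by (intro eps_mult b_rate) simp
  have "(\<lambda>c. (\<Sum>j\<in>UNIV. D a j c * (mix L1 (j # L2) c - product_moment \<mu> (j # L1 @ L2)))
      + (\<Sum>j\<in>UNIV. product_moment \<mu> (j # L1 @ L2) * (D a j c + 1 / 2 * (m [a, j] c - mat 1 $ a $ j)))
      - b a c * (mix L1 L2 c - product_moment \<mu> (L1 @ L2))
      - product_moment \<mu> (L1 @ L2) * (b a c - xbar c $ a)) \<in> o[F](\<epsilon>)" (is "?f \<in> _")
    by (intro sum_in_smallo big_sum_in_smallo smallo_cmult 1 2 D_expansion b_expansion)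
  also have "?f = (\<lambda>c. mix (a # L1) L2 c - (mix L1 (a # L2) c
      - 1 / 2 * (\<Sum>j\<in>UNIV. (m [a, j] c - mat 1 $ a $ j) * product_moment \<mu> (j # L1 @ L2))
      - xbar c $ a * product_moment \<mu> (L1 @ L2)))"
    by (rule ext) (simp add: mix_Cons sum.distrib sum_subtractf sum_distrib_left algebra_simps)
  finally show ?thesis .
qed

lemma smallo_diff_trans:
  assumes "(\<lambda>c. f c - g c) \<in> o[F](\<epsilon>)" "(\<lambda>c. g c - h c) \<in> o[F](\<epsilon>)"
  shows "(\<lambda>c. f c - h c) \<in> o[F](\<epsilon>)"
  using sum_in_smallo(1)[OF assms] by simp

lemmas product_moments =
  product_moment_0[of \<mu>, OF \<mu>] product_moment_1[of \<mu>, OF \<mu>] product_moment_2[of \<mu>, OF \<mu>]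
  product_moment_3[of \<mu>, OF \<mu>] product_moment_4[of \<mu>, OF \<mu>]

text \<open>Undoing the whitening of the two components \<open>k\<close> costs nothing, because the
  population moments involved contain the single index \<open>l\<close>. Only the component
  \<open>l\<close> contributes: its root term pairs with \<open>\<mu> k 3\<close>, and its centring
  term turns the raw moment into \<open>r_hat\<close>.\<close>

lemma mix_3_expansion:
  assumes "k \<noteq> l"
  shows "(\<lambda>c. mix [k, k, l] [] c - (r_hat (n c) (x c) k l - 1 / 2 * \<mu> k 3 * s_hat (n c) (x c) k l))
    \<in> o[F](\<epsilon>)"
proof -
  have 1: "(\<lambda>c. mix [k, k, l] [] c - mix [k, l] [k] c) \<in> o[F](\<epsilon>)"
    using mix_Cons_expansion[of "[k, l]" "[]" k] r assms by (simp add: product_moments cong: if_cong)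
  have 2: "(\<lambda>c. mix [k, l] [k] c - mix [l] [k, k] c) \<in> o[F](\<epsilon>)"
    using mix_Cons_expansion[of "[l]" "[k]" k] r assms by (auto simp: product_moments cong: if_cong)
  have 3: "(\<lambda>c. mix [l] [k, k] c -
      (m [l, k, k] c - 1 / 2 * ((m [l, k] c - mat 1 $ l $ k) * \<mu> k 3) - xbar c $ l)) \<in> o[F](\<epsilon>)"
    using mix_Cons_expansion[of "[]" "[k, k]" l] r
    by (simp add: product_moments mix_Nil if_distrib[of "\<lambda>a. _ * a"] cong: if_cong)
  note smallo_diff_trans[OF smallo_diff_trans[OF 1 2] 3]
  moreover have "m [l, k, k] c - xbar c $ l = r_hat (n c) (x c) k l" for c
    by (simp add: xbar_m m_def sample_moment_def r_hat_def algebra_simps sum_subtractf power2_eq_square)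
  moreover have "m [l, k] c - mat 1 $ l $ k = s_hat (n c) (x c) k l" for c
    using assms by (simp add: m_def sample_moment_def s_hat_def mat_def mult.commute)
  ultimately show ?thesis by (simp add: algebra_simps)
qed

text \<open>Each of the three components \<open>k\<close> contributes half of \<open>s_hat\<close>,
  since its correction index must equal \<open>l\<close> to pair up; this is the 3. The component
  \<open>l\<close> contributes the factor \<open>\<mu> k 4\<close>, and its centring term supplies
  the \<open>\<mu> k 3\<close> in \<open>q_hat\<close>.\<close>

lemma mix_4_expansion:
  assumes "k \<noteq> l" "r \<ge> 4"
  shows "(\<lambda>c. mix [k, k, k, l] [] c - (q_hat (\<lambda>k. \<mu> k 3) (n c) (x c) k l
    - 1 / 2 * (3 + \<mu> k 4) * s_hat (n c) (x c) k l)) \<in> o[F](\<epsilon>)"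
proof -
  let ?h = "\<lambda>c. 1 / 2 * (m [k, l] c - mat 1 $ k $ l)"
  have pm: "product_moment \<mu> [j, k, k, l] = (if j = l then 1 else 0)"
    "product_moment \<mu> [j, k, l, k] = (if j = l then 1 else 0)"
    "product_moment \<mu> [j, l, k, k] = (if j = l then 1 else 0)"
    "product_moment \<mu> [k, k, l] = 0" "product_moment \<mu> [k, l, k] = 0"
    "product_moment \<mu> [l, k, k] = 0" for j
    using assms(1) by (auto simp: product_moments)
  have 1: "(\<lambda>c. mix [k, k, k, l] [] c - (mix [k, k, l] [k] c - ?h c)) \<in> o[F](\<epsilon>)"
    using mix_Cons_expansion[of "[k, k, l]" "[]" k] assms
    by (simp add: pm if_distrib[of "\<lambda>a. _ * a"] cong: if_cong)
  have 2: "(\<lambda>c. mix [k, k, l] [k] c - (mix [k, l] [k, k] c - ?h c)) \<in> o[F](\<epsilon>)"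
    using mix_Cons_expansion[of "[k, l]" "[k]" k] assms
    by (simp add: pm if_distrib[of "\<lambda>a. _ * a"] cong: if_cong)
  have 3: "(\<lambda>c. mix [k, l] [k, k] c - (mix [l] [k, k, k] c - ?h c)) \<in> o[F](\<epsilon>)"
    using mix_Cons_expansion[of "[l]" "[k, k]" k] assms
    by (simp add: pm if_distrib[of "\<lambda>a. _ * a"] cong: if_cong)
  have 4: "(\<lambda>c. mix [l] [k, k, k] c - (m [l, k, k, k] c
      - 1 / 2 * ((m [l, k] c - mat 1 $ l $ k) * \<mu> k 4) - xbar c $ l * \<mu> k 3)) \<in> o[F](\<epsilon>)"
    using mix_Cons_expansion[of "[]" "[k, k, k]" l] assms
    by (simp add: product_moments mix_Nil if_distrib[of "\<lambda>a. _ * a"] cong: if_cong)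
  note sum_in_smallo(1)[OF sum_in_smallo(1)[OF sum_in_smallo(1)[OF 1 2] 3] 4]
  moreover have "m [l, k, k, k] c - xbar c $ l * \<mu> k 3 = q_hat (\<lambda>k. \<mu> k 3) (n c) (x c) k l" for c
  proof -
    have "(\<Sum>t<n c. ((x c t $ k) ^ 3 - \<mu> k 3) * x c t $ l) =
        (\<Sum>t<n c. x c t $ l * (x c t $ k * (x c t $ k * x c t $ k))) - (\<Sum>t<n c. x c t $ l) * \<mu> k 3"
      unfolding sum_distrib_right sum_subtractf[symmetric]
      by (intro sum.cong refl) (simp add: power3_eq_cube algebra_simps)
    then show ?thesis
      by (simp add: xbar_m m_def sample_moment_def q_hat_def diff_divide_distrib)
  qed
  moreover have "m [l, k] c - mat 1 $ l $ k = s_hat (n c) (x c) k l"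
    "m [k, l] c - mat 1 $ k $ l = s_hat (n c) (x c) k l" for c
    using assms by (simp_all add: m_def sample_moment_def s_hat_def mat_def mult.commute)
  ultimately show ?thesis by (simp add: algebra_simps)
qed

text \<open>Second moments of the whitened sample are exact, not merely asymptotic, so the products
  subtracted in the fourth cumulants are constants and add no first-order term.\<close>

lemma mix_2: "\<forall>\<^sub>F c in F. \<forall>i j. mix [i, j] [] c = (if i = j then 1 else 0)"
  using S_pos_def
proof eventually_elim
  case (elim c)
  define u where "u t = x c t - xbar c" for t
  have "mix [i, j] [] c = (A c ** S c ** transpose (A c)) $ i $ j" for i j
  proof -
    have "mix [i, j] [] c = (1 / real (n c)) * (\<Sum>t<n c. (\<Sum>k\<in>UNIV. A c $ i $ k * u t $ k) * (\<Sum>l\<in>UNIV. A c $ j $ l * u t $ l))"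
      by (simp add: mix_def y_def standardized_def A_def S_def u_def xbar_def matrix_vector_mult_def)
    also have "\<dots> = (1 / real (n c)) * (\<Sum>t<n c. \<Sum>l\<in>UNIV. \<Sum>k\<in>UNIV. A c $ i $ k * (u t $ k * u t $ l) * A c $ j $ l)"
      unfolding sum_product by (subst sum.swap[of _ UNIV UNIV]) (simp add: mult_ac)
    also have "\<dots> = (\<Sum>l\<in>UNIV. \<Sum>k\<in>UNIV. A c $ i $ k * ((1 / real (n c)) * (\<Sum>t<n c. u t $ k * u t $ l)) * A c $ j $ l)"
      by (simp add: sum_distrib_left sum_distrib_right sum_divide_distrib sum.swap[of _ "{..<n c}"])
    also have "\<dots> = (A c ** S c ** transpose (A c)) $ i $ j"
      by (simp add: matrix_matrix_mult_def transpose_def S_def sample_cov_def u_def xbar_def sum_distrib_right)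
    finally show ?thesis .
  qed
  then show ?case
    using inv_sqrt_whitens[OF elim] inv_sqrt(1)[OF elim] by (simp add: A_def pos_def_def mat_def)
qed

lemma sample_cumulant3_mix: "sample_cumulant3 (n c) (x c) i $ k $ l = mix [i, k, l] [] c"
  by (simp add: sample_cumulant3_def cumulant3_def integral_uniform_count_measure mix_def y_def mult.assoc)

lemma sample_cumulant4_mix: "sample_cumulant4 (n c) (x c) i j $ k $ l =
    mix [i, j, k, l] [] c - mix [i, j] [] c * mix [k, l] [] c - mix [i, k] [] c * mix [j, l] [] c
    - mix [j, k] [] c * mix [i, l] [] c"
  by (simp add: sample_cumulant4_def cumulant4_def integral_uniform_count_measure mix_def y_def mult.assoc)

lemma sample_cumulant3_rate: "(\<lambda>c. sample_cumulant3 (n c) (x c) i $ k $ l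
    - (if i = k \<and> k = l then \<mu> i 3 else 0)) \<in> O[F](\<epsilon>)"
  using mix_rate[of "[i, k, l]" "[]"] r by (simp add: sample_cumulant3_mix product_moments)

lemma sample_cumulant4_eventually: "\<forall>\<^sub>F c in F. sample_cumulant4 (n c) (x c) i j $ k $ l =
    mix [i, j, k, l] [] c - (if i = j \<and> k = l then 1 else 0) - (if i = k \<and> j = l then 1 else 0)
    - (if j = k \<and> i = l then 1 else 0)"
  using mix_2
proof eventually_elim
  case (elim c)
  have and_mult: "(if P then 1 else 0) * (if Q then 1 else 0) = (if P \<and> Q then 1 else (0 :: real))" for P Q
    by simp
  show ?case unfolding sample_cumulant4_mix elim[rule_format] and_mult ..
qed

text \<open>The three subtracted pairings cancel the value 1 that the fourth moment takes on paired
  indices. When all indices agree, all three apply and leave the excess kurtosis.\<close>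

lemma sample_cumulant4_rate:
  assumes "r \<ge> 4"
  shows "(\<lambda>c. sample_cumulant4 (n c) (x c) i j $ k $ l
    - (if i = j \<and> j = k \<and> k = l then \<mu> i 4 - 3 else 0)) \<in> O[F](\<epsilon>)"
proof -
  have "(\<lambda>c. mix [i, j, k, l] [] c - product_moment \<mu> [i, j, k, l]) \<in> O[F](\<epsilon>)"
    using mix_rate[of "[i, j, k, l]" "[]"] assms by simp
  moreover have "\<forall>\<^sub>F c in F. mix [i, j, k, l] [] c - product_moment \<mu> [i, j, k, l] =
      sample_cumulant4 (n c) (x c) i j $ k $ l - (if i = j \<and> j = k \<and> k = l then \<mu> i 4 - 3 else 0)"
    using sample_cumulant4_eventually[of i j k l]
  proof eventually_elim
    case (elim c)
    show ?case
      unfolding elim product_moments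
      by (cases "i = j"; cases "j = k"; cases "k = l"; cases "i = k"; cases "i = l"; cases "j = l")
        simp_all
  qed
  ultimately show ?thesis by (rule landau_o.big.in_cong[THEN iffD1, rotated])
qed

lemma sample_cumulant3_expansion:
  assumes "k \<noteq> l"
  shows "(\<lambda>c. sample_cumulant3 (n c) (x c) k $ k $ l
    - (r_hat (n c) (x c) k l - 1 / 2 * \<mu> k 3 * s_hat (n c) (x c) k l)) \<in> o[F](\<epsilon>)"
  using mix_3_expansion[OF assms] by (simp add: sample_cumulant3_mix)

lemma sample_cumulant4_expansion:
  assumes "k \<noteq> l" "r \<ge> 4"
  shows "(\<lambda>c. sample_cumulant4 (n c) (x c) k k $ k $ l - (q_hat (\<lambda>k. \<mu> k 3) (n c) (x c) k l
    - 1 / 2 * (3 + \<mu> k 4) * s_hat (n c) (x c) k l)) \<in> o[F](\<epsilon>)"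
proof -
  have "\<forall>\<^sub>F c in F. mix [k, k, k, l] [] c - (q_hat (\<lambda>k. \<mu> k 3) (n c) (x c) k l
      - 1 / 2 * (3 + \<mu> k 4) * s_hat (n c) (x c) k l) =
      sample_cumulant4 (n c) (x c) k k $ k $ l - (q_hat (\<lambda>k. \<mu> k 3) (n c) (x c) k l
      - 1 / 2 * (3 + \<mu> k 4) * s_hat (n c) (x c) k l)"
    using sample_cumulant4_eventually[of k k k l]
  proof eventually_elim
    case (elim c)
    then show ?case using assms(1) by simp
  qed
  then show ?thesis
    using mix_4_expansion[OF assms] by (rule landau_o.small.in_cong[THEN iffD1])
qed

end

section \<open>Expansion of the estimator\<close>

lemma norm_diag_part_conjugate:
  fixes U C :: "real ^ 'p ^ 'p"
  shows "(norm (diag_part (U ** C ** transpose U)))\<^sup>2 = (\<Sum>k\<in>UNIV. (U $ k \<bullet> (C *v U $ k))\<^sup>2)"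
proof -
  have "(U ** C ** transpose U) $ k $ k = U $ k \<bullet> (C *v U $ k)" for k
    by (simp add: matrix_matrix_mult_def transpose_def inner_vec_def matrix_vector_mult_def
        sum_distrib_left sum_distrib_right mult_ac, subst sum.swap)
      (simp add: mult.commute mult.left_commute)
  moreover have "(norm (diag_part M))\<^sup>2 = (\<Sum>k\<in>UNIV. (M $ k $ k)\<^sup>2)" for M :: "real ^ 'p ^ 'p"
    unfolding power2_norm_eq_inner
    by (simp add: inner_vec_def diag_part_def power2_eq_square if_distrib[of "\<lambda>a. a * _"] cong: if_cong)
  ultimately show ?thesis by simp
qed

lemma transpose_sample_cumulants:
  "transpose (sample_cumulant3 n x i) = sample_cumulant3 n x i"
  "transpose (sample_cumulant4 n x i j) = sample_cumulant4 n x i j"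
  by (simp_all add: vec_eq_iff transpose_def sample_cumulant3_def cumulant3_def
      sample_cumulant4_def cumulant4_def mult_ac)

text \<open>The third cumulant matrices are indexed by the left, the fourth ones by the right summand;
  the latter are dropped for \<open>\<alpha> = 1\<close>, where they need not converge.\<close>

definition cumulant_indices :: "real \<Rightarrow> ('p + 'p \<times> 'p) set" where
  "cumulant_indices \<alpha> = range Inl \<union> (if \<alpha> = 1 then {} else range Inr)"

definition cumulant_weight :: "real \<Rightarrow> 'p + 'p \<times> 'p \<Rightarrow> real" where
  "cumulant_weight \<alpha> = case_sum (\<lambda>i. \<alpha>) (\<lambda>ij. 1 - \<alpha>)"

definition sample_cumulants ::
    "nat \<Rightarrow> (nat \<Rightarrow> real ^ 'p) \<Rightarrow> 'p + 'p \<times> 'p \<Rightarrow> real ^ 'p ^ 'p" where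
  "sample_cumulants n x = case_sum (sample_cumulant3 n x) (\<lambda>(i, j). sample_cumulant4 n x i j)"

text \<open>The diagonals of the population cumulant matrices, which are diagonal because the
  components are independent.\<close>

definition cumulant_diagonal :: "('p \<Rightarrow> real) \<Rightarrow> ('p \<Rightarrow> real) \<Rightarrow> 'p + 'p \<times> 'p \<Rightarrow> 'p \<Rightarrow> real" where
  "cumulant_diagonal \<gamma> \<kappa> m k = case_sum (\<lambda>i. if i = k then \<gamma> i else 0)
     (\<lambda>(i, j). if i = j \<and> j = k then \<kappa> i else 0) m"

lemma finite_cumulant_indices: "finite (cumulant_indices \<alpha> :: ('p::finite + 'p \<times> 'p) set)"
  by (simp add: cumulant_indices_def)

lemma sum_cumulant_indices:
  fixes f :: "'p::finite + 'p \<times> 'p \<Rightarrow> real"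
  shows "(\<Sum>m\<in>cumulant_indices \<alpha>. cumulant_weight \<alpha> m * f m) =
    \<alpha> * (\<Sum>i\<in>UNIV. f (Inl i)) + (1 - \<alpha>) * (\<Sum>i\<in>UNIV. \<Sum>j\<in>UNIV. f (Inr (i, j)))"
proof -
  have l: "(\<Sum>m\<in>range Inl. cumulant_weight \<alpha> m * f m) = \<alpha> * (\<Sum>i\<in>UNIV. f (Inl i))"
    by (subst sum.reindex) (simp_all add: cumulant_weight_def sum_distrib_left)
  have "(\<Sum>m\<in>range Inr. cumulant_weight \<alpha> m * f m) = (1 - \<alpha>) * (\<Sum>ij\<in>UNIV. f (Inr ij))"
    by (subst sum.reindex) (simp_all add: cumulant_weight_def sum_distrib_left)
  also have "(\<Sum>ij\<in>UNIV. f (Inr ij)) = (\<Sum>i\<in>UNIV. \<Sum>j\<in>UNIV. f (Inr (i, j)))"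
    by (simp add: sum.cartesian_product)
  finally have r: "(\<Sum>m\<in>range Inr. cumulant_weight \<alpha> m * f m) =
    (1 - \<alpha>) * (\<Sum>i\<in>UNIV. \<Sum>j\<in>UNIV. f (Inr (i, j)))" .
  show ?thesis
  proof (cases "\<alpha> = 1")
    case True
    then show ?thesis using l by (simp add: cumulant_indices_def)
  next
    case False
    have "(\<Sum>m\<in>range Inl \<union> range Inr. cumulant_weight \<alpha> m * f m) =
        (\<Sum>m\<in>range Inl. cumulant_weight \<alpha> m * f m) + (\<Sum>m\<in>range Inr. cumulant_weight \<alpha> m * f m)"
      by (rule sum.union_disjoint) auto
    then show ?thesis using False l r by (simp add: cumulant_indices_def)
  qed
qed

lemma acm_objective_joint_diagonality:
  "acm_objective \<alpha> n x = joint_diagonality (cumulant_indices \<alpha>) (cumulant_weight \<alpha>) (sample_cumulants n x)"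
  by (rule ext) (simp add: acm_objective_def joint_diagonality_def sum_cumulant_indices
      norm_diag_part_conjugate sample_cumulants_def)

text \<open>Only the matrices labelled \<open>k\<close> or \<open>l\<close> distinguish the two
  diagonal positions. The free \<open>f\<close> is later a sample entry, giving the numerators, or
  the difference itself, giving the denominators.\<close>

lemma sum_cumulant_diagonal_diff:
  fixes f :: "'p::finite + 'p \<times> 'p \<Rightarrow> real"
  shows "(\<Sum>m\<in>cumulant_indices \<alpha>. cumulant_weight \<alpha> m *
      (cumulant_diagonal \<gamma> \<kappa> m k - cumulant_diagonal \<gamma> \<kappa> m l) * f m) =
    \<alpha> * (\<gamma> k * f (Inl k) - \<gamma> l * f (Inl l))
    + (1 - \<alpha>) * (\<kappa> k * f (Inr (k, k)) - \<kappa> l * f (Inr (l, l)))"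
proof -
  have "(\<Sum>i\<in>UNIV. (cumulant_diagonal \<gamma> \<kappa> (Inl i) k - cumulant_diagonal \<gamma> \<kappa> (Inl i) l) * f (Inl i))
      = \<gamma> k * f (Inl k) - \<gamma> l * f (Inl l)"
    by (simp add: cumulant_diagonal_def left_diff_distrib sum_subtractf if_distrib[of "\<lambda>a. a * _"]
        cong: if_cong)
  moreover have "(\<Sum>i\<in>UNIV. \<Sum>j\<in>UNIV. (cumulant_diagonal \<gamma> \<kappa> (Inr (i, j)) k
      - cumulant_diagonal \<gamma> \<kappa> (Inr (i, j)) l) * f (Inr (i, j)))
      = \<kappa> k * f (Inr (k, k)) - \<kappa> l * f (Inr (l, l))"
  proof -
    have "(\<Sum>i\<in>UNIV. \<Sum>j\<in>UNIV. cumulant_diagonal \<gamma> \<kappa> (Inr (i, j)) k * f (Inr (i, j))) =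
        \<kappa> k * f (Inr (k, k))" for k
    proof -
      have "(\<Sum>j\<in>UNIV. cumulant_diagonal \<gamma> \<kappa> (Inr (i, j)) k * f (Inr (i, j))) =
          (\<Sum>j\<in>UNIV. if j = i then (if i = k then \<kappa> k * f (Inr (k, k)) else 0) else 0)" for i
        by (intro sum.cong) (auto simp: cumulant_diagonal_def)
      then show ?thesis by simp
    qed
    then show ?thesis by (simp add: left_diff_distrib sum_subtractf)
  qed
  ultimately show ?thesis
    by (simp add: mult.assoc sum_cumulant_indices)
qed

lemma sum_cumulant_diagonal_diff_square:
  fixes k l :: "'p::finite"
  assumes "k \<noteq> l"
  shows "(\<Sum>m\<in>cumulant_indices \<alpha>. cumulant_weight \<alpha> m *
      (cumulant_diagonal \<gamma> \<kappa> m k - cumulant_diagonal \<gamma> \<kappa> m l)\<^sup>2) =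
    \<alpha> * ((\<gamma> k)\<^sup>2 + (\<gamma> l)\<^sup>2) + (1 - \<alpha>) * ((\<kappa> k)\<^sup>2 + (\<kappa> l)\<^sup>2)"
proof -
  let ?d = "cumulant_diagonal \<gamma> \<kappa>"
  have "(\<Sum>m\<in>cumulant_indices \<alpha>. cumulant_weight \<alpha> m * (?d m k - ?d m l)\<^sup>2) =
      (\<Sum>m\<in>cumulant_indices \<alpha>. cumulant_weight \<alpha> m * (?d m k - ?d m l) * (?d m k - ?d m l))"
    by (simp add: power2_eq_square mult.assoc)
  also have "\<dots> = \<alpha> * (\<gamma> k * (?d (Inl k) k - ?d (Inl k) l) - \<gamma> l * (?d (Inl l) k - ?d (Inl l) l))
      + (1 - \<alpha>) * (\<kappa> k * (?d (Inr (k, k)) k - ?d (Inr (k, k)) l)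
        - \<kappa> l * (?d (Inr (l, l)) k - ?d (Inr (l, l)) l))"
    by (rule sum_cumulant_diagonal_diff)
  finally show ?thesis
    using assms by (simp add: cumulant_diagonal_def power2_eq_square)
qed

definition diagonal_matrix :: "('p \<Rightarrow> real) \<Rightarrow> real ^ 'p ^ 'p" where
  "diagonal_matrix d = (\<chi> k l. if k = l then d k else 0)"

lemma limit_objective:
  fixes U :: "real ^ 'p ^ 'p"
  shows "joint_diagonality (cumulant_indices \<alpha>) (cumulant_weight \<alpha>)
      (\<lambda>m. diagonal_matrix (cumulant_diagonal \<gamma> \<kappa> m)) U =
    (\<Sum>i\<in>UNIV. (\<alpha> * (\<gamma> i)\<^sup>2 + (1 - \<alpha>) * (\<kappa> i)\<^sup>2) * (\<Sum>k\<in>UNIV. (U $ k $ i) ^ 4))"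
proof -
  have q: "u \<bullet> (diagonal_matrix d *v u) = (\<Sum>i\<in>UNIV. d i * (u $ i)\<^sup>2)" for u :: "real ^ 'p" and d
    by (simp add: inner_vec_def diagonal_matrix_def matrix_vector_mult_def power2_eq_square mult_ac
        if_distrib[of "\<lambda>a. a * _"] if_distrib[of "\<lambda>a. _ * a"] cong: if_cong)
  have 3: "(\<Sum>a\<in>UNIV. cumulant_diagonal \<gamma> \<kappa> (Inl i) a * u a) = \<gamma> i * u i" for i u
    by (simp add: cumulant_diagonal_def if_distrib[of "\<lambda>a. a * _"] cong: if_cong)
  have 4: "(\<Sum>a\<in>UNIV. cumulant_diagonal \<gamma> \<kappa> (Inr (i, j)) a * u a) = (if j = i then \<kappa> i * u i else 0)"
    for i j u
    by (simp add: cumulant_diagonal_def if_distrib[of "\<lambda>a. a * _"] cong: if_cong)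
  have sq: "(\<Sum>k\<in>UNIV. (a * (U $ k $ i)\<^sup>2)\<^sup>2) = a\<^sup>2 * (\<Sum>k\<in>UNIV. (U $ k $ i) ^ 4)" for a i
    by (simp add: power_mult_distrib sum_distrib_left flip: power_mult)
  have if_sq: "(\<Sum>k\<in>UNIV. (if j = i then f k else 0)\<^sup>2) = (if j = i then (\<Sum>k\<in>UNIV. (f k)\<^sup>2) else (0 :: real))"
    for i j :: 'p and f :: "'p \<Rightarrow> real" by simp
  show ?thesis
    unfolding joint_diagonality_def sum_cumulant_indices q 3 4 if_sq sq
    by (simp add: sum_distrib_left sum.distrib distrib_right mult.assoc)
qed

text \<open>The identity attains the total weight, hence so does every maximizer, which forces a
  signed permutation. The invariance is stated for arbitrary matrices \<open>D\<close> because it is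
  applied to the sample objective, not to the limit.\<close>

lemma limit_objective_symmetry:
  fixes P :: "real ^ 'p ^ 'p"
  assumes \<alpha>: "\<alpha> \<in> {0..1}"
    and zero: "\<And>k l. \<alpha> * (\<gamma> k)\<^sup>2 + (1 - \<alpha>) * (\<kappa> k)\<^sup>2 = 0 \<Longrightarrow> \<alpha> * (\<gamma> l)\<^sup>2 + (1 - \<alpha>) * (\<kappa> l)\<^sup>2 = 0 \<Longrightarrow> k = l"
    and max: "is_arg_max (joint_diagonality (cumulant_indices \<alpha>) (cumulant_weight \<alpha>)
      (\<lambda>m. diagonal_matrix (cumulant_diagonal \<gamma> \<kappa> m))) orthogonal_matrix P"
  shows "joint_diagonality I w D (transpose P ** U) = joint_diagonality I w D U"
proof (rule joint_diagonality_signed_permutation)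
  let ?c = "\<lambda>i. \<alpha> * (\<gamma> i)\<^sup>2 + (1 - \<alpha>) * (\<kappa> i)\<^sup>2"
  show P: "orthogonal_matrix P" using max by (simp add: is_arg_max_linorder)
  have "(\<Sum>i\<in>UNIV. ?c i * (\<Sum>k\<in>UNIV. (mat 1 $ k $ i :: real) ^ 4)) \<le>
      (\<Sum>i\<in>UNIV. ?c i * (\<Sum>k\<in>UNIV. (P $ k $ i) ^ 4))"
    using max orthogonal_matrix_id unfolding is_arg_max_linorder limit_objective by blast
  moreover have "(\<Sum>k\<in>UNIV. (mat 1 $ k $ i :: real) ^ 4) = 1" for i :: 'p
    by (simp add: mat_def if_distrib[of "\<lambda>a. a ^ 4"] cong: if_cong)
  ultimately have le: "(\<Sum>i\<in>UNIV. ?c i) \<le> (\<Sum>i\<in>UNIV. ?c i * (\<Sum>k\<in>UNIV. (P $ k $ i) ^ 4))" by simp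
  show "(P $ k $ i)\<^sup>2 = 0 \<or> (P $ k $ i)\<^sup>2 = 1" for k i
    by (rule fourth_power_maximizer_01[OF P _ zero le]) (use \<alpha> in auto)
qed

context sample_expansion
begin

text \<open>The inverse root is \<open>1 + D\<close>, and \<open>U - 1\<close> and \<open>D\<close>
  are both of order \<epsilon>, so their product is negligible and the expansions of the rotation
  and of the root simply add.\<close>

lemma acm_expansion:
  fixes \<alpha> :: real and U :: "'c \<Rightarrow> real ^ 'p ^ 'p"
  defines "\<gamma> \<equiv> \<lambda>k. \<mu> k 3" and "\<beta> \<equiv> \<lambda>k. \<mu> k 4" and "\<kappa> \<equiv> \<lambda>k. \<mu> k 4 - 3"
  defines "W \<equiv> \<lambda>c. U c ** inv_sqrt (sample_cov (n c) (x c))"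
  assumes \<alpha>: "\<alpha> \<in> {0..1}" "\<alpha> \<noteq> 1 \<Longrightarrow> r \<ge> 4"
    and zero: "\<And>k l. \<alpha> * (\<gamma> k)\<^sup>2 + (1 - \<alpha>) * (\<kappa> k)\<^sup>2 = 0 \<Longrightarrow> \<alpha> * (\<gamma> l)\<^sup>2 + (1 - \<alpha>) * (\<kappa> l)\<^sup>2 = 0 \<Longrightarrow> k = l"
    and max: "\<forall>\<^sub>F c in F. is_arg_max (acm_objective \<alpha> (n c) (x c)) orthogonal_matrix (U c) \<and>
      (\<forall>V. is_arg_max (acm_objective \<alpha> (n c) (x c)) orthogonal_matrix V \<longrightarrow>
        dist (U c) (mat 1) \<le> dist V (mat 1))"
  shows "(W \<longlongrightarrow> mat 1) F"
    and "(\<lambda>c. (W c $ k $ k - 1) - - (1 / 2) * (s_hat (n c) (x c) k k - 1)) \<in> o[F](\<epsilon>)"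
    and "l \<noteq> k \<Longrightarrow> (\<lambda>c. W c $ k $ l - (\<alpha> * psi1_hat \<gamma> (n c) (x c) k l
        + (1 - \<alpha>) * psi2_hat \<gamma> \<beta> \<kappa> (n c) (x c) k l)
      / (\<alpha> * ((\<gamma> k)\<^sup>2 + (\<gamma> l)\<^sup>2) + (1 - \<alpha>) * ((\<kappa> k)\<^sup>2 + (\<kappa> l)\<^sup>2))) \<in> o[F](\<epsilon>)"
proof -
  let ?I = "cumulant_indices \<alpha> :: ('p + 'p \<times> 'p) set" and ?w = "cumulant_weight \<alpha>"
  let ?d = "cumulant_diagonal \<gamma> \<kappa>" and ?C = "\<lambda>c. sample_cumulants (n c) (x c)"
  have rate: "(\<lambda>c. ?C c m $ k $ l - (if k = l then ?d m k else 0)) \<in> O[F](\<epsilon>)" if "m \<in> ?I" for m k l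
  proof (cases m)
    case (Inl i)
    then have "(if k = l then ?d m k else 0) = (if i = k \<and> k = l then \<mu> i 3 else 0)"
      by (simp add: cumulant_diagonal_def \<gamma>_def)
    then show ?thesis
      using sample_cumulant3_rate[of i k l] Inl by (simp add: sample_cumulants_def)
  next
    case (Inr ij)
    then obtain i j where ij: "m = Inr (i, j)" by (cases ij) auto
    then have "r \<ge> 4" using that \<alpha>(2) by (auto simp: cumulant_indices_def split: if_splits)
    moreover have "(if k = l then ?d m k else 0) = (if i = j \<and> j = k \<and> k = l then \<mu> i 4 - 3 else 0)"
      by (simp add: ij cumulant_diagonal_def \<kappa>_def)
    ultimately show ?thesis
      using sample_cumulant4_rate[of i j k l] by (simp add: ij sample_cumulants_def)
  qed
  have tr: "transpose (?C c m) = ?C c m" for c m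
    by (cases m) (auto simp: sample_cumulants_def transpose_sample_cumulants)
  have lim: "((\<lambda>c. ?C c m) \<longlongrightarrow> diagonal_matrix (?d m)) F" if "m \<in> ?I" for m
  proof (rule tendsto_matrix_entries)
    fix k l
    have "((\<lambda>c. ?C c m $ k $ l - (if k = l then ?d m k else 0)) \<longlongrightarrow> 0) F"
      using smalloD_tendsto[OF landau_o.big_small_trans[OF rate[OF that] eps_o1]] by simp
    then show "((\<lambda>c. ?C c m $ k $ l) \<longlongrightarrow> diagonal_matrix (?d m) $ k $ l) F"
      unfolding diagonal_matrix_def by (simp add: LIM_zero_iff)
  qed
  have U_lim: "(U \<longlongrightarrow> mat 1) F"
    by (rule nearest_maximizer_tendsto_mat_1[OF finite_cumulant_indices lim
          limit_objective_symmetry[OF \<alpha>(1) zero] max[unfolded acm_objective_joint_diagonality]])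
  have c0: "0 \<le> \<alpha> * (\<gamma> i)\<^sup>2 + (1 - \<alpha>) * (\<kappa> i)\<^sup>2" for i using \<alpha>(1) by auto
  have V: "\<alpha> * ((\<gamma> k)\<^sup>2 + (\<gamma> l)\<^sup>2) + (1 - \<alpha>) * ((\<kappa> k)\<^sup>2 + (\<kappa> l)\<^sup>2) \<noteq> 0" if "k \<noteq> l" for k l
  proof
    assume "\<alpha> * ((\<gamma> k)\<^sup>2 + (\<gamma> l)\<^sup>2) + (1 - \<alpha>) * ((\<kappa> k)\<^sup>2 + (\<kappa> l)\<^sup>2) = 0"
    then have "(\<alpha> * (\<gamma> k)\<^sup>2 + (1 - \<alpha>) * (\<kappa> k)\<^sup>2) + (\<alpha> * (\<gamma> l)\<^sup>2 + (1 - \<alpha>) * (\<kappa> l)\<^sup>2) = 0"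
      by (simp add: algebra_simps)
    then show False using zero[of k l] c0[of k] c0[of l] that by linarith
  qed
  interpret P: joint_diagonality_perturbation F \<epsilon> ?I ?w ?d ?C U
  proof
    show "(\<epsilon> \<longlongrightarrow> 0) F" by (rule eps_lim)
    show "0 \<le> \<epsilon> c" for c by (simp add: \<epsilon>_def)
    show "transpose (?C c m) = ?C c m" for c m
      by (rule tr)
    show "\<forall>\<^sub>F c in F. is_arg_max (joint_diagonality ?I ?w (?C c)) orthogonal_matrix (U c)"
      using max unfolding acm_objective_joint_diagonality by eventually_elim blast
    show "(\<Sum>m\<in>?I. ?w m * (?d m k - ?d m l)\<^sup>2) \<noteq> 0" if "k \<noteq> l" for k l
      unfolding sum_cumulant_diagonal_diff_square[OF that] by (rule V[OF that])
  qed (use finite_cumulant_indices rate U_lim in auto)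
  have W: "(\<lambda>c. W c $ k $ l - (U c $ k $ l + D k l c)) \<in> o[F](\<epsilon>)" for k l
  proof -
    have "(\<lambda>c. \<Sum>j\<in>UNIV. (U c $ k $ j - (if k = j then 1 else 0)) * D j l c) \<in> o[F](\<epsilon>)"
      by (intro big_sum_in_smallo eps_mult P.maximizer_rate D_rate)
    moreover have "(\<Sum>j\<in>UNIV. (U c $ k $ j - (if k = j then 1 else 0)) * D j l c) =
        W c $ k $ l - (U c $ k $ l + D k l c)" for c
    proof -
      have "W c $ k $ l = (\<Sum>j\<in>UNIV. U c $ k $ j * (mat 1 $ j $ l + D j l c))"
        by (simp add: W_def D_def A_def S_def matrix_matrix_mult_def)
      then show ?thesis
        by (simp add: mat_def distrib_left left_diff_distrib sum.distrib sum_subtractf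
            if_distrib[of "\<lambda>a. a * _"] if_distrib[of "\<lambda>a. _ * a"] cong: if_cong)
    qed
    ultimately show ?thesis by simp
  qed
  have sm: "m [k, l] c = s_hat (n c) (x c) k l" for k l c
    by (simp add: m_def sample_moment_def s_hat_def)
  show "(\<lambda>c. (W c $ k $ k - 1) - - (1 / 2) * (s_hat (n c) (x c) k k - 1)) \<in> o[F](\<epsilon>)"
    using sum_in_smallo(1)[OF sum_in_smallo(1)[OF W[of k k] P.maximizer_diag[of k]] D_expansion[of k k]]
    by (simp add: sm mat_def algebra_simps)
  have W_rate: "(\<lambda>c. W c $ k $ l - mat 1 $ k $ l) \<in> O[F](\<epsilon>)" for k l
    using sum_in_bigo(1)[OF sum_in_bigo(1)[OF landau_o.small_imp_big[OF W[of k l]]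
        P.maximizer_rate[of k l]] D_rate[of k l]]
    by (simp add: mat_def algebra_simps)
  show "(W \<longlongrightarrow> mat 1) F"
  proof (rule tendsto_matrix_entries)
    fix k l
    have "((\<lambda>c. W c $ k $ l - mat 1 $ k $ l) \<longlongrightarrow> 0) F"
      using smalloD_tendsto[OF landau_o.big_small_trans[OF W_rate eps_o1]] by simp
    then show "((\<lambda>c. W c $ k $ l) \<longlongrightarrow> mat 1 $ k $ l) F" by (rule LIM_zero_cancel)
  qed
  assume "l \<noteq> k"
  then have kl: "k \<noteq> l" by simp
  let ?V = "\<alpha> * ((\<gamma> k)\<^sup>2 + (\<gamma> l)\<^sup>2) + (1 - \<alpha>) * ((\<kappa> k)\<^sup>2 + (\<kappa> l)\<^sup>2)"
  let ?s = "\<lambda>c. s_hat (n c) (x c) k l"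
  let ?C3 = "\<lambda>k l c. sample_cumulant3 (n c) (x c) k $ k $ l"
  let ?C4 = "\<lambda>k l c. sample_cumulant4 (n c) (x c) k k $ k $ l"
  let ?e3 = "\<lambda>k l c. r_hat (n c) (x c) k l - 1 / 2 * \<gamma> k * s_hat (n c) (x c) k l"
  let ?e4 = "\<lambda>k l c. q_hat \<gamma> (n c) (x c) k l - 1 / 2 * (3 + \<beta> k) * s_hat (n c) (x c) k l"
  have e1: "(\<lambda>c. ?V * U c $ k $ l - (\<alpha> * (\<gamma> k * ?C3 k l c - \<gamma> l * ?C3 l k c)
      + (1 - \<alpha>) * (\<kappa> k * ?C4 k l c - \<kappa> l * ?C4 l k c))) \<in> o[F](\<epsilon>)"
  proof -
    have sym: "?C c m $ k $ l = ?C c m $ l $ k" for c m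
      by (subst tr[symmetric]) (simp add: transpose_def)
    have "?C c (Inl l) $ k $ l = ?C3 l k c" "?C c (Inr (l, l)) $ k $ l = ?C4 l k c" for c
      unfolding sym by (simp_all add: sample_cumulants_def)
    then show ?thesis
      using P.maximizer_expansion[OF kl]
      unfolding sum_cumulant_diagonal_diff_square[OF kl] sum_cumulant_diagonal_diff
      by (simp add: sample_cumulants_def)
  qed
  have e2: "(\<lambda>c. \<alpha> * (\<gamma> k * (?C3 k l c - ?e3 k l c) - \<gamma> l * (?C3 l k c - ?e3 l k c))) \<in> o[F](\<epsilon>)"
    using kl unfolding \<gamma>_def
    by (intro smallo_cmult sum_in_smallo(2) sample_cumulant3_expansion) auto
  have e3: "(\<lambda>c. (1 - \<alpha>) * (\<kappa> k * (?C4 k l c - ?e4 k l c) - \<kappa> l * (?C4 l k c - ?e4 l k c))) \<in> o[F](\<epsilon>)"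
  \<comment> \<open>For \<alpha> = 1 no fourth-order expansion is available, but then the factor
    \<open>1 - \<alpha>\<close> is zero.\<close>
  proof (cases "\<alpha> = 1")
    case False
    then show ?thesis
      using kl \<alpha>(2) unfolding \<beta>_def \<gamma>_def
      by (intro smallo_cmult sum_in_smallo(2) sample_cumulant4_expansion) auto
  qed simp
  have "(\<lambda>c. (?V * U c $ k $ l - (\<alpha> * (\<gamma> k * ?C3 k l c - \<gamma> l * ?C3 l k c)
      + (1 - \<alpha>) * (\<kappa> k * ?C4 k l c - \<kappa> l * ?C4 l k c)))
      + \<alpha> * (\<gamma> k * (?C3 k l c - ?e3 k l c) - \<gamma> l * (?C3 l k c - ?e3 l k c))
      + (1 - \<alpha>) * (\<kappa> k * (?C4 k l c - ?e4 k l c) - \<kappa> l * (?C4 l k c - ?e4 l k c))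
      + ?V * (W c $ k $ l - (U c $ k $ l + D k l c))
      + ?V * (D k l c + 1 / 2 * (m [k, l] c - mat 1 $ k $ l))) \<in> o[F](\<epsilon>)" (is "?f \<in> _")
    by (rule sum_in_smallo(1)[OF sum_in_smallo(1)[OF sum_in_smallo(1)[OF sum_in_smallo(1)[OF e1 e2] e3]
          smallo_cmult[OF W]] smallo_cmult[OF D_expansion]])
  moreover have "?f = (\<lambda>c. ?V * W c $ k $ l - (\<alpha> * psi1_hat \<gamma> (n c) (x c) k l
        + (1 - \<alpha>) * psi2_hat \<gamma> \<beta> \<kappa> (n c) (x c) k l))"
  proof
    fix c
    have s: "s_hat (n c) (x c) l k = ?s c" by (simp add: s_hat_def mult.commute)
    have \<beta>: "\<beta> i = \<kappa> i + 3" for i by (simp add: \<beta>_def \<kappa>_def)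
    \<comment> \<open>In the skewness part the cumulants contribute half of
      \<open>(\<gamma> l)\<^sup>2 - (\<gamma> k)\<^sup>2\<close> to the coefficient of
      \<open>?s c\<close>, and the root half of
      \<open>- (\<gamma> k)\<^sup>2 - (\<gamma> l)\<^sup>2\<close>; together
      \<open>- (\<gamma> k)\<^sup>2\<close>. With \<open>\<beta> i = \<kappa> i + 3\<close> the
      kurtosis part adds up likewise to
      \<open>- (\<kappa> k * \<beta> k - 3 * \<kappa> l)\<close>.\<close>
    show "?f c = ?V * W c $ k $ l - (\<alpha> * psi1_hat \<gamma> (n c) (x c) k l
        + (1 - \<alpha>) * psi2_hat \<gamma> \<beta> \<kappa> (n c) (x c) k l)"
      using kl by (simp add: psi1_hat_def psi2_hat_def s sm \<beta> mat_def field_simps power2_eq_square)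
  qed
  ultimately have "(\<lambda>c. (1 / ?V) * (?V * W c $ k $ l - (\<alpha> * psi1_hat \<gamma> (n c) (x c) k l
        + (1 - \<alpha>) * psi2_hat \<gamma> \<beta> \<kappa> (n c) (x c) k l))) \<in> o[F](\<epsilon>)"
    by (intro smallo_cmult) simp
  moreover have "(1 / ?V) * (?V * a - b) = a - b / ?V" for a b
    using V[OF kl] by (simp add: right_diff_distrib)
  ultimately show "(\<lambda>c. W c $ k $ l - (\<alpha> * psi1_hat \<gamma> (n c) (x c) k l
        + (1 - \<alpha>) * psi2_hat \<gamma> \<beta> \<kappa> (n c) (x c) k l) / ?V) \<in> o[F](\<epsilon>)"
    by simp
qed

end

section \<open>Convergence in probability\<close>

text \<open>Cross terms vanish by independence, so the variance of the sum is linear in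
  \<open>n\<close> and the scaling by \<open>sqrt (real n)\<close> makes the bound uniform in
  \<open>n\<close>. The variance is relaxed to the second moment.\<close>

lemma (in prob_space) sample_mean_deviation:
  fixes Y :: "nat \<Rightarrow> 'a \<Rightarrow> real"
  assumes indep: "indep_vars (\<lambda>_. borel) Y UNIV"
    and int: "\<And>i. integrable M (Y i)" "\<And>i. integrable M (\<lambda>\<omega>. (Y i \<omega>)\<^sup>2)"
    and mean: "\<And>i. expectation (Y i) = e" and second: "\<And>i. expectation (\<lambda>\<omega>. (Y i \<omega>)\<^sup>2) = s"
    and K: "K > 0"
  shows "prob {\<omega> \<in> space M. K < \<bar>sqrt (real n) * ((1 / real n) * (\<Sum>i<n. Y i \<omega>) - e)\<bar>} \<le> s / K\<^sup>2"
proof -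
  define X where "X i \<omega> = Y i \<omega> - e" for i \<omega>
  define S where "S \<omega> = (\<Sum>i<n. X i \<omega>)" for \<omega>
  have X_int: "integrable M (X i)" for i unfolding X_def using int(1) by simp
  have X_mean: "expectation (X i) = 0" for i
    unfolding X_def using int(1) mean by (simp add: prob_space)
  have X_sq: "(X i \<omega>)\<^sup>2 = (Y i \<omega>)\<^sup>2 - 2 * e * Y i \<omega> + e\<^sup>2" for i \<omega>
    by (simp add: X_def power2_eq_square algebra_simps)
  have X_sq_int: "integrable M (\<lambda>\<omega>. (X i \<omega>)\<^sup>2)" for i
    unfolding X_sq using int by simp
  have X_second: "expectation (\<lambda>\<omega>. (X i \<omega>)\<^sup>2) = s - e\<^sup>2" for i
    unfolding X_sq using int mean second by (simp add: prob_space power2_eq_square)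
  have X_indep: "indep_vars (\<lambda>_. borel) X J" for J
    unfolding X_def
    by (rule indep_vars_compose2[OF indep_vars_subset[OF indep subset_UNIV]]) simp
  have prod: "integrable M (\<lambda>\<omega>. X i \<omega> * X j \<omega>)"
    "expectation (\<lambda>\<omega>. X i \<omega> * X j \<omega>) = (if i = j then s - e\<^sup>2 else 0)" for i j
  proof -
    have "integrable M (\<lambda>\<omega>. X i \<omega> * X j \<omega>) \<and>
      expectation (\<lambda>\<omega>. X i \<omega> * X j \<omega>) = (if i = j then s - e\<^sup>2 else 0)"
    proof (cases "i = j")
      case True
      then show ?thesis using X_sq_int[of i] X_second[of i] by (simp add: power2_eq_square)
    next
      case False
      have "integrable M (\<lambda>\<omega>. \<Prod>k\<in>{i, j}. X k \<omega>)"
        by (rule indep_vars_integrable[OF _ X_indep]) (simp_all add: X_int)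
      moreover have "expectation (\<lambda>\<omega>. \<Prod>k\<in>{i, j}. X k \<omega>) = (\<Prod>k\<in>{i, j}. expectation (X k))"
        by (rule indep_vars_lebesgue_integral[OF _ X_indep]) (simp_all add: X_int)
      ultimately show ?thesis using False by (simp add: X_mean)
    qed
    then show "integrable M (\<lambda>\<omega>. X i \<omega> * X j \<omega>)"
      "expectation (\<lambda>\<omega>. X i \<omega> * X j \<omega>) = (if i = j then s - e\<^sup>2 else 0)" by auto
  qed
  have S_sq: "(S \<omega>)\<^sup>2 = (\<Sum>i<n. \<Sum>j<n. X i \<omega> * X j \<omega>)" for \<omega>
    by (simp add: S_def power2_eq_square sum_product)
  have S_sq_int: "integrable M (\<lambda>\<omega>. (S \<omega>)\<^sup>2)" unfolding S_sq using prod(1) by simp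
  have S_second: "expectation (\<lambda>\<omega>. (S \<omega>)\<^sup>2) = real n * (s - e\<^sup>2)"
    unfolding S_sq by (subst Bochner_Integration.integral_sum; (subst Bochner_Integration.integral_sum)?)
      (simp_all add: prod)
  have S_int: "integrable M S" unfolding S_def using X_int by simp
  have S_mean: "expectation S = 0" unfolding S_def using X_int X_mean by simp
  have s: "0 \<le> s"
    unfolding second[of 0, symmetric] by simp
  show ?thesis
  proof (cases "n = 0")
    \<comment> \<open>For \<open>n = 0\<close> the factor \<open>sqrt (real n)\<close> is zero and
      the event is empty, as \<open>K > 0\<close>.\<close>
    case True
    then show ?thesis using K s by simp
  next
    case False
    then have n: "n > 0" by simp
    have "{\<omega> \<in> space M. K < \<bar>sqrt (real n) * ((1 / real n) * (\<Sum>i<n. Y i \<omega>) - e)\<bar>} \<subseteq>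
        {\<omega> \<in> space M. K * sqrt (real n) \<le> \<bar>S \<omega> - expectation S\<bar>}"
    proof safe
      fix \<omega> assume "K < \<bar>sqrt (real n) * ((1 / real n) * (\<Sum>i<n. Y i \<omega>) - e)\<bar>"
      moreover have "sqrt (real n) * ((1 / real n) * (\<Sum>i<n. Y i \<omega>) - e) = S \<omega> / sqrt (real n)"
        using n by (simp add: S_def X_def sum_subtractf field_simps)
      ultimately have "K < \<bar>S \<omega>\<bar> / sqrt (real n)" by simp
      then show "K * sqrt (real n) \<le> \<bar>S \<omega> - expectation S\<bar>"
        using n by (simp add: S_mean field_simps)
    qed
    then have "prob {\<omega> \<in> space M. K < \<bar>sqrt (real n) * ((1 / real n) * (\<Sum>i<n. Y i \<omega>) - e)\<bar>} \<le>
        prob {\<omega> \<in> space M. K * sqrt (real n) \<le> \<bar>S \<omega> - expectation S\<bar>}"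
      using S_int by (intro finite_measure_mono) auto
    also have "\<dots> \<le> variance S / (K * sqrt (real n))\<^sup>2"
      using S_int S_sq_int K n by (intro Chebyshev_inequality) auto
    also have "\<dots> = (s - e\<^sup>2) / K\<^sup>2"
      using n by (simp add: S_mean S_second power_mult_distrib)
    also have "\<dots> \<le> s / K\<^sup>2" by (intro divide_right_mono) auto
    finally show ?thesis .
  qed
qed

text \<open>Convergence along this filter is convergence as \<open>n \<rightarrow> \<infinity>\<close>, uniformly on the sets \<open>G n\<close>.\<close>
definition good_filter :: "(nat \<Rightarrow> 'a set) \<Rightarrow> (nat \<times> 'a) filter" where
  "good_filter G = inf (filtercomap fst sequentially) (principal {(n, \<omega>). \<omega> \<in> G n})"

lemma eventually_good_filter:
  "eventually P (good_filter G) \<longleftrightarrow> (\<exists>N. \<forall>n\<ge>N. \<forall>\<omega>\<in>G n. P (n, \<omega>))"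
proof
  assume "eventually P (good_filter G)"
  then obtain Q N where "\<And>n. n \<ge> N \<Longrightarrow> Q n" "\<And>c. Q (fst c) \<Longrightarrow> c \<in> {(n, \<omega>). \<omega> \<in> G n} \<Longrightarrow> P c"
    unfolding good_filter_def eventually_inf_principal eventually_filtercomap eventually_sequentially
    by blast
  then show "\<exists>N. \<forall>n\<ge>N. \<forall>\<omega>\<in>G n. P (n, \<omega>)" by (intro exI[of _ N]) simp
next
  assume "\<exists>N. \<forall>n\<ge>N. \<forall>\<omega>\<in>G n. P (n, \<omega>)"
  then obtain N where N: "\<And>n \<omega>. n \<ge> N \<Longrightarrow> \<omega> \<in> G n \<Longrightarrow> P (n, \<omega>)" by blast
  show "eventually P (good_filter G)"
    unfolding good_filter_def eventually_inf_principal eventually_filtercomap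
    by (rule exI[of _ "\<lambda>n. n \<ge> N"]) (auto intro: N eventually_ge_at_top)
qed

lemma filterlim_fst_good_filter: "filterlim fst at_top (good_filter G)"
  unfolding good_filter_def by (rule filterlim_mono[OF filterlim_filtercomap order_refl inf_le1])

text \<open>\<open>K\<close> is fixed by the prescribed probability before \<open>n\<close> grows.
  Convergence off the bad sets is therefore asked for each \<open>K\<close> separately, not
  uniformly in \<open>K\<close>.\<close>

lemma (in prob_space) conv_in_probI_good_filter:
  fixes X :: "nat \<Rightarrow> 'a \<Rightarrow> 'b::metric_space"
  assumes X: "\<And>n. X n \<in> borel_measurable M"
    and bad: "\<And>K n. K > 0 \<Longrightarrow> B K n \<in> events" "\<And>K n. K > 0 \<Longrightarrow> prob (B K n) \<le> C / K\<^sup>2"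
    and lim: "\<And>K. K > 0 \<Longrightarrow> ((\<lambda>(n, \<omega>). X n \<omega>) \<longlongrightarrow> c) (good_filter (\<lambda>n. space M - B K n))"
  shows "conv_in_prob M X c"
  unfolding conv_in_prob_def
proof (intro conjI allI impI X tendstoI)
  fix e d :: real assume "e > 0" "d > 0"
  \<comment> \<open>Chosen to make \<open>C / K\<^sup>2\<close> smaller than \<open>d\<close>;
    adding 1 to the absolute value of \<open>C\<close> keeps \<open>K\<close> positive and the
    inequality strict.\<close>
  define K where "K = sqrt ((\<bar>C\<bar> + 1) / d)"
  have K: "K > 0" unfolding K_def using \<open>d > 0\<close> by simp
  have "K\<^sup>2 = (\<bar>C\<bar> + 1) / d" unfolding K_def using \<open>d > 0\<close> by simp
  then have "d = (\<bar>C\<bar> + 1) / K\<^sup>2" using \<open>d > 0\<close> by (simp add: add_nonneg_eq_0_iff)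
  moreover have "C / K\<^sup>2 < (\<bar>C\<bar> + 1) / K\<^sup>2"
    using K by (intro divide_strict_right_mono) auto
  ultimately have CK: "C / K\<^sup>2 < d" by simp
  obtain N where N: "\<And>n \<omega>. n \<ge> N \<Longrightarrow> \<omega> \<in> space M - B K n \<Longrightarrow> dist (X n \<omega>) c < e"
    using tendstoD[OF lim[OF K] \<open>e > 0\<close>] unfolding eventually_good_filter by auto
  show "\<forall>\<^sub>F n in sequentially. dist (prob {\<omega> \<in> space M. dist (X n \<omega>) c > e}) 0 < d"
  proof (rule eventually_sequentiallyI)
    fix n assume "n \<ge> N"
    have "{\<omega> \<in> space M. dist (X n \<omega>) c > e} \<subseteq> B K n"
      using N[OF \<open>n \<ge> N\<close>] by fastforce
    then have "prob {\<omega> \<in> space M. dist (X n \<omega>) c > e} \<le> prob (B K n)"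
      by (rule finite_measure_mono) (rule bad(1)[OF K])
    also have "\<dots> < d" using bad(2)[OF K, of n] CK by linarith
    finally show "dist (prob {\<omega> \<in> space M. dist (X n \<omega>) c > e}) 0 < d" by simp
  qed
qed

lemma prod_list_map_count:
  fixes f :: "'p::finite \<Rightarrow> real"
  shows "prod_list (map f L) = (\<Prod>i\<in>UNIV. f i ^ count_list L i)"
proof (induction L)
  case (Cons a L)
  have "(\<Prod>i\<in>UNIV. f i ^ count_list (a # L) i) =
      (\<Prod>i\<in>UNIV. (if i = a then f a else 1) * f i ^ count_list L i)"
    by (intro prod.cong) auto
  then show ?case using Cons.IH by (simp add: prod.distrib)
qed simp

lemma (in prob_space) integrable_power_le:
  fixes X :: "'a \<Rightarrow> real"
  assumes X: "X \<in> borel_measurable M" and int: "integrable M (\<lambda>\<omega>. \<bar>X \<omega>\<bar> ^ m)" and "j \<le> m"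
  shows "integrable M (\<lambda>\<omega>. X \<omega> ^ j)"
proof (rule Bochner_Integration.integrable_bound[of M "\<lambda>\<omega>. 1 + \<bar>X \<omega>\<bar> ^ m"])
  show "AE \<omega> in M. norm (X \<omega> ^ j) \<le> norm (1 + \<bar>X \<omega>\<bar> ^ m)"
  proof (rule AE_I2)
    fix \<omega>
    have "\<bar>X \<omega>\<bar> ^ j \<le> 1 + \<bar>X \<omega>\<bar> ^ m"
    proof (cases "\<bar>X \<omega>\<bar> \<le> 1")
      case True
      then have "\<bar>X \<omega>\<bar> ^ j \<le> 1" by (simp add: power_le_one)
      then show ?thesis by (meson abs_ge_zero add_increasing2 zero_le_power)
    next
      case False
      then have "\<bar>X \<omega>\<bar> ^ j \<le> \<bar>X \<omega>\<bar> ^ m" using \<open>j \<le> m\<close> by (intro power_increasing) auto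
      then show ?thesis by simp
    qed
    then show "norm (X \<omega> ^ j) \<le> norm (1 + \<bar>X \<omega>\<bar> ^ m)"
      by (simp add: power_abs abs_of_nonneg add_nonneg_nonneg)
  qed
qed (use X int in auto)

section \<open>Borel measurability of matrices and of the inverse root\<close>

lemma borel_measurable_vec_components:
  fixes f :: "'a \<Rightarrow> 'b::euclidean_space ^ 'n"
  assumes "\<And>i. (\<lambda>\<omega>. f \<omega> $ i) \<in> borel_measurable M"
  shows "f \<in> borel_measurable M"
proof -
  have "(\<lambda>\<omega>. f \<omega> \<bullet> b) \<in> borel_measurable M" if "b \<in> Basis" for b
  proof -
    have "(\<lambda>\<omega>. \<Sum>i\<in>UNIV. f \<omega> $ i \<bullet> b $ i) \<in> borel_measurable M"
      using assms by measurable
    then show ?thesis by (simp add: inner_vec_def)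
  qed
  then show ?thesis by (subst borel_measurable_euclidean_space) blast
qed

lemma borel_measurable_matrix_entries:
  fixes f :: "'a \<Rightarrow> real ^ 'm ^ 'n"
  shows "f \<in> borel_measurable M \<longleftrightarrow> (\<forall>i j. (\<lambda>\<omega>. f \<omega> $ i $ j) \<in> borel_measurable M)"
proof safe
  fix i j assume f: "f \<in> borel_measurable M"
  have "(\<lambda>A :: real ^ 'm ^ 'n. A $ i $ j) \<in> borel_measurable borel"
    by (intro borel_measurable_continuous_onI continuous_intros)
  then show "(\<lambda>\<omega>. f \<omega> $ i $ j) \<in> borel_measurable M"
    using measurable_compose[OF f] by blast
next
  assume "\<forall>i j. (\<lambda>\<omega>. f \<omega> $ i $ j) \<in> borel_measurable M"
  then show "f \<in> borel_measurable M"
    by (intro borel_measurable_vec_components) auto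
qed

text \<open>Strict positivity at uncountably many \<open>v\<close> becomes a countable condition
  through the uniform lower bound: for each \<open>k\<close> the bound
  \<open>1 / real (Suc k)\<close> defines a closed set.\<close>

lemma borel_pos_def: "{A :: real ^ 'n ^ 'n. pos_def A} \<in> sets borel"
proof -
  have pd: "pos_def A \<longleftrightarrow> transpose A = A \<and> (\<exists>k::nat. \<forall>v. 1 / real (Suc k) * (v \<bullet> v) \<le> v \<bullet> (A *v v))"
    for A :: "real ^ 'n ^ 'n"
  proof
    assume A: "pos_def A"
    then obtain c where c: "c > 0" "\<And>v. c * (v \<bullet> v) \<le> v \<bullet> (A *v v)"
      using pos_def_lower_bound by blast
    obtain k where "1 / real (Suc k) < c" using nat_approx_posE[OF c(1)] by blast
    then have "1 / real (Suc k) * (v \<bullet> v) \<le> c * (v \<bullet> v)" for v :: "real ^ 'n"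
      by (intro mult_right_mono) auto
    then show "transpose A = A \<and> (\<exists>k::nat. \<forall>v. 1 / real (Suc k) * (v \<bullet> v) \<le> v \<bullet> (A *v v))"
      using A c(2) order_trans unfolding pos_def_def by blast
  next
    assume "transpose A = A \<and> (\<exists>k::nat. \<forall>v. 1 / real (Suc k) * (v \<bullet> v) \<le> v \<bullet> (A *v v))"
    then obtain k :: nat where k: "transpose A = A"
      "\<And>v. 1 / real (Suc k) * (v \<bullet> v) \<le> v \<bullet> (A *v v)" by blast
    have "0 < v \<bullet> (A *v v)" if "v \<noteq> 0" for v
    proof -
      have "0 < 1 / real (Suc k) * (v \<bullet> v)" using that by simp
      then show ?thesis using k(2)[of v] by linarith
    qed
    then show "pos_def A" using k(1) by (simp add: pos_def_def)
  qed
  have eq: "{A :: real ^ 'n ^ 'n. pos_def A} =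
      (\<Inter>i. \<Inter>j. {A. A $ i $ j = A $ j $ i}) \<inter>
      (\<Union>k::nat. \<Inter>v. {A. 1 / real (Suc k) * (v \<bullet> v) \<le> v \<bullet> (A *v v)})"
  proof (rule set_eqI)
    fix A :: "real ^ 'n ^ 'n"
    have "transpose A = A \<longleftrightarrow> (\<forall>i j. A $ i $ j = A $ j $ i)"
      by (auto simp: transpose_def vec_eq_iff)
    then show "A \<in> {A. pos_def A} \<longleftrightarrow> A \<in> (\<Inter>i. \<Inter>j. {A. A $ i $ j = A $ j $ i}) \<inter>
      (\<Union>k::nat. \<Inter>v. {A. 1 / real (Suc k) * (v \<bullet> v) \<le> v \<bullet> (A *v v)})"
      by (simp only: mem_Collect_eq pd Int_iff INT_iff UN_iff ball_UNIV bex_UNIV)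
  qed
  have "closed (\<Inter>v. {A :: real ^ 'n ^ 'n. 1 / real (Suc k) * (v \<bullet> v) \<le> v \<bullet> (A *v v)})" for k
    unfolding inner_vec_def matrix_vector_mult_def
    by (intro closed_INT ballI closed_Collect_le continuous_intros continuous_on_vec_lambda)
      (auto intro!: continuous_intros)
  moreover have "closed (\<Inter>i. \<Inter>j. {A :: real ^ 'n ^ 'n. A $ i $ j = A $ j $ i})"
    by (intro closed_INT ballI closed_Collect_eq continuous_intros)
  ultimately show ?thesis
    unfolding eq by (intro sets.Int sets.countable_UN borel_closed) auto
qed

lemma borel_measurable_inv_sqrt:
  "(\<lambda>A :: real ^ 'n ^ 'n. if pos_def A then inv_sqrt A else 0) \<in> borel_measurable borel"
  using borel_measurable_continuous_on_if[OF borel_pos_def continuous_on_inv_sqrt continuous_on_const]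
  by simp

section \<open>The estimator on a random sample\<close>

text \<open>\<open>N\<close> carries one copy of the random vector and \<open>M\<close> the sample.
  The two spaces are linked only by the distributions, through which moments are
  transferred.\<close>

locale iid_sample = N: prob_space N + M: prob_space M
  for N :: "'b measure" and M :: "'a measure" +
  fixes z :: "'b \<Rightarrow> real ^ 'p" and Z :: "nat \<Rightarrow> 'a \<Rightarrow> real ^ 'p"
  assumes z: "z \<in> borel_measurable N"
    and components_indep: "N.indep_vars (\<lambda>_. borel) (\<lambda>k \<omega>. z \<omega> $ k) UNIV"
    and mean: "\<And>k. integrable N (\<lambda>\<omega>. z \<omega> $ k)" "\<And>k. (LINT \<omega>|N. z \<omega> $ k) = 0"
    and variance: "\<And>k. N.variance (\<lambda>\<omega>. z \<omega> $ k) = 1"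
    and sample_indep: "M.indep_vars (\<lambda>_. borel) Z UNIV"
    and sample_distr: "\<And>i. distr M borel (Z i) = distr N borel z"
begin

definition \<mu> where "\<mu> k j = (LINT \<omega>|N. (z \<omega> $ k) ^ j)"

lemma z_component [measurable]: "(\<lambda>\<omega>. z \<omega> $ k) \<in> borel_measurable N"
  using measurable_compose[OF z borel_measurable_nth] .

lemma Z_measurable [measurable]: "Z i \<in> borel_measurable M"
  using sample_indep unfolding M.indep_vars_def by simp

lemma Z_component [measurable]: "(\<lambda>\<omega>. Z i \<omega> $ k) \<in> borel_measurable M"
  using measurable_compose[OF Z_measurable borel_measurable_nth] .

lemma \<mu>_values: "\<mu> k 0 = 1" "\<mu> k (Suc 0) = 0" "\<mu> k 2 = 1"
  "\<mu> k 3 = third_moment N z k" "\<mu> k 4 = fourth_moment N z k"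
  using variance[of k] mean(2)
  by (simp_all add: \<mu>_def N.prob_space third_moment_def fourth_moment_def)

lemma product_moment_integral:
  assumes "has_moments N z h" "length L \<le> h"
  shows "integrable N (\<lambda>\<omega>. prod_list (map (($) (z \<omega>)) L))"
    and "(LINT \<omega>|N. prod_list (map (($) (z \<omega>)) L)) = product_moment \<mu> L"
proof -
  have int: "integrable N (\<lambda>\<omega>. (z \<omega> $ k) ^ count_list L k)" for k
  proof (rule N.integrable_power_le)
    show "integrable N (\<lambda>\<omega>. \<bar>z \<omega> $ k\<bar> ^ h)" using assms(1) by (simp add: has_moments_def)
    show "count_list L k \<le> h" using assms(2) count_le_length[of L k] by linarith
  qed simp
  have indep: "N.indep_vars (\<lambda>_. borel) (\<lambda>k \<omega>. (z \<omega> $ k) ^ count_list L k) UNIV"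
    by (rule N.indep_vars_compose2[OF components_indep]) simp
  show "integrable N (\<lambda>\<omega>. prod_list (map (($) (z \<omega>)) L))"
    unfolding prod_list_map_count by (rule N.indep_vars_integrable[OF _ indep]) (simp_all add: int)
  show "(LINT \<omega>|N. prod_list (map (($) (z \<omega>)) L)) = product_moment \<mu> L"
    unfolding prod_list_map_count product_moment_def \<mu>_def
    by (rule N.indep_vars_lebesgue_integral[OF _ indep]) (simp_all add: int)
qed

lemma monomial_measurable: "(\<lambda>v :: real ^ 'p. prod_list (map (($) v) L)) \<in> borel_measurable borel"
  unfolding prod_list_map_count by measurable

lemma sample_moment_measurable [measurable]:
  "(\<lambda>\<omega>. sample_moment n (\<lambda>i. Z i \<omega>) L) \<in> borel_measurable M"
  unfolding sample_moment_def using measurable_compose[OF Z_measurable monomial_measurable] by measurable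

text \<open>The square of the monomial of \<open>L\<close> is the monomial of \<open>L @ L\<close>,
  whence the doubled length.\<close>

lemma sample_moment_deviation:
  assumes "has_moments N z h" "2 * length L \<le> h" "K > 0"
  shows "M.prob {\<omega> \<in> space M. K < \<bar>sqrt (real n) * (sample_moment n (\<lambda>i. Z i \<omega>) L - product_moment \<mu> L)\<bar>}
    \<le> product_moment \<mu> (L @ L) / K\<^sup>2"
proof -
  define g where "g v = prod_list (map (($) v) L)" for v :: "real ^ 'p"
  have g: "g \<in> borel_measurable borel" unfolding g_def by (rule monomial_measurable)
  have g2: "(\<lambda>v. (g v)\<^sup>2) \<in> borel_measurable borel" using g by simp
  have sq: "(g v)\<^sup>2 = prod_list (map (($) v) (L @ L))" for v
    by (simp add: g_def power2_eq_square)
  have int_z: "integrable N (\<lambda>\<omega>. g (z \<omega>))" "(LINT \<omega>|N. g (z \<omega>)) = product_moment \<mu> L"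
    using product_moment_integral[OF assms(1), of L] assms(2) by (simp_all add: g_def)
  have int2_z: "integrable N (\<lambda>\<omega>. (g (z \<omega>))\<^sup>2)" "(LINT \<omega>|N. (g (z \<omega>))\<^sup>2) = product_moment \<mu> (L @ L)"
    using product_moment_integral[OF assms(1), of "L @ L"] assms(2) unfolding sq by simp_all
  have transfer: "integrable M (\<lambda>\<omega>. f (Z i \<omega>)) \<longleftrightarrow> integrable N (\<lambda>\<omega>. f (z \<omega>))"
    "(LINT \<omega>|M. f (Z i \<omega>)) = (LINT \<omega>|N. f (z \<omega>))"
    if f: "f \<in> borel_measurable borel" for f :: "real ^ 'p \<Rightarrow> real" and i
  proof -
    show "integrable M (\<lambda>\<omega>. f (Z i \<omega>)) \<longleftrightarrow> integrable N (\<lambda>\<omega>. f (z \<omega>))"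
      using integrable_distr_eq[OF Z_measurable[of i] f] integrable_distr_eq[OF z f]
      by (simp add: sample_distr)
    show "(LINT \<omega>|M. f (Z i \<omega>)) = (LINT \<omega>|N. f (z \<omega>))"
      using integral_distr[OF Z_measurable[of i] f] integral_distr[OF z f] by (simp add: sample_distr)
  qed
  have "M.prob {\<omega> \<in> space M. K < \<bar>sqrt (real n) * ((1 / real n) * (\<Sum>i<n. g (Z i \<omega>)) - product_moment \<mu> L)\<bar>}
      \<le> product_moment \<mu> (L @ L) / K\<^sup>2"
  proof (rule M.sample_mean_deviation[where Y = "\<lambda>i \<omega>. g (Z i \<omega>)"])
    show "M.indep_vars (\<lambda>_. borel) (\<lambda>i \<omega>. g (Z i \<omega>)) UNIV"
      by (rule M.indep_vars_compose2[OF sample_indep]) (rule g)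
  qed (simp_all add: transfer[OF g] transfer[OF g2] int_z int2_z assms(3))
  then show ?thesis by (simp add: sample_moment_def g_def)
qed

text \<open>One event for all moments up to order \<open>r\<close>; there are finitely many of them,
  so the union bound keeps the order of \<open>1 / K\<^sup>2\<close>.\<close>

definition exceptional :: "nat \<Rightarrow> real \<Rightarrow> nat \<Rightarrow> 'a set" where
  "exceptional r K n = (\<Union>L\<in>{L. set L \<subseteq> UNIV \<and> length L \<le> r}.
     {\<omega> \<in> space M. K < \<bar>sqrt (real n) * (sample_moment n (\<lambda>i. Z i \<omega>) L - product_moment \<mu> L)\<bar>})"

lemma deviation_events [measurable]:
  "{\<omega> \<in> space M. K < \<bar>sqrt (real n) * (sample_moment n (\<lambda>i. Z i \<omega>) L - product_moment \<mu> L)\<bar>} \<in> sets M"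
  by measurable

lemma exceptional_events: "exceptional r K n \<in> sets M"
  unfolding exceptional_def by (intro sets.finite_UN finite_lists_length_le deviation_events) simp

lemma prob_exceptional:
  assumes "has_moments N z (2 * r)" "K > 0"
  shows "M.prob (exceptional r K n) \<le> (\<Sum>L\<in>{L. set L \<subseteq> UNIV \<and> length L \<le> r}. product_moment \<mu> (L @ L)) / K\<^sup>2"
proof -
  have "M.prob (exceptional r K n) \<le> (\<Sum>L\<in>{L. set L \<subseteq> UNIV \<and> length L \<le> r}. M.prob
     {\<omega> \<in> space M. K < \<bar>sqrt (real n) * (sample_moment n (\<lambda>i. Z i \<omega>) L - product_moment \<mu> L)\<bar>})"
    unfolding exceptional_def
    by (intro M.finite_measure_subadditive_finite finite_lists_length_le image_subsetI deviation_events) simp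
  also have "\<dots> \<le> (\<Sum>L\<in>{L. set L \<subseteq> UNIV \<and> length L \<le> r}. product_moment \<mu> (L @ L) / K\<^sup>2)"
    using assms by (intro sum_mono sample_moment_deviation[of "2 * r"]) auto
  finally show ?thesis by (simp add: sum_divide_distrib)
qed

text \<open>Off the exceptional sets \<open>K\<close> itself is the constant of the big-O bound, the
  same for all outcomes.\<close>

lemma sample_expansion_good:
  assumes "r \<ge> 3"
  shows "sample_expansion (good_filter (\<lambda>n. space M - exceptional r K n)) fst (\<lambda>c i. Z i (snd c)) \<mu> r"
proof
  fix L :: "'p list" assume L: "length L \<le> r"
  show "(\<lambda>c. sample_moment (fst c) (\<lambda>i. Z i (snd c)) L - product_moment \<mu> L)
      \<in> O[good_filter (\<lambda>n. space M - exceptional r K n)](\<lambda>c. 1 / sqrt (real (fst c)))"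
  proof (rule bigoI[where c = K], unfold eventually_good_filter, intro exI[of _ 1] allI impI ballI)
    fix n :: nat and \<omega> assume "n \<ge> 1" and \<omega>: "\<omega> \<in> space M - exceptional r K n"
    define d where "d = sample_moment n (\<lambda>i. Z i \<omega>) L - product_moment \<mu> L"
    have "\<bar>sqrt (real n) * d\<bar> \<le> K"
      using L \<omega> unfolding exceptional_def d_def by (force simp: not_less)
    then have "norm d \<le> K * norm (1 / sqrt (real n))"
      using \<open>n \<ge> 1\<close> by (simp add: abs_mult field_simps)
    then show "norm (sample_moment (fst (n, \<omega>)) (\<lambda>i. Z i (snd (n, \<omega>))) L - product_moment \<mu> L)
        \<le> K * norm (1 / sqrt (real (fst (n, \<omega>))))"
      by (simp add: d_def)
  qed
qed (use filterlim_fst_good_filter assms \<mu>_values in auto)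

lemma sample_cov_measurable [measurable]: "(\<lambda>\<omega>. sample_cov n (\<lambda>i. Z i \<omega>)) \<in> borel_measurable M"
  unfolding borel_measurable_matrix_entries sample_cov_def sample_mean_def
  by (simp, measurable)

lemma invertible_sample_cov_iff: "invertible (sample_cov n x) \<longleftrightarrow> pos_def (sample_cov n x)"
  using invertible_sample_cov_pos_def pos_def_invertible by blast

text \<open>Replacing the inverse root by \<open>0\<close> off the positive definite matrices makes the objective
  measurable without knowing the value of the description in \<open>inv_sqrt\<close> there.\<close>
definition whitening_matrix :: "nat \<Rightarrow> 'a \<Rightarrow> real ^ 'p ^ 'p" where
  "whitening_matrix n \<omega> = (if pos_def (sample_cov n (\<lambda>i. Z i \<omega>)) then inv_sqrt (sample_cov n (\<lambda>i. Z i \<omega>)) else 0)"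

lemma whitening_matrix_measurable: "whitening_matrix n \<in> borel_measurable M"
  unfolding whitening_matrix_def[abs_def]
  using measurable_compose[OF sample_cov_measurable borel_measurable_inv_sqrt] by simp

definition whitened :: "nat \<Rightarrow> 'a \<Rightarrow> nat \<Rightarrow> real ^ 'p" where
  "whitened n \<omega> i = whitening_matrix n \<omega> *v (Z i \<omega> - sample_mean n (\<lambda>i. Z i \<omega>))"

lemma whitened_measurable [measurable]: "(\<lambda>\<omega>. whitened n \<omega> i $ k) \<in> borel_measurable M"
proof -
  have [measurable]: "(\<lambda>\<omega>. whitening_matrix n \<omega> $ k $ j) \<in> borel_measurable M" for j
    using whitening_matrix_measurable[of n] unfolding borel_measurable_matrix_entries by blast
  show ?thesis
    unfolding whitened_def matrix_vector_mult_def sample_mean_def by (simp, measurable)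
qed

definition cumulants :: "nat \<Rightarrow> 'p + 'p \<times> 'p \<Rightarrow> 'a \<Rightarrow> real ^ 'p ^ 'p" where
  "cumulants n m \<omega> = case_sum (cumulant3 (uniform_count_measure {..<n}) (whitened n \<omega>))
    (\<lambda>(i, j). cumulant4 (uniform_count_measure {..<n}) (whitened n \<omega>) i j) m"

lemma cumulants_measurable [measurable]: "(\<lambda>\<omega>. cumulants n m \<omega> $ k $ l) \<in> borel_measurable M"
proof (cases m)
  case (Inl i)
  then show ?thesis
    by (simp add: cumulants_def cumulant3_def integral_uniform_count_measure)
next
  case (Inr ij)
  then show ?thesis
    by (cases ij) (simp add: cumulants_def cumulant4_def integral_uniform_count_measure)
qed

lemma sample_cumulants_eq:
  assumes "pos_def (sample_cov n (\<lambda>i. Z i \<omega>))"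
  shows "sample_cumulants n (\<lambda>i. Z i \<omega>) = (\<lambda>m. cumulants n m \<omega>)"
proof -
  have eq: "standardized n (\<lambda>i. Z i \<omega>) = whitened n \<omega>"
    using assms by (simp add: fun_eq_iff standardized_def whitened_def whitening_matrix_def)
  show ?thesis
    by (rule ext) (simp add: eq sample_cumulants_def cumulants_def sample_cumulant3_def
        sample_cumulant4_def split: sum.split)
qed

lemma measurable_solution:
  obtains U where "U \<in> borel_measurable M"
    "\<And>\<omega>. \<omega> \<in> space M \<Longrightarrow> pos_def (sample_cov n (\<lambda>i. Z i \<omega>)) \<Longrightarrow>
      is_arg_max (acm_objective \<alpha> n (\<lambda>i. Z i \<omega>)) orthogonal_matrix (U \<omega>)"
    "\<And>\<omega> V. \<omega> \<in> space M \<Longrightarrow> pos_def (sample_cov n (\<lambda>i. Z i \<omega>)) \<Longrightarrow>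
      is_arg_max (acm_objective \<alpha> n (\<lambda>i. Z i \<omega>)) orthogonal_matrix V \<Longrightarrow>
      dist (U \<omega>) (mat 1) \<le> dist V (mat 1)"
proof -
  define f where "f \<omega> = joint_diagonality (cumulant_indices \<alpha>) (cumulant_weight \<alpha>) (\<lambda>m. cumulants n m \<omega>)" for \<omega>
  have f: "f \<omega> = acm_objective \<alpha> n (\<lambda>i. Z i \<omega>)" if "pos_def (sample_cov n (\<lambda>i. Z i \<omega>))" for \<omega>
    using sample_cumulants_eq[OF that] by (simp add: f_def acm_objective_joint_diagonality)
  obtain U where U: "U \<in> borel_measurable M"
    "\<And>\<omega>. \<omega> \<in> space M \<Longrightarrow> is_arg_max (f \<omega>) (\<lambda>u. u \<in> {V. orthogonal_matrix V}) (U \<omega>)"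
    "\<And>\<omega> u. \<omega> \<in> space M \<Longrightarrow> is_arg_max (f \<omega>) (\<lambda>u. u \<in> {V. orthogonal_matrix V}) u \<Longrightarrow>
      dist (U \<omega>) (mat 1) \<le> dist u (mat 1)"
  proof (rule measurable_nearest_argmax[of "{V :: real ^ 'p ^ 'p. orthogonal_matrix V}" f M "mat 1"])
    show "compact {V :: real ^ 'p ^ 'p. orthogonal_matrix V}" by (rule compact_orthogonal_matrices)
    show "{V :: real ^ 'p ^ 'p. orthogonal_matrix V} \<noteq> {}" using orthogonal_matrix_id by blast
    show "(\<lambda>\<omega>. f \<omega> u) \<in> borel_measurable M" for u
      unfolding f_def joint_diagonality_def inner_vec_def matrix_vector_mult_def by (simp, measurable)
    show "continuous_on {V. orthogonal_matrix V} (f \<omega>)" for \<omega>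
      unfolding f_def by (rule continuous_on_joint_diagonality)
  qed blast
  show ?thesis
  proof (rule that[OF U(1)])
    fix \<omega> V assume \<omega>: "\<omega> \<in> space M" "pos_def (sample_cov n (\<lambda>i. Z i \<omega>))"
    show "is_arg_max (acm_objective \<alpha> n (\<lambda>i. Z i \<omega>)) orthogonal_matrix (U \<omega>)"
      using U(2)[OF \<omega>(1)] unfolding f[OF \<omega>(2)] by simp
    show "dist (U \<omega>) (mat 1) \<le> dist V (mat 1)"
      if "is_arg_max (acm_objective \<alpha> n (\<lambda>i. Z i \<omega>)) orthogonal_matrix V"
      using U(3)[OF \<omega>(1), of V] that unfolding f[OF \<omega>(2)] by simp
  qed
qed

lemma statistic_measurable [measurable]:
  "(\<lambda>\<omega>. s_hat n (\<lambda>i. Z i \<omega>) k l) \<in> borel_measurable M"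
  "(\<lambda>\<omega>. r_hat n (\<lambda>i. Z i \<omega>) k l) \<in> borel_measurable M"
  "(\<lambda>\<omega>. q_hat g n (\<lambda>i. Z i \<omega>) k l) \<in> borel_measurable M"
  unfolding s_hat_def r_hat_def q_hat_def by measurable

lemma psi_measurable [measurable]:
  "(\<lambda>\<omega>. psi1_hat g n (\<lambda>i. Z i \<omega>) k l) \<in> borel_measurable M"
  "(\<lambda>\<omega>. psi2_hat g b h n (\<lambda>i. Z i \<omega>) k l) \<in> borel_measurable M"
  unfolding psi1_hat_def psi2_hat_def by measurable

lemma eq_up_to_oP_good:
  assumes mom: "has_moments N z (2 * r)"
    and meas: "\<And>n. X n \<in> borel_measurable M" "\<And>n. Y n \<in> borel_measurable M"
    and small: "\<And>K. K > 0 \<Longrightarrow> (\<lambda>(n, \<omega>). X n \<omega> - Y n \<omega>)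
      \<in> o[good_filter (\<lambda>n. space M - exceptional r K n)](\<lambda>c. 1 / sqrt (real (fst c)))"
  shows "eq_up_to_oP M (\<lambda>n \<omega>. sqrt (real n) * X n \<omega>) (\<lambda>n \<omega>. sqrt (real n) * Y n \<omega>)"
  unfolding eq_up_to_oP_def
proof (rule M.conv_in_probI_good_filter[where B = "exceptional r"])
  show "(\<lambda>\<omega>. sqrt (real n) * X n \<omega> - sqrt (real n) * Y n \<omega>) \<in> borel_measurable M" for n
    using meas[of n] by measurable
  show "exceptional r K n \<in> sets M" for K n by (rule exceptional_events)
  show "M.prob (exceptional r K n) \<le> (\<Sum>L\<in>{L. set L \<subseteq> UNIV \<and> length L \<le> r}. product_moment \<mu> (L @ L)) / K\<^sup>2"
    if "K > 0" for K n by (rule prob_exceptional[OF mom that])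
  show "((\<lambda>(n, \<omega>). sqrt (real n) * X n \<omega> - sqrt (real n) * Y n \<omega>) \<longlongrightarrow> 0)
      (good_filter (\<lambda>n. space M - exceptional r K n))" if "K > 0" for K
    using smalloD_tendsto[OF small[OF that]]
    by (simp add: case_prod_unfold algebra_simps)
qed

text \<open>The three cases differ only in \<alpha> and in the order \<open>r\<close> of the moments
  that enter; \<open>zero\<close> says that at most one weight of the limiting objective
  vanishes.\<close>

theorem acm_asymptotics:
  fixes \<alpha> :: real
  defines "\<gamma> \<equiv> third_moment N z" and "\<beta> \<equiv> fourth_moment N z" and "\<kappa> \<equiv> excess_kurtosis N z"
  assumes \<alpha>: "\<alpha> \<in> {0..1}" and r: "r \<ge> 3" "\<alpha> \<noteq> 1 \<Longrightarrow> r \<ge> 4" and mom: "has_moments N z (2 * r)"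
    and zero: "\<And>k l. \<alpha> * (\<gamma> k)\<^sup>2 + (1 - \<alpha>) * (\<kappa> k)\<^sup>2 = 0 \<Longrightarrow> \<alpha> * (\<gamma> l)\<^sup>2 + (1 - \<alpha>) * (\<kappa> l)\<^sup>2 = 0 \<Longrightarrow> k = l"
  shows "\<exists>W. acm_solution_sequence M Z \<alpha> W \<and> conv_in_prob M W (mat 1) \<and>
    (\<forall>k. eq_up_to_oP M
       (\<lambda>n \<omega>. sqrt (real n) * (W n \<omega> $ k $ k - 1))
       (\<lambda>n \<omega>. - (1 / 2) * sqrt (real n) * (s_hat n (\<lambda>i. Z i \<omega>) k k - 1))) \<and>
    (\<forall>k l. l \<noteq> k \<longrightarrow> eq_up_to_oP M
       (\<lambda>n \<omega>. sqrt (real n) * W n \<omega> $ k $ l)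
       (\<lambda>n \<omega>. (\<alpha> * sqrt (real n) * psi1_hat \<gamma> n (\<lambda>i. Z i \<omega>) k l
               + (1 - \<alpha>) * sqrt (real n) * psi2_hat \<gamma> \<beta> \<kappa> n (\<lambda>i. Z i \<omega>) k l)
              / (\<alpha> * ((\<gamma> k)\<^sup>2 + (\<gamma> l)\<^sup>2) + (1 - \<alpha>) * ((\<kappa> k)\<^sup>2 + (\<kappa> l)\<^sup>2))))"
proof -
  let ?S = "\<lambda>n \<omega>. sample_cov n (\<lambda>i. Z i \<omega>)"
  let ?F = "\<lambda>K. good_filter (\<lambda>n. space M - exceptional r K n)"
  have "\<forall>n. \<exists>U. U \<in> borel_measurable M \<and> (\<forall>\<omega>\<in>space M. pos_def (?S n \<omega>) \<longrightarrow>
      is_arg_max (acm_objective \<alpha> n (\<lambda>i. Z i \<omega>)) orthogonal_matrix (U \<omega>) \<and>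
      (\<forall>V. is_arg_max (acm_objective \<alpha> n (\<lambda>i. Z i \<omega>)) orthogonal_matrix V \<longrightarrow>
        dist (U \<omega>) (mat 1) \<le> dist V (mat 1)))"
    using measurable_solution[of _ \<alpha>] by metis
  then obtain U where U_meas: "\<And>n. U n \<in> borel_measurable M"
    and U: "\<And>n \<omega>. \<omega> \<in> space M \<Longrightarrow> pos_def (?S n \<omega>) \<Longrightarrow>
      is_arg_max (acm_objective \<alpha> n (\<lambda>i. Z i \<omega>)) orthogonal_matrix (U n \<omega>) \<and>
      (\<forall>V. is_arg_max (acm_objective \<alpha> n (\<lambda>i. Z i \<omega>)) orthogonal_matrix V \<longrightarrow>
        dist (U n \<omega>) (mat 1) \<le> dist V (mat 1))"
    by metis
  define W where "W n \<omega> = U n \<omega> ** whitening_matrix n \<omega>" for n \<omega>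
  have W_entry [measurable]: "(\<lambda>\<omega>. W n \<omega> $ k $ l) \<in> borel_measurable M" for n k l
  proof -
    have [measurable]: "(\<lambda>\<omega>. U n \<omega> $ i $ j) \<in> borel_measurable M"
      "(\<lambda>\<omega>. whitening_matrix n \<omega> $ i $ j) \<in> borel_measurable M" for i j
      using U_meas[of n] whitening_matrix_measurable[of n] unfolding borel_measurable_matrix_entries by blast+
    show ?thesis unfolding W_def matrix_matrix_mult_def by simp
  qed
  have W_eq: "W n \<omega> = U n \<omega> ** inv_sqrt (?S n \<omega>)" if "pos_def (?S n \<omega>)" for n \<omega>
    using that by (simp add: W_def whitening_matrix_def)
  have sol: "acm_solution_sequence M Z \<alpha> W"
    unfolding acm_solution_sequence_def
  proof (intro allI conjI ballI impI)
    show "W n \<in> borel_measurable M" for n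
      unfolding borel_measurable_matrix_entries using W_entry by blast
    show "acm_solution \<alpha> n (\<lambda>i. Z i \<omega>) (W n \<omega>)"
      if "\<omega> \<in> space M" "invertible (?S n \<omega>)" for n \<omega>
      using U[of \<omega> n] W_eq[of n \<omega>] that unfolding acm_solution_def invertible_sample_cov_iff by blast
  qed
  have \<mu>: "\<mu> k 3 = \<gamma> k" "\<mu> k 4 = \<beta> k" "\<beta> k - 3 = \<kappa> k" for k
    by (simp_all add: \<mu>_values \<gamma>_def \<beta>_def \<kappa>_def excess_kurtosis_def)
  \<comment> \<open>This formula agrees with \<open>W\<close> only where the covariance matrix is
    positive definite. That holds eventually along every filter \<open>?F K\<close>, so expansions
    proved for the formula carry over by \<open>W_ev\<close>.\<close>
  let ?W' = "\<lambda>c. U (fst c) (snd c) ** inv_sqrt (?S (fst c) (snd c))"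
  have good: "\<forall>\<^sub>F c in ?F K. snd c \<in> space M \<and> pos_def (?S (fst c) (snd c))" for K
  proof -
    interpret E: sample_expansion "?F K" fst "\<lambda>c i. Z i (snd c)" \<mu> r
      by (rule sample_expansion_good[OF r(1)])
    have "\<forall>\<^sub>F c in ?F K. snd c \<in> space M" unfolding eventually_good_filter by auto
    then show ?thesis using E.S_pos_def unfolding E.S_def by eventually_elim simp
  qed
  have W_ev: "\<forall>\<^sub>F c in ?F K. ?W' c = W (fst c) (snd c)" for K
    using good[of K] by eventually_elim (simp add: W_eq)
  have max: "\<forall>\<^sub>F c in ?F K.
      is_arg_max (acm_objective \<alpha> (fst c) (\<lambda>i. Z i (snd c))) orthogonal_matrix (U (fst c) (snd c)) \<and>
      (\<forall>V. is_arg_max (acm_objective \<alpha> (fst c) (\<lambda>i. Z i (snd c))) orthogonal_matrix V \<longrightarrow>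
        dist (U (fst c) (snd c)) (mat 1) \<le> dist V (mat 1))" for K
    using good[of K] by (rule eventually_mono) (rule U; blast)
  have "k = l" if "\<alpha> * (\<mu> k 3)\<^sup>2 + (1 - \<alpha>) * (\<mu> k 4 - 3)\<^sup>2 = 0"
    "\<alpha> * (\<mu> l 3)\<^sup>2 + (1 - \<alpha>) * (\<mu> l 4 - 3)\<^sup>2 = 0" for k l
    using zero that unfolding \<mu> .
  note expansion = sample_expansion.acm_expansion[OF sample_expansion_good[OF r(1)] \<alpha> r(2) this max,
      unfolded \<mu> sample_expansion.\<epsilon>_def[OF sample_expansion_good[OF r(1)], abs_def]]
  have lim: "(?W' \<longlongrightarrow> mat 1) (?F K)" for K by (rule expansion(1))
  have diag: "(\<lambda>c. (?W' c $ k $ k - 1) - - (1 / 2) * (s_hat (fst c) (\<lambda>i. Z i (snd c)) k k - 1))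
      \<in> o[?F K](\<lambda>c. 1 / sqrt (real (fst c)))" for K k
    by (rule expansion(2))
  let ?t = "\<lambda>k l n \<omega>. (\<alpha> * psi1_hat \<gamma> n (\<lambda>i. Z i \<omega>) k l + (1 - \<alpha>) * psi2_hat \<gamma> \<beta> \<kappa> n (\<lambda>i. Z i \<omega>) k l)
      / (\<alpha> * ((\<gamma> k)\<^sup>2 + (\<gamma> l)\<^sup>2) + (1 - \<alpha>) * ((\<kappa> k)\<^sup>2 + (\<kappa> l)\<^sup>2))"
  have off: "(\<lambda>c. ?W' c $ k $ l - ?t k l (fst c) (snd c)) \<in> o[?F K](\<lambda>c. 1 / sqrt (real (fst c)))"
    if "l \<noteq> k" for K k l
    by (rule expansion(3)) (use that in simp_all)
  have "conv_in_prob M W (mat 1)"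
  proof (rule M.conv_in_probI_good_filter[where B = "exceptional r"])
    show "W n \<in> borel_measurable M" for n using sol by (simp add: acm_solution_sequence_def)
    show "exceptional r K n \<in> sets M" for K n by (rule exceptional_events)
    show "M.prob (exceptional r K n) \<le> (\<Sum>L\<in>{L. set L \<subseteq> UNIV \<and> length L \<le> r}. product_moment \<mu> (L @ L)) / K\<^sup>2"
      if "K > 0" for K n by (rule prob_exceptional[OF mom that])
    show "((\<lambda>(n, \<omega>). W n \<omega>) \<longlongrightarrow> mat 1) (?F K)" for K
      using Lim_transform_eventually[OF lim W_ev] by (simp add: case_prod_unfold)
  qed
  moreover have "eq_up_to_oP M (\<lambda>n \<omega>. sqrt (real n) * (W n \<omega> $ k $ k - 1))
      (\<lambda>n \<omega>. - (1 / 2) * sqrt (real n) * (s_hat n (\<lambda>i. Z i \<omega>) k k - 1))" for k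
  proof -
    have "eq_up_to_oP M (\<lambda>n \<omega>. sqrt (real n) * (W n \<omega> $ k $ k - 1))
        (\<lambda>n \<omega>. sqrt (real n) * (- (1 / 2) * (s_hat n (\<lambda>i. Z i \<omega>) k k - 1)))"
    proof (rule eq_up_to_oP_good[OF mom])
      fix K :: real
      have "\<forall>\<^sub>F c in ?F K. (?W' c $ k $ k - 1) - - (1 / 2) * (s_hat (fst c) (\<lambda>i. Z i (snd c)) k k - 1)
          = (\<lambda>(n, \<omega>). W n \<omega> $ k $ k - 1 - - (1 / 2) * (s_hat n (\<lambda>i. Z i \<omega>) k k - 1)) c"
        using W_ev[of K] by eventually_elim (simp add: case_prod_unfold)
      then show "(\<lambda>(n, \<omega>). W n \<omega> $ k $ k - 1 - - (1 / 2) * (s_hat n (\<lambda>i. Z i \<omega>) k k - 1))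
          \<in> o[?F K](\<lambda>c. 1 / sqrt (real (fst c)))"
        using diag[of k K] by (rule landau_o.small.in_cong[THEN iffD1])
    qed measurable
    then show ?thesis by (simp add: mult_ac)
  qed
  moreover have "eq_up_to_oP M (\<lambda>n \<omega>. sqrt (real n) * W n \<omega> $ k $ l)
       (\<lambda>n \<omega>. (\<alpha> * sqrt (real n) * psi1_hat \<gamma> n (\<lambda>i. Z i \<omega>) k l
               + (1 - \<alpha>) * sqrt (real n) * psi2_hat \<gamma> \<beta> \<kappa> n (\<lambda>i. Z i \<omega>) k l)
              / (\<alpha> * ((\<gamma> k)\<^sup>2 + (\<gamma> l)\<^sup>2) + (1 - \<alpha>) * ((\<kappa> k)\<^sup>2 + (\<kappa> l)\<^sup>2)))"
    if "l \<noteq> k" for k l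
  proof -
    have "eq_up_to_oP M (\<lambda>n \<omega>. sqrt (real n) * W n \<omega> $ k $ l) (\<lambda>n \<omega>. sqrt (real n) * ?t k l n \<omega>)"
    proof (rule eq_up_to_oP_good[OF mom])
      fix K :: real
      have "\<forall>\<^sub>F c in ?F K. ?W' c $ k $ l - ?t k l (fst c) (snd c)
          = (\<lambda>(n, \<omega>). W n \<omega> $ k $ l - ?t k l n \<omega>) c"
        using W_ev[of K] by eventually_elim (simp add: case_prod_unfold)
      then show "(\<lambda>(n, \<omega>). W n \<omega> $ k $ l - ?t k l n \<omega>) \<in> o[?F K](\<lambda>c. 1 / sqrt (real (fst c)))"
        using off[OF that, of K] by (rule landau_o.small.in_cong[THEN iffD1])
    qed measurable
    moreover have "sqrt (real n) * ?t k l n \<omega> = (\<alpha> * sqrt (real n) * psi1_hat \<gamma> n (\<lambda>i. Z i \<omega>) k l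
               + (1 - \<alpha>) * sqrt (real n) * psi2_hat \<gamma> \<beta> \<kappa> n (\<lambda>i. Z i \<omega>) k l)
              / (\<alpha> * ((\<gamma> k)\<^sup>2 + (\<gamma> l)\<^sup>2) + (1 - \<alpha>) * ((\<kappa> k)\<^sup>2 + (\<kappa> l)\<^sup>2))" for n \<omega>
      by (simp only: times_divide_eq_right distrib_left mult_ac)
    ultimately show ?thesis by (simp only:)
  qed
  ultimately show ?thesis using sol by blast
qed

end

theorem theorem5p2p1:
  fixes N :: "'b measure" and z :: "'b \<Rightarrow> real ^ 'p"
    and M :: "'a measure" and Z :: "nat \<Rightarrow> 'a \<Rightarrow> real ^ 'p"
    and \<gamma> \<beta> \<kappa> :: "'p \<Rightarrow> real"
  assumes N: "prob_space N" and z: "z \<in> borel_measurable N"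
    and components_indep:
      "prob_space.indep_vars N (\<lambda>_. borel) (\<lambda>k \<omega>. z \<omega> $ k) UNIV"
    and mean: "\<And>k. integrable N (\<lambda>\<omega>. z \<omega> $ k)" "\<And>k. (LINT \<omega>|N. z \<omega> $ k) = 0"
    and variance: "\<And>k. prob_space.variance N (\<lambda>\<omega>. z \<omega> $ k) = 1"
    and M: "prob_space M"
    and sample_indep: "prob_space.indep_vars M (\<lambda>_. borel) Z UNIV"
    and sample_distr: "\<And>i. distr M borel (Z i) = distr N borel z"
  defines "\<gamma> \<equiv> third_moment N z" and "\<beta> \<equiv> fourth_moment N z"
    and "\<kappa> \<equiv> excess_kurtosis N z"
  shows
    "(has_moments N z 6 \<longrightarrow> (\<exists>\<^sub>\<le>\<^sub>1 k. \<gamma> k = 0) \<longrightarrow>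
       (\<exists>W. acm_solution_sequence M Z 1 W \<and> conv_in_prob M W (mat 1) \<and>
          (\<forall>k. eq_up_to_oP M
             (\<lambda>n \<omega>. sqrt (real n) * (W n \<omega> $ k $ k - 1))
             (\<lambda>n \<omega>. - (1 / 2) * sqrt (real n) * (s_hat n (\<lambda>i. Z i \<omega>) k k - 1))) \<and>
          (\<forall>k l. l \<noteq> k \<longrightarrow> eq_up_to_oP M
             (\<lambda>n \<omega>. sqrt (real n) * W n \<omega> $ k $ l)
             (\<lambda>n \<omega>. sqrt (real n) * psi1_hat \<gamma> n (\<lambda>i. Z i \<omega>) k l / ((\<gamma> k)\<^sup>2 + (\<gamma> l)\<^sup>2)))))
     \<and>
     (has_moments N z 8 \<longrightarrow> (\<exists>\<^sub>\<le>\<^sub>1 k. \<kappa> k = 0) \<longrightarrow>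
       (\<exists>W. acm_solution_sequence M Z 0 W \<and> conv_in_prob M W (mat 1) \<and>
          (\<forall>k. eq_up_to_oP M
             (\<lambda>n \<omega>. sqrt (real n) * (W n \<omega> $ k $ k - 1))
             (\<lambda>n \<omega>. - (1 / 2) * sqrt (real n) * (s_hat n (\<lambda>i. Z i \<omega>) k k - 1))) \<and>
          (\<forall>k l. l \<noteq> k \<longrightarrow> eq_up_to_oP M
             (\<lambda>n \<omega>. sqrt (real n) * W n \<omega> $ k $ l)
             (\<lambda>n \<omega>. sqrt (real n) * psi2_hat \<gamma> \<beta> \<kappa> n (\<lambda>i. Z i \<omega>) k l / ((\<kappa> k)\<^sup>2 + (\<kappa> l)\<^sup>2)))))
     \<and>
     (\<forall>\<alpha>\<in>{0..1}. has_moments N z 8 \<longrightarrow> (\<exists>\<^sub>\<le>\<^sub>1 k. \<gamma> k = 0 \<and> \<kappa> k = 0) \<longrightarrow>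
       (\<alpha> = 1 \<longrightarrow> (\<exists>\<^sub>\<le>\<^sub>1 k. \<gamma> k = 0)) \<longrightarrow> (\<alpha> = 0 \<longrightarrow> (\<exists>\<^sub>\<le>\<^sub>1 k. \<kappa> k = 0)) \<longrightarrow>
       (\<exists>W. acm_solution_sequence M Z \<alpha> W \<and> conv_in_prob M W (mat 1) \<and>
          (\<forall>k. eq_up_to_oP M
             (\<lambda>n \<omega>. sqrt (real n) * (W n \<omega> $ k $ k - 1))
             (\<lambda>n \<omega>. - (1 / 2) * sqrt (real n) * (s_hat n (\<lambda>i. Z i \<omega>) k k - 1))) \<and>
          (\<forall>k l. l \<noteq> k \<longrightarrow> eq_up_to_oP M
             (\<lambda>n \<omega>. sqrt (real n) * W n \<omega> $ k $ l)
             (\<lambda>n \<omega>. (\<alpha> * sqrt (real n) * psi1_hat \<gamma> n (\<lambda>i. Z i \<omega>) k l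
                     + (1 - \<alpha>) * sqrt (real n) * psi2_hat \<gamma> \<beta> \<kappa> n (\<lambda>i. Z i \<omega>) k l)
                    / (\<alpha> * ((\<gamma> k)\<^sup>2 + (\<gamma> l)\<^sup>2) + (1 - \<alpha>) * ((\<kappa> k)\<^sup>2 + (\<kappa> l)\<^sup>2))))))"
proof -
  interpret S: iid_sample N M z Z
    by (intro iid_sample.intro iid_sample_axioms.intro N M z components_indep mean variance
        sample_indep sample_distr)
  show ?thesis
  proof (intro conjI impI ballI)
    assume "has_moments N z 6" "\<exists>\<^sub>\<le>\<^sub>1 k. \<gamma> k = 0"
    then show "\<exists>W. acm_solution_sequence M Z 1 W \<and> conv_in_prob M W (mat 1) \<and>
          (\<forall>k. eq_up_to_oP M
             (\<lambda>n \<omega>. sqrt (real n) * (W n \<omega> $ k $ k - 1))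
             (\<lambda>n \<omega>. - (1 / 2) * sqrt (real n) * (s_hat n (\<lambda>i. Z i \<omega>) k k - 1))) \<and>
          (\<forall>k l. l \<noteq> k \<longrightarrow> eq_up_to_oP M
             (\<lambda>n \<omega>. sqrt (real n) * W n \<omega> $ k $ l)
             (\<lambda>n \<omega>. sqrt (real n) * psi1_hat \<gamma> n (\<lambda>i. Z i \<omega>) k l / ((\<gamma> k)\<^sup>2 + (\<gamma> l)\<^sup>2)))"
      \<comment> \<open>Only third cumulants enter, so \<open>r = 3\<close> and
        \<open>2 * 3 = 6\<close> moments suffice; with kurtosis the same count is
        \<open>2 * 4 = 8\<close>.\<close>
      using S.acm_asymptotics[of 1 3] by (simp add: \<gamma>_def Uniq_def)
  next
    assume "has_moments N z 8" "\<exists>\<^sub>\<le>\<^sub>1 k. \<kappa> k = 0"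
    then show "\<exists>W. acm_solution_sequence M Z 0 W \<and> conv_in_prob M W (mat 1) \<and>
          (\<forall>k. eq_up_to_oP M
             (\<lambda>n \<omega>. sqrt (real n) * (W n \<omega> $ k $ k - 1))
             (\<lambda>n \<omega>. - (1 / 2) * sqrt (real n) * (s_hat n (\<lambda>i. Z i \<omega>) k k - 1))) \<and>
          (\<forall>k l. l \<noteq> k \<longrightarrow> eq_up_to_oP M
             (\<lambda>n \<omega>. sqrt (real n) * W n \<omega> $ k $ l)
             (\<lambda>n \<omega>. sqrt (real n) * psi2_hat \<gamma> \<beta> \<kappa> n (\<lambda>i. Z i \<omega>) k l / ((\<kappa> k)\<^sup>2 + (\<kappa> l)\<^sup>2)))"
      using S.acm_asymptotics[of 0 4] by (simp add: \<gamma>_def \<beta>_def \<kappa>_def Uniq_def)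
  next
    fix \<alpha> :: real
    assume \<alpha>: "\<alpha> \<in> {0..1}" and mom: "has_moments N z 8"
      and uniq: "\<exists>\<^sub>\<le>\<^sub>1 k. \<gamma> k = 0 \<and> \<kappa> k = 0"
        "\<alpha> = 1 \<longrightarrow> (\<exists>\<^sub>\<le>\<^sub>1 k. \<gamma> k = 0)" "\<alpha> = 0 \<longrightarrow> (\<exists>\<^sub>\<le>\<^sub>1 k. \<kappa> k = 0)"
    have zero: "k = l" if "\<alpha> * (\<gamma> k)\<^sup>2 + (1 - \<alpha>) * (\<kappa> k)\<^sup>2 = 0" "\<alpha> * (\<gamma> l)\<^sup>2 + (1 - \<alpha>) * (\<kappa> l)\<^sup>2 = 0"
      for k l
    proof -
      \<comment> \<open>For an interior \<alpha> the weight at \<open>k\<close> vanishes only if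
        \<open>\<gamma> k\<close> and \<open>\<kappa> k\<close> both do. At an endpoint one of them
        drops out of the weight, and the hypothesis for that endpoint takes over.\<close>
      consider "\<alpha> = 1" | "\<alpha> = 0" | "0 < \<alpha>" "\<alpha> < 1" using \<alpha> by fastforce
      then show ?thesis
      proof cases
        case 1
        then show ?thesis using that uniq(2) by (simp add: Uniq_def)
      next
        case 2
        then show ?thesis using that uniq(3) by (simp add: Uniq_def)
      next
        case 3
        then have "\<gamma> k = 0 \<and> \<kappa> k = 0" "\<gamma> l = 0 \<and> \<kappa> l = 0"
          using that by (simp_all add: add_nonneg_eq_0_iff)
        then show ?thesis using uniq(1) by (simp add: Uniq_def)
      qed
    qed
    show "\<exists>W. acm_solution_sequence M Z \<alpha> W \<and> conv_in_prob M W (mat 1) \<and>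
          (\<forall>k. eq_up_to_oP M
             (\<lambda>n \<omega>. sqrt (real n) * (W n \<omega> $ k $ k - 1))
             (\<lambda>n \<omega>. - (1 / 2) * sqrt (real n) * (s_hat n (\<lambda>i. Z i \<omega>) k k - 1))) \<and>
          (\<forall>k l. l \<noteq> k \<longrightarrow> eq_up_to_oP M
             (\<lambda>n \<omega>. sqrt (real n) * W n \<omega> $ k $ l)
             (\<lambda>n \<omega>. (\<alpha> * sqrt (real n) * psi1_hat \<gamma> n (\<lambda>i. Z i \<omega>) k l
                     + (1 - \<alpha>) * sqrt (real n) * psi2_hat \<gamma> \<beta> \<kappa> n (\<lambda>i. Z i \<omega>) k l)
                    / (\<alpha> * ((\<gamma> k)\<^sup>2 + (\<gamma> l)\<^sup>2) + (1 - \<alpha>) * ((\<kappa> k)\<^sup>2 + (\<kappa> l)\<^sup>2))))"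
      unfolding \<gamma>_def \<beta>_def \<kappa>_def
      by (rule S.acm_asymptotics[of \<alpha> 4])
        (use \<alpha> mom zero in \<open>simp_all add: \<gamma>_def \<kappa>_def\<close>)
  qed
qed

end
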